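(* The cut elimination reduction $\rightarrow$ on proof nets is strongly normalizing. The normal forms are cut free proof nets.
   Context: Write ⅋ for par and $\odot$ for the cut connective. Proof graphs $\langle P\mid\Gamma\rangle$ consist of an MLL linking tree $P$ (generated by $\mathsf1\mid a\otimes a^\perp\mid a^\perp\otimes a\mid\bot\otimes L\mid L\otimes\bot\mid L⅋L$) and a sequent with cuts $\Gamma$ (cuts $A\odot A^\perp$ only at roots) sharing the same leaves, such that every switching (one child edge of each ⅋-node deleted; $\odot$ behaves as $\otimes$) is connected and acyclic. Proof nets are $\sim$-classes of proof graphs, where $\sim$ is generated by commutativity/associativity of ⅋ in the linking, commutativity of $\otimes$, $\bot_i\otimes(Q\otimes\bot_j)\sim(\bot_i\otimes Q)\otimes\bot_j$, and $Q⅋(R\otimes\bot_i)\sim(Q⅋R)\otimes\bot_i$ (side condition: no node of $Q$ connected to $\bot_i$ in any switching with the edge from $\bot_i$ to its parent also removed). Cut reduction on graphs: $\langle P\mid(A⅋B)\odot(B^\perp\otimes A^\perp),\Gamma\rangle\to\langle P\mid A\odot A^\perp,B\odot B^\perp,\Gamma\rangle$; $\langle P[(a_h^\perp\otimes a_i)⅋(a_j^\perp\otimes a_k)]\mid a_i\odot a_j^\perp,\Gamma\rangle\to\langle P[a_h^\perp\otimes a_k]\mid\Gamma\rangle$; $\langle P[(Q\otimes\bot_i)⅋\mathsf1_j]\mid\bot_i\odot\mathsf1_j,\Gamma\rangle\to\langle P[Q]\mid\Gamma\rangle$. On nets, $[P\mid\Gamma]\to[Q\mid\Delta]$ iff there are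 $\langle P'\mid\Gamma\rangle\sim\langle P\mid\Gamma\rangle$ and $\langle Q'\mid\Delta\rangle\sim\langle Q\mid\Delta\rangle$ with $\langle P'\mid\Gamma\rangle\to\langle Q'\mid\Delta\rangle$. *)

theory Defs
  imports Main "HOL-Library.Multiset"
begin

section \<open>MLL with units: formulas, linkings, sequents with cuts\<close>

text \<open>Literals: positive atom a, negative atom a^perp, the units 1 and bot.\<close>
datatype 'a lit = Atom 'a | NAtom 'a | One | Bot

fun dlit :: "'a lit \<Rightarrow> 'a lit" where
  "dlit (Atom a) = NAtom a"
| "dlit (NAtom a) = Atom a"
| "dlit One = Bot"
| "dlit Bot = One"

fun is_atomic :: "'a lit \<Rightarrow> bool" where
  "is_atomic (Atom a) = True"
| "is_atomic (NAtom a) = True"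
| "is_atomic _ = False"

text \<open>Trees whose leaves are literal occurrences, indexed by a natural number
  (the occurrence name); internal nodes are tensor and par.  Used both for
  formulas of the sequent and for linkings.\<close>
datatype 'a tm = Leaf "'a lit" nat | Tens "'a tm" "'a tm" | Par "'a tm" "'a tm"

text \<open>Linear negation (on shapes): (A tensor B)^perp = B^perp par A^perp, etc.\<close>
fun dual :: "'a tm \<Rightarrow> 'a tm" where
  "dual (Leaf l i) = Leaf (dlit l) i"
| "dual (Tens A B) = Par (dual B) (dual A)"
| "dual (Par A B) = Tens (dual B) (dual A)"

text \<open>Forget the occurrence names.\<close>
fun erase :: "'a tm \<Rightarrow> 'a tm" where
  "erase (Leaf l i) = Leaf l 0"
| "erase (Tens A B) = Tens (erase A) (erase B)"
| "erase (Par A B) = Par (erase A) (erase B)"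

fun leaves :: "'a tm \<Rightarrow> ('a lit \<times> nat) list" where
  "leaves (Leaf l i) = [(l, i)]"
| "leaves (Tens A B) = leaves A @ leaves B"
| "leaves (Par A B) = leaves A @ leaves B"

text \<open>MLL linking trees:  1 | a tensor a^perp | a^perp tensor a | bot tensor L | L tensor bot | L par L.\<close>
inductive is_linking :: "'a tm \<Rightarrow> bool" where
  lk_one:  "is_linking (Leaf One i)"
| lk_ax1:  "is_linking (Tens (Leaf (Atom a) i) (Leaf (NAtom a) j))"
| lk_ax2:  "is_linking (Tens (Leaf (NAtom a) i) (Leaf (Atom a) j))"
| lk_botl: "is_linking L \<Longrightarrow> is_linking (Tens (Leaf Bot i) L)"
| lk_botr: "is_linking L \<Longrightarrow> is_linking (Tens L (Leaf Bot i))"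
| lk_par:  "is_linking L \<Longrightarrow> is_linking M \<Longrightarrow> is_linking (Par L M)"

text \<open>Items of a sequent with cuts: a formula, or a cut A (cut) B (intended B = A^perp).\<close>
datatype 'a item = Form "'a tm" | Cut "'a tm" "'a tm"

fun is_cut :: "'a item \<Rightarrow> bool" where
  "is_cut (Cut A B) = True"
| "is_cut (Form A) = False"

fun item_ok :: "'a item \<Rightarrow> bool" where
  "item_ok (Form A) = True"
| "item_ok (Cut A B) = (erase B = erase (dual A))"

text \<open>The tree of an item; a cut node behaves as a tensor node.\<close>
fun itree :: "'a item \<Rightarrow> 'a tm" where
  "itree (Form A) = A"
| "itree (Cut A B) = Tens A B"

definition seq_leaves :: "'a item multiset \<Rightarrow> ('a lit \<times> nat) multiset" where
  "seq_leaves \<Gamma> = \<Sum>\<^sub># (image_mset (\<lambda>c. mset (leaves (itree c))) \<Gamma>)"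

section \<open>Positions, subterms, replacement\<close>

fun poss :: "'a tm \<Rightarrow> bool list set" where
  "poss (Leaf l i) = {[]}"
| "poss (Tens A B) = insert [] (Cons False ` poss A \<union> Cons True ` poss B)"
| "poss (Par A B) = insert [] (Cons False ` poss A \<union> Cons True ` poss B)"

fun sub :: "'a tm \<Rightarrow> bool list \<Rightarrow> 'a tm" where
  "sub t [] = t"
| "sub (Leaf l i) (b # p) = Leaf l i"
| "sub (Tens A B) (b # p) = sub (if b then B else A) p"
| "sub (Par A B) (b # p) = sub (if b then B else A) p"

fun rep :: "'a tm \<Rightarrow> bool list \<Rightarrow> 'a tm \<Rightarrow> 'a tm" where
  "rep t [] u = u"
| "rep (Leaf l i) (b # p) u = Leaf l i"
| "rep (Tens A B) (b # p) u = (if b then Tens A (rep B p u) else Tens (rep A p u) B)"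
| "rep (Par A B) (b # p) u = (if b then Par A (rep B p u) else Par (rep A p u) B)"

section \<open>The graph of a proof graph and its switchings\<close>

text \<open>Vertices: shared leaves (by occurrence name), internal nodes of the linking
  (by position), internal nodes of the k-th item of the sequent (by position;
  the root of a cut item is the cut node).\<close>
datatype vtx = VLeaf nat | VLink "bool list" | VSeq nat "bool list"

definition nd_link :: "'a tm \<Rightarrow> bool list \<Rightarrow> vtx" where
  "nd_link P q = (case sub P q of Leaf l i \<Rightarrow> VLeaf i | _ \<Rightarrow> VLink q)"

definition nd_seq :: "'a tm \<Rightarrow> nat \<Rightarrow> bool list \<Rightarrow> vtx" where
  "nd_seq t k q = (case sub t q of Leaf l i \<Rightarrow> VLeaf i | _ \<Rightarrow> VSeq k q)"

text \<open>Edges of a tree under a switching s: a tensor node keeps both child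
  edges, a par node v keeps only the edge to child s v (the other is deleted).\<close>
definition tedges :: "'a tm \<Rightarrow> (bool list \<Rightarrow> vtx) \<Rightarrow> (vtx \<Rightarrow> bool) \<Rightarrow> vtx set set" where
  "tedges t nd s = {{nd p, nd (p @ [b])} | p b. p \<in> poss t \<and>
      (case sub t p of Leaf l i \<Rightarrow> False | Tens A B \<Rightarrow> True | Par A B \<Rightarrow> s (nd p) = b)}"

definition verts :: "'a tm \<Rightarrow> 'a item list \<Rightarrow> vtx set" where
  "verts P xs = nd_link P ` poss P \<union>
     (\<Union>k<length xs. nd_seq (itree (xs ! k)) k ` poss (itree (xs ! k)))"

definition swedges :: "'a tm \<Rightarrow> 'a item list \<Rightarrow> (vtx \<Rightarrow> bool) \<Rightarrow> vtx set set" where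
  "swedges P xs s = tedges P (nd_link P) s \<union>
     (\<Union>k<length xs. tedges (itree (xs ! k)) (nd_seq (itree (xs ! k)) k) s)"

text \<open>Undirected (simple) graphs given by a set of 2-element edges.\<close>
definition adj :: "'v set set \<Rightarrow> ('v \<times> 'v) set" where
  "adj E = {(u, v). {u, v} \<in> E}"

definition uconnected :: "'v set \<Rightarrow> 'v set set \<Rightarrow> bool" where
  "uconnected V E = (\<forall>u\<in>V. \<forall>v\<in>V. (u, v) \<in> (adj E)\<^sup>*)"

definition uacyclic :: "'v set set \<Rightarrow> bool" where
  "uacyclic E = (\<nexists>cs. 3 \<le> length cs \<and> distinct cs \<and>
      (\<forall>i<length cs. {cs ! i, cs ! (Suc i mod length cs)} \<in> E))"

definition switch_ok :: "'a tm \<Rightarrow> 'a item list \<Rightarrow> bool" where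
  "switch_ok P xs = (\<forall>s. uconnected (verts P xs) (swedges P xs s) \<and> uacyclic (swedges P xs s))"

section \<open>Proof graphs\<close>

type_synonym 'a pgraph = "'a tm \<times> 'a item multiset"

definition proof_graph :: "'a pgraph \<Rightarrow> bool" where
  "proof_graph G = (case G of (P, \<Gamma>) \<Rightarrow>
      is_linking P \<and> (\<forall>c\<in>#\<Gamma>. item_ok c) \<and>
      distinct (map snd (leaves P)) \<and> mset (leaves P) = seq_leaves \<Gamma> \<and>
      (\<forall>xs. mset xs = \<Gamma> \<longrightarrow> switch_ok P xs))"

section \<open>The equivalence \<sim>\<close>

text \<open>Side condition for Q par (R tensor bot_i) ~ (Q par R) tensor bot_i, the
  redex Q par (R tensor bot_i) sitting at position p of the linking: no node of Q
  is connected to bot_i in any switching once the edge from bot_i to its parent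
  (in the linking) is removed.\<close>
definition bot_detached :: "'a tm \<Rightarrow> 'a item list \<Rightarrow> bool list \<Rightarrow> nat \<Rightarrow> bool" where
  "bot_detached P xs p i = (\<forall>s. \<forall>q\<in>poss (sub P (p @ [False])).
      (VLeaf i, nd_link P (p @ [False] @ q))
        \<notin> (adj (swedges P xs s - {{nd_link P (p @ [True]), VLeaf i}}))\<^sup>*)"

inductive sim_step :: "'a pgraph \<Rightarrow> 'a pgraph \<Rightarrow> bool" where
  par_comm: "p \<in> poss P \<Longrightarrow> sub P p = Par Q R \<Longrightarrow>
     sim_step (P, \<Gamma>) (rep P p (Par R Q), \<Gamma>)"
| par_assoc: "p \<in> poss P \<Longrightarrow> sub P p = Par Q (Par R S) \<Longrightarrow>
     sim_step (P, \<Gamma>) (rep P p (Par (Par Q R) S), \<Gamma>)"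
| tens_comm: "p \<in> poss P \<Longrightarrow> sub P p = Tens Q R \<Longrightarrow>
     sim_step (P, \<Gamma>) (rep P p (Tens R Q), \<Gamma>)"
| bot_assoc: "p \<in> poss P \<Longrightarrow> sub P p = Tens (Leaf Bot i) (Tens Q (Leaf Bot j)) \<Longrightarrow>
     sim_step (P, \<Gamma>) (rep P p (Tens (Tens (Leaf Bot i) Q) (Leaf Bot j)), \<Gamma>)"
| bot_par: "p \<in> poss P \<Longrightarrow> sub P p = Par Q (Tens R (Leaf Bot i)) \<Longrightarrow>
     (\<forall>xs. mset xs = \<Gamma> \<longrightarrow> bot_detached P xs p i) \<Longrightarrow>
     sim_step (P, \<Gamma>) (rep P p (Tens (Par Q R) (Leaf Bot i)), \<Gamma>)"
| cut_sym: "sim_step (P, \<Gamma> + {#Cut A B#}) (P, \<Gamma> + {#Cut B A#})"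

text \<open>The equivalence relation on proof graphs generated by sim_step.\<close>
definition pg_sim :: "'a pgraph \<Rightarrow> 'a pgraph \<Rightarrow> bool" where
  "pg_sim = (\<lambda>G H. (sim_step G H \<or> sim_step H G) \<and> proof_graph G \<and> proof_graph H)\<^sup>*\<^sup>*"

definition is_net :: "'a pgraph set \<Rightarrow> bool" where
  "is_net N = (\<exists>G. proof_graph G \<and> N = {H. pg_sim G H})"

section \<open>Cut reduction\<close>

inductive gred :: "'a pgraph \<Rightarrow> 'a pgraph \<Rightarrow> bool" where
  red_par: "gred (P, \<Gamma> + {#Cut (Par A B) (Tens B' A')#}) (P, \<Gamma> + {#Cut A A', Cut B B'#})"
| red_ax: "p \<in> poss P \<Longrightarrow> is_atomic x \<Longrightarrow>
     sub P p = Par (Tens (Leaf (dlit x) h) (Leaf x i)) (Tens (Leaf (dlit x) j) (Leaf x k)) \<Longrightarrow>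
     gred (P, \<Gamma> + {#Cut (Leaf x i) (Leaf (dlit x) j)#}) (rep P p (Tens (Leaf (dlit x) h) (Leaf x k)), \<Gamma>)"
| red_unit: "p \<in> poss P \<Longrightarrow> sub P p = Par (Tens Q (Leaf Bot i)) (Leaf One j) \<Longrightarrow>
     gred (P, \<Gamma> + {#Cut (Leaf Bot i) (Leaf One j)#}) (rep P p Q, \<Gamma>)"

definition net_red :: "'a pgraph set \<Rightarrow> 'a pgraph set \<Rightarrow> bool" where
  "net_red N M = (is_net N \<and> is_net M \<and> (\<exists>G\<in>N. \<exists>H\<in>M. gred G H))"

definition cut_free_net :: "'a pgraph set \<Rightarrow> bool" where
  "cut_free_net N = (\<forall>G\<in>N. \<forall>c\<in>#snd G. \<not> is_cut c)"

end

theory Submission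
  imports Defs
begin

text \<open>
  Strong normalization holds because every reduction step lowers the number of binary nodes of the sequent, cuts
  included, which the equivalence leaves alone.

  For progress, cut the leaves of a switched proof graph into blocks, one for each connected piece of a switched
  tree. The number of edges minus the number of vertices of a switched graph does not depend on the switching, so
  correctness amounts to a count together with connectedness of the hypergraph of blocks for every switching.
  Conversely, by counting, no block can be split without disconnecting the hypergraph. In these terms the
  equivalences and reductions preserve correctness by short arguments.

  A cut between leaves needs these leaves in neighbouring parts of a par of the linking. Consider the lowest par
  separating them. Pars between it and a leaf are removed by associativity, and bottoms by the last equivalence.
  If both sides are of the form \<open>Q \<otimes> \<bottom>\<close>, consider for each of the two tensors its empire: the nodes connected
  to it in all switchings after removal of the edge to its bottom. Both empires contain the cut leaves, so by the
  nesting property of empires one of them contains the other tensor. This is the side condition for moving the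
  bottom.
\<close>

text \<open>Inner nodes of a proof graph are positions in a tree, so every rewriting of the linking
  renames them, whereas leaves keep their names. This is why correctness is moved to sets of leaves:
  a rewriting then alters a few blocks and leaves the rest of the multiset literally equal, and
  acyclicity, which would otherwise need surgery on cycles, becomes a number. Tightness of the count
  is used in one way only: splitting a block adds a hyperedge without adding incidences, hence must
  disconnect. Only pars and bottoms can lie between the separating par and a cut leaf because the
  grammar of linkings has no other tensors except axiom links, whose leaves are already in place.
  The obstacle is a bottom on each side: the side condition for moving one of them may fail, and
  nothing local tells which one is free. Nesting of empires shows that at least one is. Termination
  passes from graphs to nets since the weight is constant on classes; a step of nets may start from
  a representative other than the one at which the previous step ended.\<close>

subsection \<open>Connectedness of hypergraphs\<close>

definition hrel :: "'v set multiset \<Rightarrow> ('v \<times> 'v) set" where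
  "hrel M = {(u, v). \<exists>B\<in>#M. u \<in> B \<and> v \<in> B}"

definition hconn :: "'v set \<Rightarrow> 'v set multiset \<Rightarrow> bool" where
  "hconn V M \<longleftrightarrow> (\<forall>u\<in>V. \<forall>v\<in>V. (u, v) \<in> (hrel M)\<^sup>*)"

lemma hrel_stepI: "B \<in># M \<Longrightarrow> u \<in> B \<Longrightarrow> v \<in> B \<Longrightarrow> (u, v) \<in> (hrel M)\<^sup>*"
  unfolding hrel_def by blast

lemma hrel_sym: "(u, v) \<in> (hrel M)\<^sup>* \<Longrightarrow> (v, u) \<in> (hrel M)\<^sup>*"
proof -
  have "sym (hrel M)" unfolding hrel_def sym_def by blast
  then show "(u, v) \<in> (hrel M)\<^sup>* \<Longrightarrow> (v, u) \<in> (hrel M)\<^sup>*"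
    by (metis sym_rtrancl symD)
qed

text \<open>A chain is carried over one hyperedge at a time. The images need only be joined by a
  chain, so a hyperedge may be split or rerouted in the target.\<close>

lemma hrel_hom:
  assumes "(u, v) \<in> (hrel M)\<^sup>*"
    and "\<And>B u v. B \<in># M \<Longrightarrow> u \<in> B \<Longrightarrow> v \<in> B \<Longrightarrow> (f u, f v) \<in> (hrel M')\<^sup>*"
  shows "(f u, f v) \<in> (hrel M')\<^sup>*"
  using assms(1)
proof (induction rule: rtrancl_induct)
  case (step y z)
  then have "(f y, f z) \<in> (hrel M')\<^sup>*" using assms(2) unfolding hrel_def by blast
  with step.IH show ?case by (rule rtrancl_trans)
qed simp

lemma hrel_mono:
  assumes "(u, v) \<in> (hrel M)\<^sup>*" and "\<And>B. B \<in># M \<Longrightarrow> \<exists>C\<in>#M'. B \<subseteq> C"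
  shows "(u, v) \<in> (hrel M')\<^sup>*"
proof -
  have "(x, y) \<in> (hrel M')\<^sup>*" if "B \<in># M" "x \<in> B" "y \<in> B" for B x y
    using that assms(2)[of B] by (auto intro: hrel_stepI)
  then show ?thesis using hrel_hom[OF assms(1), of "\<lambda>x. x" M'] by blast
qed

text \<open>The form in which connectedness is transferred between two hypergraphs: \<open>f\<close>
  sends vertices that disappear to surviving ones and fixes those of \<open>V'\<close>.\<close>

lemma hconn_hom:
  assumes "hconn V M" "V' \<subseteq> V" "\<And>v. v \<in> V' \<Longrightarrow> f v = v"
    and "\<And>B u v. B \<in># M \<Longrightarrow> u \<in> B \<Longrightarrow> v \<in> B \<Longrightarrow> (f u, f v) \<in> (hrel M')\<^sup>*"
  shows "hconn V' M'"
  unfolding hconn_def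
proof (intro ballI)
  fix u v assume uv: "u \<in> V'" "v \<in> V'"
  then have "(u, v) \<in> (hrel M)\<^sup>*" using assms(1,2) unfolding hconn_def by blast
  then have "(f u, f v) \<in> (hrel M')\<^sup>*" using assms(4) by (rule hrel_hom)
  then show "(u, v) \<in> (hrel M')\<^sup>*" using uv assms(3) by simp
qed

lemma hconnI_star:
  assumes "\<And>v. v \<in> V \<Longrightarrow> (v, a) \<in> (hrel M)\<^sup>*" shows "hconn V M"
  unfolding hconn_def using assms by (blast intro: rtrancl_trans hrel_sym)

lemma sum_mset_card_image_le:
  assumes "\<forall>B\<in>#M. finite B"
  shows "(\<Sum>B\<in>#image_mset ((`) f) M. card B) \<le> (\<Sum>B\<in>#M. card B)"
  using assms by (induction M) (auto intro!: add_mono card_image_le)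

text \<open>The hypergraph version of the fact that a connected graph on n vertices has at least n -
  1 edges: contracting a hyperedge \<open>B\<close> to one point \<open>b\<close> keeps
  connectedness and loses at most \<open>card B - 1\<close> vertices.\<close>

lemma hconn_bound:
  assumes "finite V" "\<forall>B\<in>#M. finite B \<and> B \<noteq> {}" "hconn V M"
  shows "card V + size M \<le> (\<Sum>B\<in>#M. card B) + 1"
  using assms
proof (induction "size M" arbitrary: V M)
  case 0
  then have "\<forall>u\<in>V. \<forall>v\<in>V. u = v" unfolding hconn_def hrel_def by simp
  then have "card V \<le> 1" using 0(2) by (metis One_nat_def card_le_Suc0_iff_eq)
  then show ?case using 0 by simp
next
  case (Suc n M0)
  then obtain B M where M0: "M0 = add_mset B M" by (metis size_eq_Suc_imp_eq_union)
  note prems = Suc.prems[unfolded M0]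
  obtain b where b: "b \<in> B" using prems by auto
  define f where "f x = (if x \<in> B then b else x)" for x
  have "hconn (f ` V) (image_mset ((`) f) M)"
    unfolding hconn_def
  proof (intro ballI)
    fix u v assume "u \<in> f ` V" "v \<in> f ` V"
    then obtain x y where xy: "x \<in> V" "y \<in> V" "u = f x" "v = f y" by auto
    have "(x, y) \<in> (hrel (add_mset B M))\<^sup>*" using xy prems(3) unfolding hconn_def by blast
    moreover have "(f u, f v) \<in> (hrel (image_mset ((`) f) M))\<^sup>*"
      if "C \<in># add_mset B M" "u \<in> C" "v \<in> C" for C u v
    proof (cases "C \<in># M")
      case True
      then show ?thesis using that by (intro hrel_stepI[of "f ` C"]) auto
    next
      case False
      then show ?thesis using that by (auto simp: f_def)
    qed
    ultimately show "(u, v) \<in> (hrel (image_mset ((`) f) M))\<^sup>*"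
      unfolding xy by (rule hrel_hom)
  qed
  then have "card (f ` V) + size (image_mset ((`) f) M) \<le> (\<Sum>B\<in>#image_mset ((`) f) M. card B) + 1"
    using prems(1,2) Suc.hyps(2) M0 by (intro Suc.hyps(1)) auto
  also have "\<dots> \<le> (\<Sum>B\<in>#M. card B) + 1"
    using sum_mset_card_image_le[of M f] prems(2) by simp
  finally have 1: "card (f ` V) + size M \<le> (\<Sum>B\<in>#M. card B) + 1" by simp
  have B: "finite B" "card B \<ge> 1" using prems(2) by (auto simp: Suc_le_eq card_gt_0_iff)
  \<comment> \<open>Hyperedges need not lie inside \<open>V\<close>; when \<open>B\<close> misses
    \<open>V\<close>, the contraction loses no vertex.\<close>
  have "card V + 1 \<le> card (f ` V) + card B"
  proof (cases "V \<inter> B = {}")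
    case True
    then have "f ` V = V" by (auto simp: f_def image_def)
    then show ?thesis using B by simp
  next
    case False
    then have "f ` V = insert b (V - B)" by (auto simp: f_def image_def)
    then have "card (f ` V) = card (V - B) + 1" using b prems(1) by simp
    moreover have "card V = card (V - B) + card (V \<inter> B)"
      using prems(1) by (metis add.commute card_Diff_subset_Int card_mono finite_Int inf_le1 le_add_diff_inverse)
    moreover have "card (V \<inter> B) \<le> card B" using B by (simp add: card_mono)
    ultimately show ?thesis by simp
  qed
  then show ?case using 1 M0 by simp
qed

text \<open>The opposite bound for forests, again by contraction. Since no two points of a hyperedge
  are joined by the others, contracting \<open>B\<close> is injective on every other hyperedge,
  which keeps its size, and loses exactly \<open>card B - 1\<close> vertices.\<close>

lemma forest_bound:
  assumes "finite V" "V \<noteq> {}" "\<forall>B\<in>#M. B \<noteq> {} \<and> B \<subseteq> V"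
    and "\<And>B M' u v. M = add_mset B M' \<Longrightarrow> u \<in> B \<Longrightarrow> v \<in> B \<Longrightarrow> u \<noteq> v \<Longrightarrow> (u, v) \<notin> (hrel M')\<^sup>*"
  shows "(\<Sum>B\<in>#M. card B) + 1 \<le> card V + size M"
  using assms
proof (induction M arbitrary: V rule: measure_induct_rule[of size])
  case (less M0)
  show ?case
  proof (cases "M0 = {#}")
    case True
    then show ?thesis using less.prems by (simp add: Suc_le_eq card_gt_0_iff)
  next
    case False
    then obtain B M where M0: "M0 = add_mset B M" by (meson multiset_nonemptyE mset_add)
    then obtain b where b: "b \<in> B" using less.prems(3) by auto
    have BV: "B \<subseteq> V" using less.prems(3) M0 by simp
    define f where "f x = (if x \<in> B then b else x)" for x
    let ?I = "image_mset ((`) f) M"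
    have f: "(x, f x) \<in> (hrel (add_mset B N))\<^sup>*" for x N
      using b by (auto simp: f_def intro: hrel_stepI[of B])
    \<comment> \<open>Two points of \<open>C\<close> identified by the contraction both lie in
      \<open>B\<close>, so \<open>B\<close> would join them.\<close>
    have inj: "inj_on f C" if C: "C \<in># M" for C
    proof (rule inj_onI, rule ccontr)
      fix c d assume cd: "c \<in> C" "d \<in> C" "f c = f d" "c \<noteq> d"
      then have "c \<in> B" "d \<in> B" using b by (auto simp: f_def split: if_splits)
      moreover obtain N where "M = add_mset C N" using C by (meson mset_add)
      ultimately show False using less.prems(4)[of C "add_mset B N" c d] cd M0
        by (simp add: add_mset_commute hrel_stepI[of B])
    qed
    have "(\<Sum>B\<in>#?I. card B) + 1 \<le> card (f ` V) + size ?I"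
    proof (rule less.IH)
      show "size ?I < size M0" using M0 by simp
      show "finite (f ` V)" "f ` V \<noteq> {}" using less.prems by auto
      show "\<forall>B\<in>#?I. B \<noteq> {} \<and> B \<subseteq> f ` V" using less.prems(3) M0 by auto
      fix C' N' u v assume h: "?I = add_mset C' N'" "u \<in> C'" "v \<in> C'" "u \<noteq> v"
      then obtain C N where CN: "M = add_mset C N" "C' = f ` C" "N' = image_mset ((`) f) N"
        by (metis msed_map_invR)
      then obtain c d where cd: "c \<in> C" "d \<in> C" "u = f c" "v = f d" using h by auto
      show "(u, v) \<notin> (hrel N')\<^sup>*"
      proof
        assume "(u, v) \<in> (hrel N')\<^sup>*"
        moreover have "(x, y) \<in> (hrel (add_mset B N))\<^sup>*" if D: "D \<in># N'" "x \<in> D" "y \<in> D" for D x y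
        proof -
          obtain C' x' y' where *: "C' \<in># N" "x' \<in> C'" "y' \<in> C'" "x = f x'" "y = f y'"
            using D CN(3) by auto
          then have "(x', y') \<in> (hrel (add_mset B N))\<^sup>*" by (auto intro: hrel_stepI[of C'])
          then show ?thesis using hrel_sym[OF f[of x' N]] f[of y' N] unfolding *(4,5) by (meson rtrancl_trans)
        qed
        ultimately have "(u, v) \<in> (hrel (add_mset B N))\<^sup>*"
          using hrel_hom[of u v N' "\<lambda>x. x" "add_mset B N"] by blast
        then have "(c, d) \<in> (hrel (add_mset B N))\<^sup>*"
          using f[of c N] hrel_sym[OF f[of d N]] unfolding cd(3,4) by (meson rtrancl_trans)
        moreover have "c \<noteq> d" using cd h by auto
        ultimately show False using less.prems(4)[of C "add_mset B N" c d] cd M0 CN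
          by (simp add: add_mset_commute)
      qed
    qed
    moreover have "(\<Sum>B\<in>#?I. card B) = (\<Sum>B\<in>#M. card B)"
      using inj by (simp add: multiset.map_comp comp_def card_image cong: image_mset_cong)
    moreover have "f ` V = insert b (V - B)" using b BV by (auto simp: f_def image_def)
    then have "card (f ` V) = card (V - B) + 1" using b less.prems(1) by simp
    moreover have "card V = card (V - B) + card B"
      using BV less.prems(1) by (metis add.commute card_Diff_subset card_mono finite_subset le_add_diff_inverse)
    ultimately show ?thesis using M0 by simp
  qed
qed

text \<open>A chain that used the split hyperedge can be restarted from \<open>a\<close> or from
  \<open>b\<close>, so at most two components arise.\<close>

lemma split_block_conn:
  assumes "hconn V (add_mset (A \<union> B) M)" "a \<in> A" "b \<in> B" "a \<in> V" "v \<in> V"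
  shows "(v, a) \<in> (hrel (add_mset A (add_mset B M)))\<^sup>* \<or> (v, b) \<in> (hrel (add_mset A (add_mset B M)))\<^sup>*"
    (is "(v, a) \<in> ?R \<or> (v, b) \<in> ?R")
proof -
  have "(a, v) \<in> (hrel (add_mset (A \<union> B) M))\<^sup>*" using assms unfolding hconn_def by blast
  then show ?thesis
  proof (induction rule: rtrancl_induct)
    case (step y z)
    then obtain C where C: "C \<in># add_mset (A \<union> B) M" "y \<in> C" "z \<in> C" unfolding hrel_def by blast
    show ?case
    proof (cases "C \<in># M")
      case True
      then have "(z, y) \<in> ?R" using C by (auto intro: hrel_stepI[of C])
      then show ?thesis using step.IH by (meson rtrancl_trans)
    next
      case False
      then have "z \<in> A \<or> z \<in> B" using C by auto
      then show ?thesis using assms(2,3) by (auto intro: hrel_stepI[of A] hrel_stepI[of B])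
    qed
  qed simp
qed

text \<open>Were \<open>a\<close> and \<open>b\<close> still joined, the split hypergraph would be
  connected, with one hyperedge more and the same number of incidences. This contradicts
  \<open>hconn_bound\<close>, as the count was already tight.\<close>

lemma split_block_not_conn:
  assumes "finite V" "hconn V (add_mset (A \<union> B) M)" "\<forall>C\<in>#add_mset (A \<union> B) M. finite C \<and> C \<noteq> {}"
    and "(\<Sum>C\<in>#add_mset (A \<union> B) M. card C) + 1 \<le> card V + size (add_mset (A \<union> B) M)"
    and "A \<inter> B = {}" "a \<in> A" "b \<in> B"
  shows "(a, b) \<notin> (hrel (add_mset A (add_mset B M)))\<^sup>*"
proof
  assume ab: "(a, b) \<in> (hrel (add_mset A (add_mset B M)))\<^sup>*"
  let ?N = "add_mset A (add_mset B M)"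
  have "hconn V ?N"
  proof (rule hconn_hom[OF assms(2)])
    fix C u v assume C: "C \<in># add_mset (A \<union> B) M" "u \<in> C" "v \<in> C"
    show "(u, v) \<in> (hrel ?N)\<^sup>*"
    proof (cases "C \<in># M")
      case True
      then show ?thesis using C by (auto intro: hrel_stepI[of C])
    next
      case False
      then have uv: "u \<in> A \<union> B" "v \<in> A \<union> B" using C by auto
      have "(w, a) \<in> (hrel ?N)\<^sup>*" if "w \<in> A \<union> B" for w
        using that assms(6,7) hrel_sym[OF ab]
        by (auto intro: hrel_stepI[of A] rtrancl_trans[OF hrel_stepI[of B]])
      then show ?thesis using uv by (blast intro: rtrancl_trans hrel_sym)
    qed
  qed auto
  moreover have fin: "finite A" "finite B" using assms(3) by auto
  ultimately have "card V + size ?N \<le> (\<Sum>C\<in>#?N. card C) + 1"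
    using assms by (intro hconn_bound) auto
  moreover have "card (A \<union> B) = card A + card B" using assms(5) fin by (simp add: card_Un_disjoint)
  ultimately show False using assms(4) by simp
qed

section \<open>Graphs: cycles, bridges and trees\<close>

lemma adj_sym: "(u, v) \<in> (adj E)\<^sup>* \<Longrightarrow> (v, u) \<in> (adj E)\<^sup>*"
proof -
  have "sym (adj E)" unfolding adj_def sym_def by (auto simp: insert_commute)
  then show "(u, v) \<in> (adj E)\<^sup>* \<Longrightarrow> (v, u) \<in> (adj E)\<^sup>*"
    by (metis sym_rtrancl symD)
qed

lemma adj_mono: "E \<subseteq> F \<Longrightarrow> (u, v) \<in> (adj E)\<^sup>* \<Longrightarrow> (u, v) \<in> (adj F)\<^sup>*"
  by (rule subsetD[OF rtrancl_mono]) (auto simp: adj_def)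

lemma adjI: "{u, v} \<in> E \<Longrightarrow> (u, v) \<in> (adj E)\<^sup>*"
  by (auto simp: adj_def)

lemma rtrancl_simple_path:
  assumes "(a, b) \<in> R\<^sup>*"
  shows "\<exists>cs. cs \<noteq> [] \<and> distinct cs \<and> hd cs = a \<and> last cs = b \<and> successively (\<lambda>u v. (u, v) \<in> R) cs"
  using assms
proof (induction rule: rtrancl_induct)
  case base
  show ?case by (rule exI[of _ "[a]"]) simp
next
  case (step y z)
  then obtain cs where cs: "cs \<noteq> []" "distinct cs" "hd cs = a" "last cs = y"
    "successively (\<lambda>u v. (u, v) \<in> R) cs" by blast
  show ?case
  proof (cases "z \<in> set cs")
    case True
    then obtain ys zs where "cs = ys @ z # zs" by (meson split_list)
    then show ?thesis using cs
      by (intro exI[of _ "ys @ [z]"]) (auto simp: successively_append_iff hd_append split: if_splits)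
  next
    case False
    then show ?thesis using cs step(2)
      by (intro exI[of _ "cs @ [z]"]) (auto simp: successively_append_iff)
  qed
qed

text \<open>A detour around the edge \<open>{a, b}\<close> can be made simple, and the edge closes
  it to a cycle.\<close>

lemma uacyclic_bridge:
  assumes "uacyclic E" "{a, b} \<in> E" "a \<noteq> b"
  shows "(a, b) \<notin> (adj (E - {{a, b}}))\<^sup>*"
proof
  assume "(a, b) \<in> (adj (E - {{a, b}}))\<^sup>*"
  from rtrancl_simple_path[OF this] obtain cs where cs: "cs \<noteq> []" "distinct cs" "hd cs = a" "last cs = b"
    and succ: "successively (\<lambda>u v. (u, v) \<in> adj (E - {{a, b}})) cs" by blast
  have step: "{cs ! i, cs ! Suc i} \<in> E - {{a, b}}" if "Suc i < length cs" for i
    using succ that unfolding successively_conv_nth adj_def by auto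
  have h: "cs ! 0 = a" "cs ! (length cs - 1) = b" using cs by (simp_all add: hd_conv_nth last_conv_nth)
  then have "length cs \<noteq> 1" "length cs \<noteq> 0" using assms(3) cs(1) by auto
  \<comment> \<open>A simple path of two vertices would be the removed edge itself.\<close>
  moreover have "length cs \<noteq> 2" using step[of 0] h by auto
  ultimately have len: "3 \<le> length cs" by linarith
  moreover have "{cs ! i, cs ! (Suc i mod length cs)} \<in> E" if "i < length cs" for i
  proof (cases "Suc i < length cs")
    case True
    then show ?thesis using step[of i] by simp
  next
    case False
    then have "Suc i = length cs" using that by simp
    then have "i = length cs - 1" "Suc i mod length cs = 0" by auto
    then show ?thesis using h assms(2) by (simp add: insert_commute)
  qed
  ultimately show False using assms(1) cs(2) unfolding uacyclic_def by blast
qed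

text \<open>The rest of a cycle bypasses its first edge. Together with
  \<open>uacyclic_bridge\<close> this turns acyclicity into a statement on connectedness.\<close>

lemma uacyclicI_bridge:
  assumes "\<And>a b. {a, b} \<in> E \<Longrightarrow> a \<noteq> b \<Longrightarrow> (a, b) \<notin> (adj (E - {{a, b}}))\<^sup>*"
  shows "uacyclic E"
  unfolding uacyclic_def
proof
  assume "\<exists>cs. 3 \<le> length cs \<and> distinct cs \<and> (\<forall>i<length cs. {cs ! i, cs ! (Suc i mod length cs)} \<in> E)"
  then obtain cs where cs: "3 \<le> length cs" "distinct cs"
    and E: "\<And>i. i < length cs \<Longrightarrow> {cs ! i, cs ! (Suc i mod length cs)} \<in> E" by blast
  let ?e = "{cs ! 0, cs ! 1}"
  have nth: "cs ! i = cs ! j \<longleftrightarrow> i = j" if "i < length cs" "j < length cs" for i j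
    using cs(2) that by (simp add: nth_eq_iff_index_eq)
  have ind: "(cs ! 1, cs ! Suc k) \<in> (adj (E - {?e}))\<^sup>*" if "Suc k < length cs" for k
    using that
  proof (induction k)
    case (Suc k)
    have "{cs ! Suc k, cs ! Suc (Suc k)} \<in> E" using E[of "Suc k"] Suc.prems by simp
    moreover have "cs ! Suc k \<noteq> cs ! 0" "cs ! Suc (Suc k) \<noteq> cs ! 0"
      using Suc.prems nth[of "Suc k" 0] nth[of "Suc (Suc k)" 0] by linarith+
    then have "{cs ! Suc k, cs ! Suc (Suc k)} \<noteq> ?e" by (simp add: doubleton_eq_iff)
    ultimately have "(cs ! Suc k, cs ! Suc (Suc k)) \<in> adj (E - {?e})" by (simp add: adj_def)
    with Suc show ?case by (auto intro: rtrancl_into_rtrancl)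
  qed simp
  obtain n where n: "length cs = Suc (Suc (Suc n))" 
    using that[of "length cs - 3"] cs(1) by simp
  have "{cs ! Suc (Suc n), cs ! 0} \<in> E" using E[of "Suc (Suc n)"] n by simp
  moreover have "cs ! Suc (Suc n) \<noteq> cs ! 0" "cs ! Suc (Suc n) \<noteq> cs ! 1"
    using n nth[of "Suc (Suc n)" 0] nth[of "Suc (Suc n)" 1] by auto
  then have "{cs ! Suc (Suc n), cs ! 0} \<noteq> ?e" by (simp add: doubleton_eq_iff)
  ultimately have "(cs ! Suc (Suc n), cs ! 0) \<in> adj (E - {?e})" by (simp add: adj_def)
  then have "(cs ! 1, cs ! 0) \<in> (adj (E - {?e}))\<^sup>*"
    using ind[of "Suc n"] n by (auto intro: rtrancl_into_rtrancl)
  then have "(cs ! 0, cs ! 1) \<in> (adj (E - {?e}))\<^sup>*" by (rule adj_sym)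
  moreover have "?e \<in> E" "cs ! 0 \<noteq> cs ! 1" using E[of 0] n nth[of 0 1] by auto
  ultimately show False using assms by blast
qed

text \<open>Views a graph as a hypergraph, so that the two bounds above apply to it.\<close>

lemma hrel_mset_set_adj:
  assumes "finite E" "\<forall>e\<in>E. \<exists>u w. e = {u, w}"
  shows "(hrel (mset_set E))\<^sup>* = (adj E)\<^sup>*"
proof -
  have "hrel (mset_set E) \<subseteq> (adj E)\<^sup>*"
  proof clarify
    fix u v assume "(u, v) \<in> hrel (mset_set E)"
    then obtain B where B: "B \<in> E" "u \<in> B" "v \<in> B" using assms(1) unfolding hrel_def by auto
    then obtain x y where "B = {x, y}" using assms(2) by blast
    then have "u = v \<or> B = {u, v}" using B by auto
    then show "(u, v) \<in> (adj E)\<^sup>*" using B by (auto simp: adj_def)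
  qed
  moreover have "adj E \<subseteq> hrel (mset_set E)"
    using assms(1) unfolding adj_def hrel_def by auto
  ultimately show ?thesis using rtrancl_mono rtrancl_subset_rtrancl by blast
qed

lemma uconnected_card_bound:
  assumes "finite V" "finite E" "\<forall>e\<in>E. \<exists>u w. e = {u, w} \<and> u \<noteq> w" "uconnected V E"
  shows "card V \<le> card E + 1"
proof -
  have "hconn V (mset_set E)"
  proof -
    have "(hrel (mset_set E))\<^sup>* = (adj E)\<^sup>*" using assms(2,3) by (intro hrel_mset_set_adj) blast+
    then show ?thesis using assms(4) unfolding uconnected_def hconn_def by simp
  qed
  moreover have "finite e \<and> e \<noteq> {} \<and> card e = 2" if "e \<in> E" for e using assms(3) that by auto
  moreover from this have "(\<Sum>e\<in>#mset_set E. card e) = 2 * card E"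
    by (simp add: sum_unfold_sum_mset[symmetric])
  ultimately show ?thesis using hconn_bound[of V "mset_set E"] assms(1,2) by simp
qed

text \<open>Both bounds, with two incidences per edge, give the count. Conversely, an edge that is
  not a bridge could be dropped, leaving a connected graph with too few edges.\<close>

lemma tree_card:
  assumes "finite V" "V \<noteq> {}" "finite E" "\<forall>e\<in>E. \<exists>u w. e = {u, w} \<and> u \<noteq> w \<and> u \<in> V \<and> w \<in> V" "uconnected V E"
  shows "uacyclic E \<longleftrightarrow> card E + 1 = card V"
proof
  assume ac: "uacyclic E"
  have E: "finite e \<and> e \<noteq> {} \<and> card e = 2 \<and> e \<subseteq> V" if "e \<in> E" for e using assms(4) that by auto
  have "(\<Sum>e\<in>#mset_set E. card e) + 1 \<le> card V + size (mset_set E)"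
  proof (rule forest_bound[OF assms(1,2)])
    show "\<forall>B\<in>#mset_set E. B \<noteq> {} \<and> B \<subseteq> V" using E assms(3) by auto
    fix B M' u v assume h: "mset_set E = add_mset B M'" "u \<in> B" "v \<in> B" "u \<noteq> v"
    have "B \<in># mset_set E" unfolding h(1) by simp
    then have B: "B \<in> E" using assms(3) by simp
    then obtain x y where "B = {x, y}" using assms(4) by blast
    then have "B = {u, v}" using h(2-4) by auto
    have "mset_set E = add_mset B (mset_set (E - {B}))"
      using B assms(3) by (simp add: mset_set.remove)
    then have "M' = mset_set (E - {B})" using h(1) by simp
    then have "(hrel M')\<^sup>* = (adj (E - {{u, v}}))\<^sup>*"
      using hrel_mset_set_adj[of "E - {B}"] assms(3,4) \<open>B = {u, v}\<close> by blast
    then show "(u, v) \<notin> (hrel M')\<^sup>*" using uacyclic_bridge[OF ac _ h(4)] B \<open>B = {u, v}\<close> by simp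
  qed
  moreover have "(\<Sum>e\<in>#mset_set E. card e) = 2 * card E"
    using E by (simp add: sum_unfold_sum_mset[symmetric])
  moreover have "card V \<le> card E + 1" using assms by (intro uconnected_card_bound) auto
  ultimately show "card E + 1 = card V" by simp
next
  assume c: "card E + 1 = card V"
  show "uacyclic E"
  proof (rule uacyclicI_bridge, rule notI)
    fix a b assume ab: "{a, b} \<in> E" "a \<noteq> b" "(a, b) \<in> (adj (E - {{a, b}}))\<^sup>*"
    have "(adj E) \<subseteq> (adj (E - {{a, b}}))\<^sup>*"
    proof clarify
      fix u v assume "(u, v) \<in> adj E"
      then show "(u, v) \<in> (adj (E - {{a, b}}))\<^sup>*"
        using ab(3) adj_sym[OF ab(3)] by (cases "{u, v} = {a, b}") (auto simp: adj_def doubleton_eq_iff)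
    qed
    then have "uconnected V (E - {{a, b}})"
      using assms(5) rtrancl_subset_rtrancl unfolding uconnected_def by blast
    then have "card V \<le> card (E - {{a, b}}) + 1" using assms by (intro uconnected_card_bound) auto
    moreover have "card (E - {{a, b}}) < card E" using ab assms(3) by (meson card_Diff1_less)
    ultimately show False using c by simp
  qed
qed

section \<open>Leaves, names and pars of a tree\<close>

fun npar :: "'a tm \<Rightarrow> nat" where
  "npar (Leaf l i) = 0"
| "npar (Tens A B) = npar A + npar B"
| "npar (Par A B) = Suc (npar A + npar B)"

definition names :: "'a tm \<Rightarrow> nat set" where
  "names t = snd ` set (leaves t)"

lemma names_simps [simp]:
  "names (Leaf l i) = {i}" "names (Tens A B) = names A \<union> names B" "names (Par A B) = names A \<union> names B"
  by (auto simp: names_def)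

lemma finite_names [simp]: "finite (names t)"
  by (simp add: names_def)

abbreviation dnames :: "'a tm \<Rightarrow> bool" where
  "dnames t \<equiv> distinct (map snd (leaves t))"

lemma dnames_simps:
  "dnames (Tens A B) \<longleftrightarrow> dnames A \<and> dnames B \<and> names A \<inter> names B = {}"
  "dnames (Par A B) \<longleftrightarrow> dnames A \<and> dnames B \<and> names A \<inter> names B = {}"
  by (auto simp: names_def)

lemma card_names: "dnames t \<Longrightarrow> card (names t) = length (leaves t)"
  unfolding names_def by (metis distinct_card length_map set_map)

lemma length_leaves_pos [simp]: "0 < length (leaves t)" "leaves t \<noteq> []"
  by (induction t) auto

subsection \<open>Blocks of a switched tree\<close>

text \<open>A switching cuts a tree into connected pieces. The sets of leaves of these pieces are recorded as
  the block of the root and the multiset of all other blocks.\<close>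

fun blk :: "'a tm \<Rightarrow> (bool list \<Rightarrow> bool) \<Rightarrow> nat set \<times> nat set multiset" where
  "blk (Leaf l i) \<sigma> = ({i}, {#})"
| "blk (Tens A B) \<sigma> =
    (let (X, M) = blk A (\<lambda>q. \<sigma> (False # q)); (Y, N) = blk B (\<lambda>q. \<sigma> (True # q)) in (X \<union> Y, M + N))"
| "blk (Par A B) \<sigma> =
    (let (X, M) = blk A (\<lambda>q. \<sigma> (False # q)); (Y, N) = blk B (\<lambda>q. \<sigma> (True # q)) in
      if \<sigma> [] then (Y, add_mset X (M + N)) else (X, add_mset Y (M + N)))"

text \<open>All values of \<open>blk\<close> at once (see \<open>swp_blk\<close>). Switchings are
  functions on positions and would have to be re-indexed by every rewriting of a tree; this
  recursion does not mention them.\<close>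

fun swp :: "'a tm \<Rightarrow> (nat set \<times> nat set multiset) set" where
  "swp (Leaf l i) = {({i}, {#})}"
| "swp (Tens A B) = {(X \<union> Y, M + N) | X Y M N. (X, M) \<in> swp A \<and> (Y, N) \<in> swp B}"
| "swp (Par A B) = {(X, add_mset Y (M + N)) | X Y M N. (X, M) \<in> swp A \<and> (Y, N) \<in> swp B}
     \<union> {(Y, add_mset X (M + N)) | X Y M N. (X, M) \<in> swp A \<and> (Y, N) \<in> swp B}"

definition combine :: "bool \<Rightarrow> (bool list \<Rightarrow> bool) \<Rightarrow> (bool list \<Rightarrow> bool) \<Rightarrow> bool list \<Rightarrow> bool" where
  "combine b \<sigma> \<tau> p = (case p of [] \<Rightarrow> b | c # q \<Rightarrow> if c then \<tau> q else \<sigma> q)"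

lemma combine_simps [simp]:
  "combine b \<sigma> \<tau> [] = b" "combine b \<sigma> \<tau> (False # q) = \<sigma> q" "combine b \<sigma> \<tau> (True # q) = \<tau> q"
  by (auto simp: combine_def)

lemma blk_in_swp: "blk t \<sigma> \<in> swp t"
proof (induction t arbitrary: \<sigma>)
  case (Tens A B)
  then show ?case by (auto split: prod.split) (metis)
next
  case (Par A B)
  have "(fst (blk A \<sigma>), snd (blk A \<sigma>)) \<in> swp A" "(fst (blk B \<sigma>), snd (blk B \<sigma>)) \<in> swp B" for \<sigma>
    using Par by simp_all
  then show ?case by (fastforce simp: Let_def split_def)
qed simp

lemma swp_blk: "swp t = range (blk t)"
proof
  show "range (blk t) \<subseteq> swp t" using blk_in_swp by blast
  have "z \<in> swp t \<Longrightarrow> \<exists>\<sigma>. z = blk t \<sigma>" for z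
  proof (induction t arbitrary: z)
    case (Tens A B)
    then obtain X Y M N where z: "z = (X \<union> Y, M + N)" "(X, M) \<in> swp A" "(Y, N) \<in> swp B" by auto
    obtain \<sigma> \<tau> where "(X, M) = blk A \<sigma>" "(Y, N) = blk B \<tau>" using Tens.IH z by blast
    then have "z = blk (Tens A B) (combine False \<sigma> \<tau>)" using z
      by (simp flip: \<open>(X, M) = blk A \<sigma>\<close> \<open>(Y, N) = blk B \<tau>\<close>)
    then show ?case by blast
  next
    case (Par A B)
    then obtain X Y M N b where z: "z = (if b then (Y, add_mset X (M + N)) else (X, add_mset Y (M + N)))"
      and s: "(X, M) \<in> swp A" "(Y, N) \<in> swp B" by (auto split: if_splits; metis)
    obtain \<sigma> \<tau> where "(X, M) = blk A \<sigma>" "(Y, N) = blk B \<tau>" using Par.IH s by blast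
    then have "z = blk (Par A B) (combine b \<sigma> \<tau>)" using z
      by (simp flip: \<open>(X, M) = blk A \<sigma>\<close> \<open>(Y, N) = blk B \<tau>\<close>)
    then show ?case by blast
  qed simp
  then show "swp t \<subseteq> range (blk t)" by blast
qed

lemma swp_blocks:
  assumes "(X, M) \<in> swp t"
  shows "X \<noteq> {} \<and> X \<subseteq> names t \<and> (\<forall>B\<in>#M. B \<noteq> {} \<and> B \<subseteq> names t)"
  using assms by (induction t arbitrary: X M) (fastforce)+

lemma swp_size: "(X, M) \<in> swp t \<Longrightarrow> size M = npar t"
  by (induction t arbitrary: X M) fastforce+

lemma swp_finite: "(X, M) \<in> swp t \<Longrightarrow> finite X \<and> (\<forall>B\<in>#M. finite B)"
  using swp_blocks finite_names finite_subset by metis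

text \<open>Distinct leaf names are not assumed, hence an inequality; it is the direction that
  tightness needs.\<close>

lemma swp_card: "(X, M) \<in> swp t \<Longrightarrow> card X + (\<Sum>B\<in>#M. card B) \<le> length (leaves t)"
proof (induction t arbitrary: X M)
  case (Tens A B)
  then obtain X1 Y1 M1 N1 where z: "X = X1 \<union> Y1" "M = M1 + N1" "(X1, M1) \<in> swp A" "(Y1, N1) \<in> swp B" by auto
  have "card X \<le> card X1 + card Y1" using z(1) card_Un_le by simp
  then show ?case using Tens.IH(1)[OF z(3)] Tens.IH(2)[OF z(4)] z(2) by simp
next
  case (Par A B)
  then show ?case by fastforce
qed simp

text \<open>Let each par keep the premise that contains the leaf.\<close>

lemma swp_root_choice:
  assumes "i \<in> names t" shows "\<exists>X M. (X, M) \<in> swp t \<and> i \<in> X"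
proof -
  have ne: "swp u \<noteq> {}" for u :: "'a tm" using blk_in_swp by blast
  show ?thesis using assms
  proof (induction t)
    case (Tens A B)
    obtain X M Y N where "(X, M) \<in> swp A" "(Y, N) \<in> swp B" using ne by (metis ex_in_conv surj_pair)
    then show ?case using Tens by simp blast
  next
    case (Par A B)
    obtain X M Y N where "(X, M) \<in> swp A" "(Y, N) \<in> swp B" using ne by (metis ex_in_conv surj_pair)
    then show ?case using Par by simp blast
  qed auto
qed

text \<open>The root block is singled out only while a tree may still grow; as part of a graph, all
  blocks of a tree have equal rights.\<close>

definition full :: "'a tm \<Rightarrow> nat set multiset set" where
  "full t = (\<lambda>(X, M). add_mset X M) ` swp t"

lemma full_iff: "M \<in> full t \<longleftrightarrow> (\<exists>X N. (X, N) \<in> swp t \<and> M = add_mset X N)"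
  by (force simp: full_def)

definition blks :: "'a tm \<Rightarrow> (bool list \<Rightarrow> bool) \<Rightarrow> nat set multiset" where
  "blks t \<sigma> = (case blk t \<sigma> of (X, M) \<Rightarrow> add_mset X M)"

lemma full_blks: "full t = range (blks t)"
  by (auto simp: full_def swp_blk blks_def image_image)

subsection \<open>Positions\<close>

fun is_leaf :: "'a tm \<Rightarrow> bool" where
  "is_leaf (Leaf l i) = True"
| "is_leaf _ = False"

lemma poss_Nil [simp]: "[] \<in> poss t"
  by (cases t) auto

lemma poss_append_iff: "p @ q \<in> poss t \<longleftrightarrow> p \<in> poss t \<and> q \<in> poss (sub t p)"
proof (induction p arbitrary: t)
  case (Cons b p)
  show ?case
  proof (cases t)
    case (Leaf l i) then show ?thesis by simp
  next
    case (Tens A B) then show ?thesis using Cons[of A] Cons[of B] by (cases b) auto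
  next
    case (Par A B) then show ?thesis using Cons[of A] Cons[of B] by (cases b) auto
  qed
qed simp

lemma sub_append: "p \<in> poss t \<Longrightarrow> sub t (p @ q) = sub (sub t p) q"
  by (induction t p rule: sub.induct) (auto split: if_splits)

lemma poss_snoc: "p \<in> poss t \<Longrightarrow> \<not> is_leaf (sub t p) \<Longrightarrow> p @ [b] \<in> poss t"
  by (cases "sub t p") (auto simp: poss_append_iff)

lemma sub_leaf_names: "p \<in> poss t \<Longrightarrow> sub t p = Leaf l i \<Longrightarrow> (l, i) \<in> set (leaves t)"
  by (induction t p rule: sub.induct) (auto split: if_splits)

lemma leaf_position: "(l, i) \<in> set (leaves t) \<Longrightarrow> \<exists>p\<in>poss t. sub t p = Leaf l i"
proof (induction t)
  case (Tens A B)
  then show ?case by (cases "(l, i) \<in> set (leaves A)") (auto 0 3 simp: bex_Un)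
next
  case (Par A B)
  then show ?case by (cases "(l, i) \<in> set (leaves A)") (auto 0 3 simp: bex_Un)
qed simp

lemma leaf_position_unique:
  assumes "dnames t" "p \<in> poss t" "q \<in> poss t" "sub t p = Leaf l i" "sub t q = Leaf l' i"
  shows "p = q"
proof -
  have n: "i \<in> names T" if "r \<in> poss T" "sub T r = Leaf k i" for T :: "'a tm" and r k
    using sub_leaf_names[OF that] by (force simp: names_def)
  show ?thesis using assms
  proof (induction t arbitrary: p q)
    case (Tens A B)
    have "dnames A" "dnames B" "names A \<inter> names B = {}" using Tens.prems(1) by (simp_all add: dnames_simps del: leaves.simps)
    then show ?case using Tens.prems(2-) Tens.IH n by auto blast+
  next
    case (Par A B)
    have "dnames A" "dnames B" "names A \<inter> names B = {}" using Par.prems(1) by (simp_all add: dnames_simps del: leaves.simps)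
    then show ?case using Par.prems(2-) Par.IH n by auto blast+
  qed auto
qed

lemma sub_rep: "p \<in> poss t \<Longrightarrow> sub (rep t p u) p = u"
  by (induction t p u rule: rep.induct) auto

lemma poss_rep: "p \<in> poss t \<Longrightarrow> p \<in> poss (rep t p u)"
  by (induction t p u rule: rep.induct) auto

lemma rep_rep: "p \<in> poss t \<Longrightarrow> rep (rep t p u) p v = rep t p v"
  by (induction t p u rule: rep.induct) auto

lemma rep_sub: "p \<in> poss t \<Longrightarrow> rep t p (sub t p) = t"
  by (induction t p rule: sub.induct) (auto split: if_splits)

lemma rep_append: "p \<in> poss t \<Longrightarrow> rep t (p @ q) u = rep t p (rep (sub t p) q u)"
  by (induction t p rule: sub.induct) (auto split: if_splits)

lemma leaves_rep:
  "p \<in> poss t \<Longrightarrow> mset (leaves (rep t p u)) + mset (leaves (sub t p)) = mset (leaves t) + mset (leaves u)"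
  by (induction t p u rule: rep.induct) (auto simp: ac_simps)

lemma npar_rep: "p \<in> poss t \<Longrightarrow> npar (rep t p u) + npar (sub t p) = npar t + npar u"
  by (induction t p u rule: rep.induct) auto

section \<open>Switchings of a tree with a hole\<close>

lemma swp_rep_cong: "swp u = swp v \<Longrightarrow> swp (rep t p u) = swp (rep t p v)"
  by (induction t p u rule: rep.induct) auto

text \<open>A switched context with a hole. \<open>K\<close> collects the leaves that the context
  joins to the root block of the hole, \<open>D\<close> its other blocks. With \<open>None\<close>
  this extended block is the root block of the whole tree; with \<open>Some R\<close> a par has cut
  it off and the root block is \<open>R\<close>.\<close>

fun plug :: "nat set option \<times> nat set \<times> nat set multiset \<Rightarrow> nat set \<times> nat set multiset \<Rightarrow> nat set \<times> nat set multiset" where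
  "plug (None, K, D) (X, M) = (X \<union> K, M + D)"
| "plug (Some R, K, D) (X, M) = (R, add_mset (X \<union> K) (M + D))"

text \<open>The contexts \<open>C\<close> are fixed before \<open>u\<close>: replacing a subtree
  leaves the switchings of its surroundings unchanged.\<close>

definition swp_ctx :: "('a tm \<Rightarrow> (nat set \<times> nat set multiset) set) \<Rightarrow> bool" where
  "swp_ctx F \<longleftrightarrow> (\<exists>C. \<forall>u. F u = (\<Union>z\<in>C. plug z ` swp u))"

text \<open>One more node above the hole: \<open>w\<close> ranges over the switchings of the
  sibling, and \<open>f w\<close> turns a context into a larger one.\<close>

lemma swp_ctx_comp:
  assumes "swp_ctx F" and "\<And>w z. w \<in> W \<Longrightarrow> \<exists>z'. \<forall>x. f w (plug z x) = plug z' x"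
  shows "swp_ctx (\<lambda>u. \<Union>w\<in>W. f w ` F u)"
proof -
  obtain C where C: "F u = (\<Union>z\<in>C. plug z ` swp u)" for u using assms(1) unfolding swp_ctx_def by blast
  obtain g where g: "f w (plug z x) = plug (g w z) x" if "w \<in> W" for w z x
    using assms(2) by metis
  have "(\<Union>w\<in>W. f w ` F u) = (\<Union>z\<in>{g w z | w z. w \<in> W \<and> z \<in> C}. plug z ` swp u)" for u
  proof (intro set_eqI)
    fix y
    have "y \<in> (\<Union>w\<in>W. f w ` F u) \<longleftrightarrow> (\<exists>w\<in>W. \<exists>c\<in>C. \<exists>x\<in>swp u. y = f w (plug c x))"
      unfolding C by blast
    also have "\<dots> \<longleftrightarrow> (\<exists>w\<in>W. \<exists>c\<in>C. \<exists>x\<in>swp u. y = plug (g w c) x)"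
      using g by (simp cong: bex_cong)
    also have "\<dots> \<longleftrightarrow> y \<in> (\<Union>z\<in>{g w z | w z. w \<in> W \<and> z \<in> C}. plug z ` swp u)" by blast
    finally show "y \<in> (\<Union>w\<in>W. f w ` F u) \<longleftrightarrow> y \<in> (\<Union>z\<in>{g w z | w z. w \<in> W \<and> z \<in> C}. plug z ` swp u)" .
  qed
  then show ?thesis unfolding swp_ctx_def by blast
qed

lemma swp_Tens_comm: "swp (Tens A B) = swp (Tens B A)"
  by auto (metis Un_commute add.commute)+

lemma swp_Par_comm: "swp (Par A B) = swp (Par B A)"
  by (auto simp: add.commute)

text \<open>Written as functions of one child with the other one fixed, once for each side of the
  hole, as \<open>swp_ctx_comp\<close> requires.\<close>

lemma swp_Tens:
  "swp (Tens A B) = (\<Union>w\<in>swp B. (\<lambda>x. (fst x \<union> fst w, snd x + snd w)) ` swp A)"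
  "swp (Tens A B) = (\<Union>w\<in>swp A. (\<lambda>x. (fst x \<union> fst w, snd x + snd w)) ` swp B)"
proof -
  show *: "swp (Tens A B) = (\<Union>w\<in>swp B. (\<lambda>x. (fst x \<union> fst w, snd x + snd w)) ` swp A)" for A B :: "'a tm"
  proof (intro set_eqI)
    fix z
    have "z \<in> swp (Tens A B) \<longleftrightarrow> (\<exists>Y N. (Y, N) \<in> swp B \<and> (\<exists>X M. (X, M) \<in> swp A \<and> z = (X \<union> Y, M + N)))" by auto
    also have "\<dots> \<longleftrightarrow> (\<exists>w\<in>swp B. \<exists>x\<in>swp A. z = (fst x \<union> fst w, snd x + snd w))"
      by (simp add: Bex_def)
    also have "\<dots> \<longleftrightarrow> z \<in> (\<Union>w\<in>swp B. (\<lambda>x. (fst x \<union> fst w, snd x + snd w)) ` swp A)" by blast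
    finally show "z \<in> swp (Tens A B) \<longleftrightarrow> z \<in> (\<Union>w\<in>swp B. (\<lambda>x. (fst x \<union> fst w, snd x + snd w)) ` swp A)" .
  qed
  show "swp (Tens A B) = (\<Union>w\<in>swp A. (\<lambda>x. (fst x \<union> fst w, snd x + snd w)) ` swp B)"
    by (rule trans[OF swp_Tens_comm *])
qed

lemma swp_Par:
  defines "f \<equiv> \<lambda>w x. if fst w then (fst (snd w), add_mset (fst x) (snd x + snd (snd w)))
    else (fst x, add_mset (fst (snd w)) (snd x + snd (snd w)))"
  shows "swp (Par A B) = (\<Union>w\<in>UNIV \<times> swp B. f w ` swp A)"
    "swp (Par A B) = (\<Union>w\<in>UNIV \<times> swp A. f w ` swp B)"
proof -
  show *: "swp (Par A B) = (\<Union>w\<in>UNIV \<times> swp B. f w ` swp A)" for A B :: "'a tm"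
  proof (intro set_eqI)
    fix z
    have "z \<in> (\<Union>w\<in>UNIV \<times> swp B. f w ` swp A) \<longleftrightarrow> (\<exists>b. \<exists>w\<in>swp B. \<exists>x\<in>swp A. z = f (b, w) x)" by auto
    also have "\<dots> \<longleftrightarrow> (\<exists>w\<in>swp B. \<exists>x\<in>swp A. z = f (True, w) x) \<or> (\<exists>w\<in>swp B. \<exists>x\<in>swp A. z = f (False, w) x)"
      by (metis (full_types))
    also have "\<dots> \<longleftrightarrow> z \<in> swp (Par A B)"
      by (simp add: f_def Bex_def) blast
    finally show "z \<in> swp (Par A B) \<longleftrightarrow> z \<in> (\<Union>w\<in>UNIV \<times> swp B. f w ` swp A)" by simp
  qed
  show "swp (Par A B) = (\<Union>w\<in>UNIV \<times> swp A. f w ` swp B)"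
    by (rule trans[OF swp_Par_comm *])
qed

lemma swp_context: "p \<in> poss t \<Longrightarrow> swp_ctx (\<lambda>u. swp (rep t p u))"
proof (induction t p rule: sub.induct)
  case (1 t)
  have "swp u = (\<Union>z\<in>{(None, {}, {#})}. plug z ` swp u)" for u by force
  then show ?case unfolding swp_ctx_def by auto
next
  case (3 A B b p)
  let ?f = "\<lambda>w x. (fst x \<union> fst w, snd x + snd w)"
  have z: "\<exists>z'. \<forall>x. ?f w (plug z x) = plug z' x" for w z
  proof -
    obtain R K D where z: "z = (R, K, D)" by (metis surj_pair)
    \<comment> \<open>The root block of the sibling is joined to the root block of the tree, which
      is the one around the hole only in the case \<open>None\<close>.\<close>
    define z' where "z' = (case R of None \<Rightarrow> (None, K \<union> fst w, D + snd w) | Some S \<Rightarrow> (Some (S \<union> fst w), K, D + snd w))"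
    have "?f w (plug z x) = plug z' x" for x
      by (cases x; cases R) (auto simp: z z'_def ac_simps)
    then show ?thesis by blast
  qed
  show ?case
  proof (cases b)
    case True
    then have "swp_ctx (\<lambda>u. \<Union>w\<in>swp A. ?f w ` swp (rep B p u))"
      using 3 by (intro swp_ctx_comp z) auto
    then show ?thesis using True by (simp add: swp_Tens(2) del: swp.simps)
  next
    case False
    then have "swp_ctx (\<lambda>u. \<Union>w\<in>swp B. ?f w ` swp (rep A p u))"
      using 3 by (intro swp_ctx_comp z) auto
    then show ?thesis using False by (simp add: swp_Tens(1) del: swp.simps)
  qed
next
  case (4 A B b p)
  let ?f = "\<lambda>w x. if fst w then (fst (snd w), add_mset (fst x) (snd x + snd (snd w)))
    else (fst x, add_mset (fst (snd w)) (snd x + snd (snd w)))"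
  have z: "\<exists>z'. \<forall>x. ?f w (plug z x) = plug z' x" for w z
  proof -
    obtain c Y N R K D where w: "w = (c, Y, N)" "z = (R, K, D)" by (metis surj_pair)
    \<comment> \<open>The flag \<open>c\<close> means that the par keeps its edge to the sibling:
      then the old root block is cut off and \<open>Y\<close> becomes the root block.\<close>
    define z' where "z' = (case R of
       None \<Rightarrow> if c then (Some Y, K, D + N) else (None, K, add_mset Y (D + N))
     | Some S \<Rightarrow> if c then (Some Y, K, add_mset S (D + N)) else (Some S, K, add_mset Y (D + N)))"
    have "?f w (plug z x) = plug z' x" for x
      by (cases x; cases R) (auto simp: w z'_def add_mset_commute)
    then show ?thesis by blast
  qed
  show ?case
  proof (cases b)
    case True
    then have "swp_ctx (\<lambda>u. \<Union>w\<in>UNIV \<times> swp A. ?f w ` swp (rep B p u))"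
      using 4 by (intro swp_ctx_comp z) auto
    then show ?thesis using True by (simp add: swp_Par(2) del: swp.simps)
  next
    case False
    then have "swp_ctx (\<lambda>u. \<Union>w\<in>UNIV \<times> swp B. ?f w ` swp (rep A p u))"
      using 4 by (intro swp_ctx_comp z) auto
    then show ?thesis using False by (simp add: swp_Par(1) del: swp.simps)
  qed
qed simp

text \<open>Without a distinguished root the two kinds of context coincide. Rewritings of a subtree
  are compared below inside one fixed pair \<open>(K, D)\<close>.\<close>

lemma full_context:
  assumes "p \<in> poss t"
  obtains C where "\<And>u. full (rep t p u) = {add_mset (X \<union> K) (M + D) | X M K D. (X, M) \<in> swp u \<and> (K, D) \<in> C}"
proof -
  obtain C where C: "swp (rep t p u) = (\<Union>z\<in>C. plug z ` swp u)" for u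
    using swp_context[OF assms] unfolding swp_ctx_def by blast
  define rest where "rest z = (case z of (R, K, D) \<Rightarrow> (K, (case R of None \<Rightarrow> D | Some S \<Rightarrow> add_mset S D)))"
    for z :: "nat set option \<times> nat set \<times> nat set multiset"
  have r: "(case plug z (X, M) of (R, N) \<Rightarrow> add_mset R N) = add_mset (X \<union> fst (rest z)) (M + snd (rest z))" for z X M
    by (cases z; cases "fst z") (auto simp: rest_def add_mset_commute)
  have "full (rep t p u) = {add_mset (X \<union> K) (M + D) | X M K D. (X, M) \<in> swp u \<and> (K, D) \<in> rest ` C}" (is "_ = ?R") for u
  proof -
    have "M \<in> full (rep t p u) \<longleftrightarrow> (\<exists>z\<in>C. \<exists>x\<in>swp u. M = (case plug z x of (R, N) \<Rightarrow> add_mset R N))" for M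
      unfolding full_def C by blast
    also have "\<dots> M \<longleftrightarrow> (\<exists>z\<in>C. \<exists>X N. (X, N) \<in> swp u \<and> M = add_mset (X \<union> fst (rest z)) (N + snd (rest z)))" for M
      by (simp add: Bex_def r)
    also have "\<dots> M \<longleftrightarrow> (\<exists>y\<in>rest ` C. \<exists>X N. (X, N) \<in> swp u \<and> M = add_mset (X \<union> fst y) (N + snd y))" for M
      by blast
    also have "\<dots> M \<longleftrightarrow> (\<exists>K D. (K, D) \<in> rest ` C \<and> (\<exists>X N. (X, N) \<in> swp u \<and> M = add_mset (X \<union> K) (N + D)))" for M
      unfolding Bex_def by (simp only: split_paired_Ex fst_conv snd_conv)
    also have "\<dots> M \<longleftrightarrow> M \<in> ?R" for M by blast
    finally show ?thesis by blast
  qed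
  then show thesis by (rule that)
qed

subsection \<open>Switched graphs and blocks\<close>

text \<open>Common form of \<open>nd_link\<close> and \<open>nd_seq\<close>; the parameter
  \<open>c\<close> lets an induction descend into a subtree by re-indexing its inner nodes.\<close>

definition nd :: "(bool list \<Rightarrow> vtx) \<Rightarrow> 'a tm \<Rightarrow> bool list \<Rightarrow> vtx" where
  "nd c t q = (case sub t q of Leaf l i \<Rightarrow> VLeaf i | _ \<Rightarrow> c q)"

lemma nd_link_nd: "nd_link P = nd VLink P" and nd_seq_nd: "nd_seq t k = nd (VSeq k) t"
  by (auto simp: nd_link_def nd_seq_def nd_def)

lemma nd_simps [simp]:
  "nd c (Leaf l i) p = VLeaf i"
  "nd c (Tens A B) [] = c []" "nd c (Par A B) [] = c []"
  "nd c (Tens A B) (b # p) = nd (\<lambda>q. c (b # q)) (if b then B else A) p"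
  "nd c (Par A B) (b # p) = nd (\<lambda>q. c (b # q)) (if b then B else A) p"
  by (cases p; simp add: nd_def)+

text \<open>Edges as pairs of a position and a child. These can be counted by recursion; that
  different indices give different edges is shown separately in \<open>tedges_inj\<close>.\<close>

definition eidx :: "'a tm \<Rightarrow> (bool list \<Rightarrow> bool) \<Rightarrow> (bool list \<times> bool) set" where
  "eidx t \<sigma> = {(p, b). p \<in> poss t \<and>
     (case sub t p of Leaf l i \<Rightarrow> False | Tens A B \<Rightarrow> True | Par A B \<Rightarrow> \<sigma> p = b)}"

lemma eidx_simps:
  "eidx (Leaf l i) \<sigma> = {}"
  "eidx (Tens A B) \<sigma> = insert ([], False) (insert ([], True)
    (map_prod (Cons False) id ` eidx A (\<lambda>q. \<sigma> (False # q)) \<union> map_prod (Cons True) id ` eidx B (\<lambda>q. \<sigma> (True # q))))"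
  "eidx (Par A B) \<sigma> = insert ([], \<sigma> [])
    (map_prod (Cons False) id ` eidx A (\<lambda>q. \<sigma> (False # q)) \<union> map_prod (Cons True) id ` eidx B (\<lambda>q. \<sigma> (True # q)))"
  by (auto simp: eidx_def image_iff id_def split: if_splits)

lemma tedges_eidx: "tedges t f s = (\<lambda>(p, b). {f p, f (p @ [b])}) ` eidx t (\<lambda>q. s (f q))"
  by (auto simp: tedges_def eidx_def)

lemma tedges_simps:
  "tedges (Leaf l i) f s = {}"
  "tedges (Tens A B) f s = {{f [], f [False]}, {f [], f [True]}}
      \<union> tedges A (\<lambda>q. f (False # q)) s \<union> tedges B (\<lambda>q. f (True # q)) s"
  "tedges (Par A B) f s = {{f [], f [s (f [])]}}
      \<union> tedges A (\<lambda>q. f (False # q)) s \<union> tedges B (\<lambda>q. f (True # q)) s"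
  by (simp_all add: tedges_eidx eidx_simps image_Un image_image split_def map_prod_def)

lemma tedges_image: "tedges t (nd c t) s = (\<lambda>(p, b). {nd c t p, nd c t (p @ [b])}) ` eidx t (\<lambda>q. s (c q))"
proof -
  have "eidx t (\<lambda>q. s (nd c t q)) = eidx t (\<lambda>q. s (c q))"
    unfolding eidx_def by (auto simp: nd_def split: tm.splits)
  then show ?thesis by (simp add: tedges_eidx)
qed

lemma adjI2: "{u, v} \<in> E \<Longrightarrow> (v, u) \<in> (adj E)\<^sup>*"
  by (simp add: adjI insert_commute)

lemma block_connected:
  assumes "blk t (\<lambda>q. s (c q)) = (X, M)" "tedges t (nd c t) s \<subseteq> W"
  shows "(\<forall>a\<in>X. (VLeaf a, nd c t []) \<in> (adj W)\<^sup>*) \<and>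
    (\<forall>C\<in>#M. \<forall>a\<in>C. \<forall>b\<in>C. (VLeaf a, VLeaf b) \<in> (adj W)\<^sup>*)"
  using assms
proof (induction t arbitrary: c X M)
  case (Tens A B)
  obtain X1 M1 Y1 N1 where b: "blk A (\<lambda>q. s (c (False # q))) = (X1, M1)" "blk B (\<lambda>q. s (c (True # q))) = (Y1, N1)"
    by fastforce
  have XM: "X = X1 \<union> Y1" "M = M1 + N1" using Tens.prems(1) b by auto
  have W: "tedges A (nd (\<lambda>q. c (False # q)) A) s \<subseteq> W" "tedges B (nd (\<lambda>q. c (True # q)) B) s \<subseteq> W"
    and e: "{c [], nd (\<lambda>q. c (False # q)) A []} \<in> W" "{c [], nd (\<lambda>q. c (True # q)) B []} \<in> W"
    using Tens.prems(2) by (auto simp: tedges_simps)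
  have "(nd (\<lambda>q. c (False # q)) A [], c []) \<in> (adj W)\<^sup>*" "(nd (\<lambda>q. c (True # q)) B [], c []) \<in> (adj W)\<^sup>*"
    using adjI2[OF e(1)] adjI2[OF e(2)] .
  then show ?case using Tens.IH(1)[OF b(1) W(1)] Tens.IH(2)[OF b(2) W(2)] XM
    by (auto intro: rtrancl_trans)
next
  case (Par A B)
  obtain X1 M1 Y1 N1 where b: "blk A (\<lambda>q. s (c (False # q))) = (X1, M1)" "blk B (\<lambda>q. s (c (True # q))) = (Y1, N1)"
    by fastforce
  have XM: "(X, M) = (if s (c []) then (Y1, add_mset X1 (M1 + N1)) else (X1, add_mset Y1 (M1 + N1)))"
    using Par.prems(1) b by auto
  have W: "tedges A (nd (\<lambda>q. c (False # q)) A) s \<subseteq> W" "tedges B (nd (\<lambda>q. c (True # q)) B) s \<subseteq> W"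
    using Par.prems(2) by (auto simp: tedges_simps)
  note IA = Par.IH(1)[OF b(1) W(1)] and IB = Par.IH(2)[OF b(2) W(2)]
  have blockA: "(VLeaf a, VLeaf a') \<in> (adj W)\<^sup>*" if "a \<in> X1" "a' \<in> X1" for a a'
    using IA that by (blast intro: rtrancl_trans adj_sym)
  have blockB: "(VLeaf a, VLeaf a') \<in> (adj W)\<^sup>*" if "a \<in> Y1" "a' \<in> Y1" for a a'
    using IB that by (blast intro: rtrancl_trans adj_sym)
  show ?case
  proof (cases "s (c [])")
    case True
    then have "{c [], nd (\<lambda>q. c (True # q)) B []} \<in> W" using Par.prems(2) by (auto simp: tedges_simps)
    then have "(nd (\<lambda>q. c (True # q)) B [], c []) \<in> (adj W)\<^sup>*" by (rule adjI2)
    then show ?thesis using IA IB XM True blockA by (auto intro: rtrancl_trans)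
  next
    case False
    then have "{c [], nd (\<lambda>q. c (False # q)) A []} \<in> W" using Par.prems(2) by (auto simp: tedges_simps)
    then have "(nd (\<lambda>q. c (False # q)) A [], c []) \<in> (adj W)\<^sup>*" by (rule adjI2)
    then show ?thesis using IA IB XM False blockB by (auto intro: rtrancl_trans)
  qed
qed simp

text \<open>Every node of a switched tree leads down to some leaf of its block.\<close>

fun dleaf :: "'a tm \<Rightarrow> (bool list \<Rightarrow> bool) \<Rightarrow> nat" where
  "dleaf (Leaf l i) \<sigma> = i"
| "dleaf (Tens A B) \<sigma> = dleaf A (\<lambda>q. \<sigma> (False # q))"
| "dleaf (Par A B) \<sigma> = (if \<sigma> [] then dleaf B (\<lambda>q. \<sigma> (True # q)) else dleaf A (\<lambda>q. \<sigma> (False # q)))"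

lemma dleaf_root: "dleaf t \<sigma> \<in> fst (blk t \<sigma>)"
  by (induction t arbitrary: \<sigma>) (auto simp: Let_def split_def)

lemma dleaf_names: "dleaf t \<sigma> \<in> names t"
  using dleaf_root[of t \<sigma>] swp_blocks[of "fst (blk t \<sigma>)" "snd (blk t \<sigma>)" t] blk_in_swp[of t \<sigma>] by auto

lemma names_sub: "p \<in> poss t \<Longrightarrow> names (sub t p) \<subseteq> names t"
  by (induction t p rule: sub.induct) (auto split: if_splits)

lemma dleaf_connected:
  assumes "p \<in> poss t" "tedges t (nd c t) s \<subseteq> W"
  shows "(nd c t p, VLeaf (dleaf (sub t p) (\<lambda>q. s (c (p @ q))))) \<in> (adj W)\<^sup>*"
  using assms
proof (induction t arbitrary: c p)
  case (Tens A B)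
  have W: "tedges A (nd (\<lambda>q. c (False # q)) A) s \<subseteq> W" "tedges B (nd (\<lambda>q. c (True # q)) B) s \<subseteq> W"
    and e: "{c [], nd (\<lambda>q. c (False # q)) A []} \<in> W"
    using Tens.prems(2) by (auto simp: tedges_simps)
  show ?case
  proof (cases p)
    case Nil
    then show ?thesis using adjI[OF e] Tens.IH(1)[of "[]", OF _ W(1)]
      by (auto intro: rtrancl_trans)
  next
    case (Cons b q)
    then show ?thesis using Tens.IH(1)[OF _ W(1), of q] Tens.IH(2)[OF _ W(2), of q] Tens.prems(1)
      by (cases b) auto
  qed
next
  case (Par A B)
  have W: "tedges A (nd (\<lambda>q. c (False # q)) A) s \<subseteq> W" "tedges B (nd (\<lambda>q. c (True # q)) B) s \<subseteq> W"
    and e: "{c [], nd (\<lambda>q. c (s (c []) # q)) (if s (c []) then B else A) []} \<in> W"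
    using Par.prems(2) by (auto simp: tedges_simps)
  show ?case
  proof (cases p)
    case Nil
    then show ?thesis using adjI[OF e] Par.IH(1)[of "[]", OF _ W(1)] Par.IH(2)[of "[]", OF _ W(2)]
      by (auto intro: rtrancl_trans)
  next
    case (Cons b q)
    then show ?thesis using Par.IH(1)[OF _ W(1), of q] Par.IH(2)[OF _ W(2), of q] Par.prems(1)
      by (cases b) auto
  qed
qed simp

lemma blks_unfold: "blks t \<sigma> = add_mset (fst (blk t \<sigma>)) (snd (blk t \<sigma>))"
  by (simp add: blks_def split_def)

text \<open>Each node is represented by the leaf \<open>dleaf\<close> below it. An edge that is kept
  stays inside one connected piece, so the representatives of its ends share a block.\<close>

lemma edge_in_block:
  assumes "p \<in> poss t" "case sub t p of Leaf l i \<Rightarrow> False | Tens A B \<Rightarrow> True | Par A B \<Rightarrow> \<sigma> p = b"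
  shows "\<exists>C\<in>#blks t \<sigma>. dleaf (sub t p) (\<lambda>q. \<sigma> (p @ q)) \<in> C \<and> dleaf (sub t (p @ [b])) (\<lambda>q. \<sigma> (p @ [b] @ q)) \<in> C"
  using assms
proof (induction t arbitrary: \<sigma> p)
  case (Tens A B)
  show ?case
  proof (cases p)
    case Nil
    then show ?thesis using Tens.prems(2) dleaf_root[of A "\<lambda>q. \<sigma> (False # q)"] dleaf_root[of B "\<lambda>q. \<sigma> (True # q)"]
      by (cases b) (auto simp: blks_unfold Let_def split_def)
  next
    case (Cons d q)
    have "\<exists>C\<in>#blks (if d then B else A) (\<lambda>q. \<sigma> (d # q)). dleaf (sub (if d then B else A) q) (\<lambda>r. \<sigma> (d # q @ r)) \<in> C
        \<and> dleaf (sub (if d then B else A) (q @ [b])) (\<lambda>r. \<sigma> (d # q @ [b] @ r)) \<in> C"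
    proof (cases d)
      case True
      then have "q \<in> poss B" "case sub B q of Leaf l i \<Rightarrow> False | Tens A B \<Rightarrow> True | Par A B \<Rightarrow> \<sigma> (True # q) = b"
        using Tens.prems Cons by auto
      from Tens.IH(2)[where \<sigma> = "\<lambda>q. \<sigma> (True # q)", OF this] show ?thesis using True by simp
    next
      case False
      then have "q \<in> poss A" "case sub A q of Leaf l i \<Rightarrow> False | Tens A B \<Rightarrow> True | Par A B \<Rightarrow> \<sigma> (False # q) = b"
        using Tens.prems Cons by auto
      from Tens.IH(1)[where \<sigma> = "\<lambda>q. \<sigma> (False # q)", OF this] show ?thesis using False by simp
    qed
    then show ?thesis using Cons by (cases d) (auto simp: blks_unfold Let_def split_def)
  qed
next
  case (Par A B)
  show ?case
  proof (cases p)
    case Nil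
    then show ?thesis using Par.prems(2) dleaf_root[of A "\<lambda>q. \<sigma> (False # q)"] dleaf_root[of B "\<lambda>q. \<sigma> (True # q)"]
      by (cases b) (auto simp: blks_unfold Let_def split_def)
  next
    case (Cons d q)
    have "\<exists>C\<in>#blks (if d then B else A) (\<lambda>q. \<sigma> (d # q)). dleaf (sub (if d then B else A) q) (\<lambda>r. \<sigma> (d # q @ r)) \<in> C
        \<and> dleaf (sub (if d then B else A) (q @ [b])) (\<lambda>r. \<sigma> (d # q @ [b] @ r)) \<in> C"
    proof (cases d)
      case True
      then have "q \<in> poss B" "case sub B q of Leaf l i \<Rightarrow> False | Tens A B \<Rightarrow> True | Par A B \<Rightarrow> \<sigma> (True # q) = b"
        using Par.prems Cons by auto
      from Par.IH(2)[where \<sigma> = "\<lambda>q. \<sigma> (True # q)", OF this] show ?thesis using True by simp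
    next
      case False
      then have "q \<in> poss A" "case sub A q of Leaf l i \<Rightarrow> False | Tens A B \<Rightarrow> True | Par A B \<Rightarrow> \<sigma> (False # q) = b"
        using Par.prems Cons by auto
      from Par.IH(1)[where \<sigma> = "\<lambda>q. \<sigma> (False # q)", OF this] show ?thesis using False by simp
    qed
    then show ?thesis using Cons by (cases d) (auto simp: blks_unfold Let_def split_def)
  qed
qed simp

section \<open>Paths in the graph and chains of blocks\<close>

definition tblk :: "'a tm \<Rightarrow> 'a item list \<Rightarrow> (vtx \<Rightarrow> bool) \<Rightarrow> nat set multiset" where
  "tblk P xs s = blks P (\<lambda>q. s (VLink q)) + (\<Sum>k<length xs. blks (itree (xs ! k)) (\<lambda>q. s (VSeq k q)))"

text \<open>A retraction of the vertices onto the leaves. It maps edges into blocks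
  (\<open>edge_gl\<close>) and moves no vertex out of its component (\<open>path_to_gl\<close>),
  which makes the two notions of connectedness agree.\<close>

fun gl :: "'a tm \<Rightarrow> 'a item list \<Rightarrow> (vtx \<Rightarrow> bool) \<Rightarrow> vtx \<Rightarrow> nat" where
  "gl P xs s (VLeaf i) = i"
| "gl P xs s (VLink p) = dleaf (sub P p) (\<lambda>q. s (VLink (p @ q)))"
| "gl P xs s (VSeq k p) = dleaf (sub (itree (xs ! k)) p) (\<lambda>q. s (VSeq k (p @ q)))"

lemma gl_nd [simp]:
  "gl P xs s (nd VLink P p) = dleaf (sub P p) (\<lambda>q. s (VLink (p @ q)))"
  "gl P xs s (nd (VSeq k) (itree (xs ! k)) p) = dleaf (sub (itree (xs ! k)) p) (\<lambda>q. s (VSeq k (p @ q)))"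
  by (cases "sub P p"; simp add: nd_def) (cases "sub (itree (xs ! k)) p"; simp add: nd_def)

lemma in_tblk:
  "B \<in># tblk P xs s \<longleftrightarrow> B \<in># blks P (\<lambda>q. s (VLink q)) \<or>
    (\<exists>k<length xs. B \<in># blks (itree (xs ! k)) (\<lambda>q. s (VSeq k q)))"
  by (auto simp: tblk_def set_mset_sum)

lemma tedgesE:
  assumes "e \<in> tedges t (nd c t) s"
  obtains p b where "e = {nd c t p, nd c t (p @ [b])}" "p \<in> poss t" "\<not> is_leaf (sub t p)"
    "case sub t p of Leaf l i \<Rightarrow> False | Tens A B \<Rightarrow> True | Par A B \<Rightarrow> s (c p) = b"
proof -
  from assms obtain p b where p: "e = {nd c t p, nd c t (p @ [b])}" "p \<in> poss t"
    "case sub t p of Leaf l i \<Rightarrow> False | Tens A B \<Rightarrow> True | Par A B \<Rightarrow> s (nd c t p) = b"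
    unfolding tedges_def by blast
  moreover have "case sub t p of Leaf l i \<Rightarrow> False | Tens A B \<Rightarrow> True | Par A B \<Rightarrow> s (c p) = b"
    using p(3) by (cases "sub t p") (auto simp: nd_def)
  moreover have "\<not> is_leaf (sub t p)" using p(3) by (cases "sub t p") auto
  ultimately show thesis using that by blast
qed

lemma swedgesE:
  assumes "e \<in> swedges P xs s"
  obtains p b where "e = {nd VLink P p, nd VLink P (p @ [b])}" "p \<in> poss P" "\<not> is_leaf (sub P p)"
    "case sub P p of Leaf l i \<Rightarrow> False | Tens A B \<Rightarrow> True | Par A B \<Rightarrow> s (VLink p) = b"
  | k p b where "k < length xs" "e = {nd (VSeq k) (itree (xs ! k)) p, nd (VSeq k) (itree (xs ! k)) (p @ [b])}"
    "p \<in> poss (itree (xs ! k))" "\<not> is_leaf (sub (itree (xs ! k)) p)"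
    "case sub (itree (xs ! k)) p of Leaf l i \<Rightarrow> False | Tens A B \<Rightarrow> True | Par A B \<Rightarrow> s (VSeq k p) = b"
  using assms unfolding swedges_def nd_link_nd nd_seq_nd
  by (auto elim!: tedgesE)

lemma edge_gl:
  assumes "{u, w} \<in> swedges P xs s"
  shows "(gl P xs s u, gl P xs s w) \<in> hrel (tblk P xs s)"
proof -
  have sym: "(x, y) \<in> hrel M \<Longrightarrow> (y, x) \<in> hrel M" for x y and M :: "nat set multiset"
    by (auto simp: hrel_def)
  from assms show ?thesis
  proof (cases rule: swedgesE)
    case (1 p b)
    from edge_in_block[where \<sigma> = "\<lambda>q. s (VLink q)", OF 1(2,4)] obtain C where
      "C \<in># tblk P xs s" "gl P xs s (nd VLink P p) \<in> C" "gl P xs s (nd VLink P (p @ [b])) \<in> C"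
      by (auto simp: in_tblk)
    then have "(gl P xs s (nd VLink P p), gl P xs s (nd VLink P (p @ [b]))) \<in> hrel (tblk P xs s)"
      unfolding hrel_def by blast
    then show ?thesis using 1(1) sym by (auto simp: doubleton_eq_iff)
  next
    case (2 k p b)
    from edge_in_block[where \<sigma> = "\<lambda>q. s (VSeq k q)", OF 2(3,5)] 2(1) obtain C where
      "C \<in># tblk P xs s" "gl P xs s (nd (VSeq k) (itree (xs ! k)) p) \<in> C"
      "gl P xs s (nd (VSeq k) (itree (xs ! k)) (p @ [b])) \<in> C"
      by (auto simp: in_tblk)
    then have "(gl P xs s (nd (VSeq k) (itree (xs ! k)) p), gl P xs s (nd (VSeq k) (itree (xs ! k)) (p @ [b]))) \<in> hrel (tblk P xs s)"
      unfolding hrel_def by blast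
    then show ?thesis using 2(2) sym by (auto simp: doubleton_eq_iff)
  qed
qed

lemma path_gl:
  assumes "(u, w) \<in> (adj (swedges P xs s))\<^sup>*"
  shows "(gl P xs s u, gl P xs s w) \<in> (hrel (tblk P xs s))\<^sup>*"
  using assms
proof (induction rule: rtrancl_induct)
  case (step y z)
  then have "(gl P xs s y, gl P xs s z) \<in> hrel (tblk P xs s)" by (intro edge_gl) (simp add: adj_def)
  with step.IH show ?case by (rule rtrancl_into_rtrancl)
qed simp

lemma blks_connected:
  assumes "tedges t (nd c t) s \<subseteq> W" "C \<in># blks t (\<lambda>q. s (c q))" "a \<in> C" "b \<in> C"
  shows "(VLeaf a, VLeaf b) \<in> (adj W)\<^sup>*"
proof -
  obtain X M where b: "blk t (\<lambda>q. s (c q)) = (X, M)" by fastforce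
  from block_connected[OF b assms(1)] have
    X: "\<forall>a\<in>X. (VLeaf a, nd c t []) \<in> (adj W)\<^sup>*"
    and M: "\<forall>C\<in>#M. \<forall>a\<in>C. \<forall>b\<in>C. (VLeaf a, VLeaf b) \<in> (adj W)\<^sup>*" by auto
  have "C = X \<or> C \<in># M" using assms(2) b by (auto simp: blks_unfold)
  then show ?thesis
  proof
    assume "C = X"
    then show ?thesis using X assms(3,4) adj_sym[of "VLeaf b"] by (blast intro: rtrancl_trans)
  qed (use M assms in blast)
qed

lemma path_of_blocks:
  assumes "(a, b) \<in> (hrel (tblk P xs s))\<^sup>*"
  shows "(VLeaf a, VLeaf b) \<in> (adj (swedges P xs s))\<^sup>*"
  using assms
proof (induction rule: rtrancl_induct)
  case (step y z)
  then obtain C where C: "C \<in># tblk P xs s" "y \<in> C" "z \<in> C" unfolding hrel_def by blast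
  have "(VLeaf y, VLeaf z) \<in> (adj (swedges P xs s))\<^sup>*"
    using C(1) unfolding in_tblk
  proof (elim disjE exE conjE)
    assume "C \<in># blks P (\<lambda>q. s (VLink q))"
    then show ?thesis using C by (intro blks_connected[of P VLink s]) (auto simp: swedges_def nd_link_nd)
  next
    fix k assume "k < length xs" "C \<in># blks (itree (xs ! k)) (\<lambda>q. s (VSeq k q))"
    then show ?thesis using C by (intro blks_connected[of "itree (xs ! k)" "VSeq k" s])
      (auto simp: swedges_def nd_seq_nd)
  qed
  with step.IH show ?case by (rule rtrancl_trans)
qed simp

lemma vertsE:
  assumes "v \<in> verts P xs"
  obtains p where "p \<in> poss P" "v = nd VLink P p"
  | k p where "k < length xs" "p \<in> poss (itree (xs ! k))" "v = nd (VSeq k) (itree (xs ! k)) p"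
  using assms unfolding verts_def nd_link_nd nd_seq_nd by blast

lemma path_to_gl:
  assumes "v \<in> verts P xs"
  shows "(v, VLeaf (gl P xs s v)) \<in> (adj (swedges P xs s))\<^sup>*"
  using assms
proof (cases rule: vertsE)
  case (1 p)
  then show ?thesis using dleaf_connected[of p P VLink s "swedges P xs s"]
    by (auto simp: swedges_def nd_link_nd)
next
  case (2 k p)
  then have "tedges (itree (xs ! k)) (nd (VSeq k) (itree (xs ! k))) s \<subseteq> swedges P xs s"
    by (auto simp: swedges_def nd_seq_nd)
  then show ?thesis using dleaf_connected[OF 2(2)] 2(3) by auto
qed

lemma path_leaf_iff:
  assumes "v \<in> verts P xs"
  shows "(VLeaf a, v) \<in> (adj (swedges P xs s))\<^sup>* \<longleftrightarrow> (a, gl P xs s v) \<in> (hrel (tblk P xs s))\<^sup>*"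
proof
  assume "(VLeaf a, v) \<in> (adj (swedges P xs s))\<^sup>*"
  from path_gl[OF this] show "(a, gl P xs s v) \<in> (hrel (tblk P xs s))\<^sup>*" by simp
next
  assume "(a, gl P xs s v) \<in> (hrel (tblk P xs s))\<^sup>*"
  from path_of_blocks[OF this] adj_sym[OF path_to_gl[OF assms]]
  show "(VLeaf a, v) \<in> (adj (swedges P xs s))\<^sup>*" by (rule rtrancl_trans)
qed

lemma verts_leaf: "i \<in> names P \<Longrightarrow> VLeaf i \<in> verts P xs"
proof -
  assume "i \<in> names P"
  then obtain l where "(l, i) \<in> set (leaves P)" by (auto simp: names_def)
  from leaf_position[OF this] obtain p where "p \<in> poss P" "sub P p = Leaf l i" by blast
  then show ?thesis unfolding verts_def nd_link_nd by (intro UnI1 image_eqI[of _ _ p]) (auto simp: nd_def)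
qed

lemma gl_names:
  assumes "v \<in> verts P xs" "\<And>k. k < length xs \<Longrightarrow> names (itree (xs ! k)) \<subseteq> names P"
  shows "gl P xs s v \<in> names P"
  using assms(1)
proof (cases rule: vertsE)
  case (1 p)
  then show ?thesis using dleaf_names names_sub by fastforce
next
  case (2 k p)
  then show ?thesis using dleaf_names names_sub assms(2)[OF 2(1)] by fastforce
qed

lemma uconnected_iff_hconn:
  assumes "\<And>k. k < length xs \<Longrightarrow> names (itree (xs ! k)) \<subseteq> names P"
  shows "uconnected (verts P xs) (swedges P xs s) \<longleftrightarrow> hconn (names P) (tblk P xs s)"
proof
  assume "uconnected (verts P xs) (swedges P xs s)"
  then have "(VLeaf i, VLeaf j) \<in> (adj (swedges P xs s))\<^sup>*" if "i \<in> names P" "j \<in> names P" for i j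
    using that verts_leaf unfolding uconnected_def by blast
  from path_gl[OF this] show "hconn (names P) (tblk P xs s)" unfolding hconn_def by simp
next
  assume h: "hconn (names P) (tblk P xs s)"
  show "uconnected (verts P xs) (swedges P xs s)"
    unfolding uconnected_def
  proof (intro ballI)
    fix u v assume uv: "u \<in> verts P xs" "v \<in> verts P xs"
    have "(gl P xs s u, gl P xs s v) \<in> (hrel (tblk P xs s))\<^sup>*"
      using h gl_names[OF uv(1) assms] gl_names[OF uv(2) assms] unfolding hconn_def by blast
    then have "(VLeaf (gl P xs s u), v) \<in> (adj (swedges P xs s))\<^sup>*" using path_leaf_iff[OF uv(2)] by simp
    with path_to_gl[OF uv(1)] show "(u, v) \<in> (adj (swedges P xs s))\<^sup>*" by (rule rtrancl_trans)
  qed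
qed

subsection \<open>Counting\<close>

definition ipos :: "'a tm \<Rightarrow> bool list set" where
  "ipos t = {p \<in> poss t. \<not> is_leaf (sub t p)}"

lemma ipos_simps [simp]:
  "ipos (Leaf l i) = {}"
  "ipos (Tens A B) = insert [] (Cons False ` ipos A \<union> Cons True ` ipos B)"
  "ipos (Par A B) = insert [] (Cons False ` ipos A \<union> Cons True ` ipos B)"
  by (auto simp: ipos_def)

lemma finite_ipos [simp]: "finite (ipos t)"
  by (induction t) auto

lemma card_ipos: "card (ipos t) + 1 = length (leaves t)"
proof -
  have c: "card (Cons False ` X \<union> Cons True ` Y) = card X + card Y" if "finite X" "finite Y" for X Y :: "bool list set"
    using that by (subst card_Un_disjoint) (auto simp: card_image)
  show ?thesis by (induction t) (auto simp: c card_insert_if)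
qed

text \<open>Two edges for each inner node, less one for each par.\<close>

lemma card_eidx: "finite (eidx t \<sigma>) \<and> card (eidx t \<sigma>) + npar t = 2 * card (ipos t)"
proof -
  have inj: "inj_on (map_prod (Cons b) id) S" for b and S :: "(bool list \<times> bool) set" by (auto simp: inj_on_def)
  have c: "card (map_prod (Cons False) id ` X \<union> map_prod (Cons True) id ` Y) = card X + card Y"
    if "finite X" "finite Y" for X Y :: "(bool list \<times> bool) set"
    using that by (subst card_Un_disjoint) (auto simp: card_image inj)
  have "finite (eidx t \<sigma>) \<and> card (eidx t \<sigma>) + npar t + 2 = 2 * length (leaves t)"
  proof (induction t arbitrary: \<sigma>)
    case (Tens A B)
    from Tens.IH(1)[of "\<lambda>q. \<sigma> (False # q)"] Tens.IH(2)[of "\<lambda>q. \<sigma> (True # q)"]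
    show ?case by (auto simp: eidx_simps c card_insert_if)
  next
    case (Par A B)
    from Par.IH(1)[of "\<lambda>q. \<sigma> (False # q)"] Par.IH(2)[of "\<lambda>q. \<sigma> (True # q)"]
    show ?case by (auto simp: eidx_simps c card_insert_if)
  qed (simp add: eidx_simps)
  then show ?thesis using card_ipos[of t] by auto
qed

lemma nd_ipos: "p \<in> ipos t \<Longrightarrow> nd c t p = c p"
  by (cases "sub t p") (auto simp: ipos_def nd_def)

lemma nd_image: "nd c t ` poss t = VLeaf ` names t \<union> c ` ipos t"
proof
  show "nd c t ` poss t \<subseteq> VLeaf ` names t \<union> c ` ipos t"
  proof
    fix v assume "v \<in> nd c t ` poss t"
    then obtain p where p: "p \<in> poss t" "v = nd c t p" by blast
    show "v \<in> VLeaf ` names t \<union> c ` ipos t"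
    proof (cases "is_leaf (sub t p)")
      case True
      then obtain l i where "sub t p = Leaf l i" by (cases "sub t p") auto
      then show ?thesis using p sub_leaf_names[OF p(1)] by (force simp: names_def nd_def)
    next
      case False
      then have "p \<in> ipos t" using p by (simp add: ipos_def)
      then show ?thesis using p nd_ipos by blast
    qed
  qed
  show "VLeaf ` names t \<union> c ` ipos t \<subseteq> nd c t ` poss t"
  proof (intro Un_least subsetI)
    fix v assume "v \<in> VLeaf ` names t"
    then obtain l i where i: "(l, i) \<in> set (leaves t)" "v = VLeaf i" by (auto simp: names_def)
    from leaf_position[OF i(1)] obtain p where "p \<in> poss t" "sub t p = Leaf l i" by blast
    then show "v \<in> nd c t ` poss t" using i by (intro image_eqI[of _ _ p]) (auto simp: nd_def)
  next
    fix v assume "v \<in> c ` ipos t"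
    then obtain p where "p \<in> ipos t" "v = c p" by blast
    then show "v \<in> nd c t ` poss t" using nd_ipos[of p t c] by (intro image_eqI[of _ _ p]) (auto simp: ipos_def)
  qed
qed

lemma seq_leaves_add [simp]: "seq_leaves (add_mset c \<Gamma>) = mset (leaves (itree c)) + seq_leaves \<Gamma>"
  by (simp add: seq_leaves_def)

lemma seq_leaves_empty [simp]: "seq_leaves {#} = {#}"
  by (simp add: seq_leaves_def)

lemma seq_leaves_split:
  assumes "dnames P" "mset (leaves P) = mset (leaves t) + R"
  obtains zs where "mset zs = R" "distinct (map snd (leaves t @ zs))"
    "names P = names t \<union> snd ` set_mset R" "names t \<inter> snd ` set_mset R = {}"
proof -
  obtain zs where zs: "mset zs = R" by (meson ex_mset)
  then have e: "mset (leaves P) = mset (leaves t @ zs)" using assms(2) by simp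
  then have "mset (map snd (leaves P)) = mset (map snd (leaves t @ zs))" by (metis mset_map)
  then have d: "distinct (map snd (leaves t @ zs))" using assms(1) mset_eq_imp_distinct_iff by blast
  have "set (leaves P) = set (leaves t) \<union> set zs" using mset_eq_setD[OF e] by simp
  then have "names P = names t \<union> snd ` set zs" by (auto simp: names_def)
  moreover have "names t \<inter> snd ` set zs = {}" using d by (auto simp: names_def)
  ultimately show thesis using that zs d by auto
qed

lemma wf_names_item:
  assumes "dnames P" "mset (leaves P) = seq_leaves \<Gamma>" "c \<in># \<Gamma>"
  shows "dnames (itree c)" "names (itree c) \<subseteq> names P"
proof -
  obtain \<Delta> where "\<Gamma> = add_mset c \<Delta>" using assms(3) by (meson mset_add)
  then have "mset (leaves P) = mset (leaves (itree c)) + seq_leaves \<Delta>" using assms(2) by simp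
  from seq_leaves_split[OF assms(1) this] show "dnames (itree c)" "names (itree c) \<subseteq> names P" by auto
qed

lemma sum_nth_mset: "(\<Sum>k<length xs. f (xs ! k)) = (\<Sum>x\<in>#mset xs. f x)"
proof -
  have "(\<Sum>x\<in>#mset xs. f x) = sum_list (map f xs)" by (metis mset_map sum_mset_sum_list)
  then show ?thesis by (simp add: sum_list_sum_nth atLeast0LessThan)
qed

lemma length_leaves_seq: "mset (leaves P) = seq_leaves \<Gamma> \<Longrightarrow> length (leaves P) = (\<Sum>c\<in>#\<Gamma>. length (leaves (itree c)))"
proof -
  have "size (seq_leaves \<Gamma>) = (\<Sum>c\<in>#\<Gamma>. length (leaves (itree c)))" by (induction \<Gamma>) auto
  then show "mset (leaves P) = seq_leaves \<Gamma> \<Longrightarrow> ?thesis" by (metis size_mset)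
qed

lemma verts_eq:
  assumes "\<And>k. k < length xs \<Longrightarrow> names (itree (xs ! k)) \<subseteq> names P"
  shows "verts P xs = VLeaf ` names P \<union> VLink ` ipos P \<union> (\<Union>k<length xs. VSeq k ` ipos (itree (xs ! k)))"
  unfolding verts_def nd_link_nd nd_seq_nd nd_image using assms by blast

lemma card_verts:
  assumes "\<And>k. k < length xs \<Longrightarrow> names (itree (xs ! k)) \<subseteq> names P"
  shows "finite (verts P xs) \<and>
    card (verts P xs) = card (names P) + card (ipos P) + (\<Sum>k<length xs. card (ipos (itree (xs ! k))))"
proof -
  have inj: "inj_on VLeaf A" "inj_on VLink B" "inj_on (VSeq k) B" for A B k by (auto simp: inj_on_def)
  have "card (\<Union>k<length xs. VSeq k ` ipos (itree (xs ! k))) = (\<Sum>k<length xs. card (ipos (itree (xs ! k))))"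
    by (subst card_UN_disjoint) (auto simp: card_image inj)
  moreover have "card (VLeaf ` names P \<union> VLink ` ipos P) = card (names P) + card (ipos P)"
    by (subst card_Un_disjoint) (auto simp: card_image inj)
  moreover have "card (VLeaf ` names P \<union> VLink ` ipos P \<union> (\<Union>k<length xs. VSeq k ` ipos (itree (xs ! k))))
      = card (VLeaf ` names P \<union> VLink ` ipos P) + card (\<Union>k<length xs. VSeq k ` ipos (itree (xs ! k)))"
    by (rule card_Un_disjoint) auto
  moreover have "verts P xs = VLeaf ` names P \<union> VLink ` ipos P \<union> (\<Union>k<length xs. VSeq k ` ipos (itree (xs ! k)))"
    using assms by (rule verts_eq)
  ultimately show ?thesis by simp
qed

lemma nd_inj:
  assumes "dnames t" "inj c" "\<And>p i. c p \<noteq> VLeaf i"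
  shows "inj_on (nd c t) (poss t)"
proof (rule inj_onI)
  fix p q assume pq: "p \<in> poss t" "q \<in> poss t" "nd c t p = nd c t q"
  show "p = q"
  proof (cases "sub t p")
    case p: (Leaf l i)
    then have "\<exists>l'. sub t q = Leaf l' i" using pq(3) assms(3) by (cases "sub t q") (auto simp: nd_def dest: sym)
    then show ?thesis using leaf_position_unique[OF assms(1) pq(1,2) p] by blast
  next
    case (Tens A B)
    then have "c p = c q" using pq(3) assms(3) by (cases "sub t q") (auto simp: nd_def)
    then show ?thesis using assms(2) by (simp add: inj_eq)
  next
    case (Par A B)
    then have "c p = c q" using pq(3) assms(3) by (cases "sub t q") (auto simp: nd_def)
    then show ?thesis using assms(2) by (simp add: inj_eq)
  qed
qed

lemma eidx_poss: "(p, b) \<in> eidx t \<sigma> \<Longrightarrow> p \<in> ipos t \<and> p \<in> poss t \<and> p @ [b] \<in> poss t"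
  using poss_snoc[of p t b] by (cases "sub t p") (auto simp: eidx_def ipos_def)

lemma tedges_inj:
  assumes "dnames t" "inj c" "\<And>p i. c p \<noteq> VLeaf i" "p \<in> ipos t" "p' \<in> ipos t"
    "{nd c t p, nd c t (p @ [b])} = {nd c t p', nd c t (p' @ [b'])}"
  shows "p = p' \<and> b = b'"
proof -
  have eq: "nd c t p = nd c t q \<longleftrightarrow> p = q" if "p \<in> poss t" "q \<in> poss t" for p q
    using nd_inj[OF assms(1-3)] that by (auto dest: inj_onD)
  have "p \<in> poss t" "p' \<in> poss t" "p @ [b] \<in> poss t" "p' @ [b'] \<in> poss t"
    using assms(4,5) poss_snoc unfolding ipos_def by blast+
  \<comment> \<open>Equality of unordered pairs allows a second matching, in which each position
    would be a proper prefix of the other.\<close>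
  then have "(p = p' \<and> p @ [b] = p' @ [b']) \<or> (p = p' @ [b'] \<and> p @ [b] = p')"
    using assms(6) by (simp add: doubleton_eq_iff eq)
  then show ?thesis by auto
qed

lemma card_tedges:
  assumes "dnames t" "inj c" "\<And>p i. c p \<noteq> VLeaf i"
  shows "finite (tedges t (nd c t) s) \<and> card (tedges t (nd c t) s) + npar t = 2 * card (ipos t)"
proof -
  have "inj_on (\<lambda>(p, b). {nd c t p, nd c t (p @ [b])}) (eidx t (\<lambda>q. s (c q)))"
    using tedges_inj[OF assms] eidx_poss by (intro inj_onI) (auto, blast+)
  then show ?thesis using card_eidx[of t "\<lambda>q. s (c q)"] by (simp add: tedges_image card_image)
qed

text \<open>Makes the edge sets of different trees disjoint: trees share only leaf vertices, and no
  edge joins two leaves.\<close>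

lemma tedges_parent: "e \<in> tedges t (nd c t) s \<Longrightarrow> \<exists>p. c p \<in> e \<and> (\<forall>v\<in>e. (\<exists>i. v = VLeaf i) \<or> (\<exists>q. v = c q))"
  by (erule tedgesE) (auto simp: nd_def split: tm.splits)

lemma card_swedges:
  assumes "dnames P" "\<And>k. k < length xs \<Longrightarrow> dnames (itree (xs ! k))"
  shows "finite (swedges P xs s) \<and>
    card (swedges P xs s) + npar P + (\<Sum>k<length xs. npar (itree (xs ! k))) =
      2 * (card (ipos P) + (\<Sum>k<length xs. card (ipos (itree (xs ! k)))))"
proof -
  let ?E = "\<lambda>k. tedges (itree (xs ! k)) (nd (VSeq k) (itree (xs ! k))) s"
  have cP: "finite (tedges P (nd VLink P) s)" "card (tedges P (nd VLink P) s) + npar P = 2 * card (ipos P)"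
    using card_tedges[OF assms(1), of VLink s] by (auto simp: inj_def)
  have ck: "finite (?E k)" "card (?E k) + npar (itree (xs ! k)) = 2 * card (ipos (itree (xs ! k)))"
    if "k < length xs" for k
    using card_tedges[OF assms(2)[OF that], of "VSeq k" s] by (auto simp: inj_def)
  have disj: "?E k \<inter> ?E l = {}" if "k \<noteq> l" for k l
    using that by (fastforce dest!: tedges_parent)
  have "card (\<Union>k<length xs. ?E k) = (\<Sum>k<length xs. card (?E k))"
    using ck disj by (intro card_UN_disjoint) auto
  moreover have "(\<Sum>k<length xs. card (?E k)) + (\<Sum>k<length xs. npar (itree (xs ! k)))
      = (\<Sum>k<length xs. 2 * card (ipos (itree (xs ! k))))"
    unfolding sum.distrib[symmetric] using ck by (intro sum.cong) auto
  moreover have "tedges P (nd VLink P) s \<inter> (\<Union>k<length xs. ?E k) = {}"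
    by (fastforce dest!: tedges_parent)
  then have "card (swedges P xs s) = card (tedges P (nd VLink P) s) + card (\<Union>k<length xs. ?E k)"
    unfolding swedges_def nd_link_nd nd_seq_nd using cP ck by (intro card_Un_disjoint) auto
  moreover have "finite (swedges P xs s)" unfolding swedges_def nd_link_nd nd_seq_nd using cP ck by auto
  ultimately show ?thesis using cP by (simp add: sum_distrib_left)
qed

lemma swedges_verts:
  assumes "dnames P" "\<And>k. k < length xs \<Longrightarrow> dnames (itree (xs ! k))" "e \<in> swedges P xs s"
  shows "\<exists>u w. e = {u, w} \<and> u \<noteq> w \<and> u \<in> verts P xs \<and> w \<in> verts P xs"
proof -
  have neq: "nd c t p \<noteq> nd c t (p @ [b])" if "dnames t" "inj c" "\<And>p i. c p \<noteq> VLeaf i" "p \<in> poss t" "p @ [b] \<in> poss t"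
    for c p b and t :: "'a tm"
    using inj_onD[OF nd_inj[OF that(1-3)] _ that(4,5)] by auto
  from assms(3) show ?thesis
  proof (cases rule: swedgesE)
    case (1 p b)
    have "p @ [b] \<in> poss P" using 1 poss_snoc by blast
    moreover have "nd VLink P p \<noteq> nd VLink P (p @ [b])"
      using 1 calculation assms(1) by (intro neq) (auto simp: inj_def)
    ultimately show ?thesis using 1 unfolding verts_def nd_link_nd by blast
  next
    case (2 k p b)
    have "p @ [b] \<in> poss (itree (xs ! k))" using 2 poss_snoc by blast
    moreover have "nd (VSeq k) (itree (xs ! k)) p \<noteq> nd (VSeq k) (itree (xs ! k)) (p @ [b])"
      using 2 calculation assms(2) by (intro neq) (auto simp: inj_def)
    ultimately show ?thesis using 2 unfolding verts_def nd_seq_nd by blast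
  qed
qed

text \<open>The Euler characteristic of a switched graph does not depend on the switching. Thus acyclicity can be
  replaced by a count of leaves, pars and formulas.\<close>

definition par_count :: "'a tm \<Rightarrow> 'a item multiset \<Rightarrow> bool" where
  "par_count P \<Gamma> \<longleftrightarrow> length (leaves P) = npar P + (\<Sum>c\<in>#\<Gamma>. npar (itree c)) + size \<Gamma>"

text \<open>With L leaves, n items and k pars in total, a switched graph has L + (L - 1) + (L - n)
  vertices and 2 ((L - 1) + (L - n)) - k edges. If connected, it is a tree exactly when L = k + n,
  which is \<open>par_count\<close>.\<close>

lemma switch_ok_iff:
  assumes "dnames P" "mset (leaves P) = seq_leaves (mset xs)"
  shows "switch_ok P xs \<longleftrightarrow> par_count P (mset xs) \<and> (\<forall>s. hconn (names P) (tblk P xs s))"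
proof -
  have it: "dnames (itree (xs ! k))" "names (itree (xs ! k)) \<subseteq> names P" if "k < length xs" for k
    using wf_names_item[OF assms, of "xs ! k"] that by auto
  have edges: "\<forall>e\<in>swedges P xs s. \<exists>u w. e = {u, w} \<and> u \<noteq> w \<and> u \<in> verts P xs \<and> w \<in> verts P xs" for s
    using swedges_verts[OF assms(1) it(1)] by blast
  have ne: "verts P xs \<noteq> {}" unfolding verts_def using poss_Nil[of P] by blast
  have tree: "uacyclic (swedges P xs s) \<longleftrightarrow> par_count P (mset xs)" if "uconnected (verts P xs) (swedges P xs s)" for s
  proof -
    let ?I = "\<Sum>k<length xs. card (ipos (itree (xs ! k)))"
    let ?N = "\<Sum>k<length xs. npar (itree (xs ! k))"
    have "uacyclic (swedges P xs s) \<longleftrightarrow> card (swedges P xs s) + 1 = card (verts P xs)"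
      using card_verts[OF it(2)] card_swedges[OF assms(1) it(1)] ne edges that by (intro tree_card) auto
    moreover have "card (verts P xs) = length (leaves P) + card (ipos P) + ?I"
      using card_verts[OF it(2)] card_names[OF assms(1)] by simp
    moreover have "card (swedges P xs s) + npar P + ?N = 2 * (card (ipos P) + ?I)"
      using card_swedges[OF assms(1) it(1)] by blast
    moreover have "?I + length xs = length (leaves P)"
    proof -
      have "?I + length xs = (\<Sum>k<length xs. card (ipos (itree (xs ! k))) + 1)" by (subst sum.distrib) simp
      also have "\<dots> = (\<Sum>k<length xs. length (leaves (itree (xs ! k))))" by (simp only: card_ipos)
      also have "\<dots> = length (leaves P)" using length_leaves_seq[OF assms(2)]
        sum_nth_mset[of "\<lambda>c. length (leaves (itree c))" xs] by simp
      finally show ?thesis .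
    qed
    moreover have "?N = (\<Sum>c\<in>#mset xs. npar (itree c))" by (rule sum_nth_mset)
    ultimately show ?thesis using card_ipos[of P] unfolding par_count_def by auto
  qed
  show ?thesis unfolding switch_ok_def using tree uconnected_iff_hconn[OF it(2)] by blast
qed

text \<open>Vertex names depend on the order chosen for the items, the blocks do not. Building them
  from the multiset makes the quantifier over all orders in \<open>proof_graph\<close>
  disappear.\<close>

inductive swm :: "'a item multiset \<Rightarrow> nat set multiset \<Rightarrow> bool" where
  swm_empty: "swm {#} {#}"
| swm_add: "M \<in> full (itree c) \<Longrightarrow> swm \<Gamma> N \<Longrightarrow> swm (add_mset c \<Gamma>) (M + N)"

lemma swm_remove:
  "swm \<Delta> N \<Longrightarrow> c \<in># \<Delta> \<Longrightarrow> \<exists>M N'. M \<in> full (itree c) \<and> swm (\<Delta> - {#c#}) N' \<and> N = M + N'"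
proof (induction rule: swm.induct)
  case (swm_add M d \<Gamma> N)
  show ?case
  proof (cases "c = d")
    case True
    then show ?thesis using swm_add by auto
  next
    case False
    then obtain M' N' where h: "M' \<in> full (itree c)" "swm (\<Gamma> - {#c#}) N'" "N = M' + N'" using swm_add by auto
    have "swm (add_mset d (\<Gamma> - {#c#})) (M + N')" using swm_add.hyps(1) h(2) by (rule swm.swm_add)
    then show ?thesis using False h by (intro exI[of _ M'] exI[of _ "M + N'"]) (auto simp: ac_simps)
  qed
qed simp

lemma swm_add_iff:
  "swm (add_mset c \<Gamma>) N \<longleftrightarrow> (\<exists>M N'. M \<in> full (itree c) \<and> swm \<Gamma> N' \<and> N = M + N')"
  using swm_remove[of "add_mset c \<Gamma>" N c] swm.swm_add by auto

lemma swm_empty_iff [simp]: "swm {#} N \<longleftrightarrow> N = {#}"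
  using swm.cases[of "{#}" N] swm.swm_empty by auto

lemma swm_list:
  "swm (mset xs) N \<longleftrightarrow> (\<exists>\<sigma>. N = (\<Sum>k<length xs. blks (itree (xs ! k)) (\<sigma> k)))"
proof (induction xs arbitrary: N rule: rev_induct)
  case (snoc x xs)
  have "swm (mset (xs @ [x])) N \<longleftrightarrow>
    (\<exists>\<tau> \<sigma>. N = blks (itree x) \<tau> + (\<Sum>k<length xs. blks (itree (xs ! k)) (\<sigma> k)))"
    by (auto simp: swm_add_iff snoc full_blks)
  also have "\<dots> \<longleftrightarrow> (\<exists>\<sigma>. N = (\<Sum>k<length (xs @ [x]). blks (itree ((xs @ [x]) ! k)) (\<sigma> k)))"
  proof
    assume "\<exists>\<tau> \<sigma>. N = blks (itree x) \<tau> + (\<Sum>k<length xs. blks (itree (xs ! k)) (\<sigma> k))"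
    then obtain \<tau> \<sigma> where "N = blks (itree x) \<tau> + (\<Sum>k<length xs. blks (itree (xs ! k)) (\<sigma> k))" by blast
    then have "N = (\<Sum>k<length (xs @ [x]). blks (itree ((xs @ [x]) ! k)) ((\<sigma>(length xs := \<tau>)) k))"
      by (simp add: nth_append add.commute)
    then show "\<exists>\<sigma>. N = (\<Sum>k<length (xs @ [x]). blks (itree ((xs @ [x]) ! k)) (\<sigma> k))" by blast
  next
    assume "\<exists>\<sigma>. N = (\<Sum>k<length (xs @ [x]). blks (itree ((xs @ [x]) ! k)) (\<sigma> k))"
    then obtain \<sigma> where "N = (\<Sum>k<length (xs @ [x]). blks (itree ((xs @ [x]) ! k)) (\<sigma> k))" by blast
    then have "N = blks (itree x) (\<sigma> (length xs)) + (\<Sum>k<length xs. blks (itree (xs ! k)) (\<sigma> k))"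
      by (simp add: nth_append add.commute)
    then show "\<exists>\<tau> \<sigma>. N = blks (itree x) \<tau> + (\<Sum>k<length xs. blks (itree (xs ! k)) (\<sigma> k))" by blast
  qed
  finally show ?case .
qed simp

text \<open>A switching acts independently on the linking and on each item.\<close>

lemma tblk_range: "(\<exists>s. T = tblk P xs s) \<longleftrightarrow> (\<exists>M\<in>full P. \<exists>N. swm (mset xs) N \<and> T = M + N)"
proof
  assume "\<exists>s. T = tblk P xs s"
  then obtain s where "T = tblk P xs s" by blast
  then show "\<exists>M\<in>full P. \<exists>N. swm (mset xs) N \<and> T = M + N"
    unfolding swm_list tblk_def full_blks
    by (intro bexI[of _ "blks P (\<lambda>q. s (VLink q))"] exI conjI[rotated] refl
        exI[of _ "\<lambda>k q. s (VSeq k q)"]) auto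
next
  assume "\<exists>M\<in>full P. \<exists>N. swm (mset xs) N \<and> T = M + N"
  then obtain \<tau> \<sigma> where T: "T = blks P \<tau> + (\<Sum>k<length xs. blks (itree (xs ! k)) (\<sigma> k))"
    unfolding swm_list full_blks by auto
  \<comment> \<open>Leaves have no premises to choose from, so any value serves there.\<close>
  define s where "s v = (case v of VLeaf i \<Rightarrow> False | VLink q \<Rightarrow> \<tau> q | VSeq k q \<Rightarrow> \<sigma> k q)" for v
  have "T = tblk P xs s" unfolding T tblk_def s_def by simp
  then show "\<exists>s. T = tblk P xs s" by blast
qed

definition bconn :: "'a tm \<Rightarrow> 'a item multiset \<Rightarrow> bool" where
  "bconn P \<Gamma> \<longleftrightarrow> (\<forall>M\<in>full P. \<forall>N. swm \<Gamma> N \<longrightarrow> hconn (names P) (M + N))"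

lemma proof_graph_iff:
  "proof_graph (P, \<Gamma>) \<longleftrightarrow> is_linking P \<and> (\<forall>c\<in>#\<Gamma>. item_ok c) \<and> dnames P \<and>
     mset (leaves P) = seq_leaves \<Gamma> \<and> par_count P \<Gamma> \<and> bconn P \<Gamma>"
proof -
  obtain ys where ys: "mset ys = \<Gamma>" by (meson ex_mset)
  have "(\<forall>xs. mset xs = \<Gamma> \<longrightarrow> switch_ok P xs) \<longleftrightarrow> par_count P \<Gamma> \<and> bconn P \<Gamma>"
    if h: "dnames P" "mset (leaves P) = seq_leaves \<Gamma>"
  proof -
    have "switch_ok P xs \<longleftrightarrow> par_count P \<Gamma> \<and> bconn P \<Gamma>" if xs: "mset xs = \<Gamma>" for xs
    proof -
      have "(\<forall>s. hconn (names P) (tblk P xs s)) \<longleftrightarrow> (\<forall>T. (\<exists>s. T = tblk P xs s) \<longrightarrow> hconn (names P) T)" by blast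
      also have "\<dots> \<longleftrightarrow> bconn P \<Gamma>" unfolding tblk_range xs bconn_def by blast
      finally show ?thesis using switch_ok_iff[of P xs] h xs by simp
    qed
    then show ?thesis using ys by blast
  qed
  then show ?thesis unfolding proof_graph_def by auto
qed

subsection \<open>Preservation of correctness\<close>

lemma is_linking_sub: "is_linking P \<Longrightarrow> p \<in> poss P \<Longrightarrow> \<not> is_leaf (sub P p) \<Longrightarrow> is_linking (sub P p)"
  by (induction arbitrary: p rule: is_linking.induct) (auto intro: is_linking.intros)

lemma is_linking_rep:
  "is_linking P \<Longrightarrow> p \<in> poss P \<Longrightarrow> \<not> is_leaf (sub P p) \<Longrightarrow> is_linking u \<Longrightarrow> is_linking (rep P p u)"
  by (induction arbitrary: p rule: is_linking.induct) (auto simp del: is_leaf.simps simp: is_leaf.simps(1) intro!: is_linking.intros)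

lemma is_linking_Par [simp]: "is_linking (Par A B) \<longleftrightarrow> is_linking A \<and> is_linking B"
  by (subst is_linking.simps) auto

lemma is_linking_Leaf [simp]: "is_linking (Leaf l i) \<longleftrightarrow> l = One"
  by (subst is_linking.simps) auto

lemma is_linking_Tens_Bot [simp]:
  "is_linking (Tens A (Leaf Bot i)) \<longleftrightarrow> is_linking A"
  by (subst is_linking.simps) auto

lemma is_linking_Tens_comm: "is_linking (Tens A B) \<Longrightarrow> is_linking (Tens B A)"
  by (erule is_linking.cases) (auto intro: is_linking.intros)

lemma same_leaves:
  assumes "mset (leaves Q) = mset (leaves P)"
  shows "names Q = names P" "dnames Q \<longleftrightarrow> dnames P" "length (leaves Q) = length (leaves P)"
proof -
  show "names Q = names P" using mset_eq_setD[OF assms] by (simp add: names_def)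
  have "mset (map snd (leaves Q)) = mset (map snd (leaves P))" using assms by (metis mset_map)
  then show "dnames Q \<longleftrightarrow> dnames P" by (rule mset_eq_imp_distinct_iff)
  show "length (leaves Q) = length (leaves P)" using assms by (metis size_mset)
qed

lemma leaves_rep_eq:
  assumes "p \<in> poss P" "mset (leaves u) = mset (leaves (sub P p))"
  shows "mset (leaves (rep P p u)) = mset (leaves P)"
  using leaves_rep[OF assms(1), of u] assms(2) by simp

lemma proof_graph_rep:
  assumes "proof_graph (P, \<Gamma>)" "p \<in> poss P" "\<not> is_leaf (sub P p)" "is_linking u"
    "mset (leaves u) = mset (leaves (sub P p))" "npar u = npar (sub P p)"
    "bconn (rep P p u) \<Gamma>"
  shows "proof_graph (rep P p u, \<Gamma>)"
  using assms is_linking_rep[of P p u] same_leaves[OF leaves_rep_eq[OF assms(2,5)]]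
    leaves_rep_eq[OF assms(2,5)] npar_rep[OF assms(2), of u]
  unfolding proof_graph_iff par_count_def by simp

text \<open>Covers the commutativities and associativity, which leave the set of possible blocks as
  it is.\<close>

lemma proof_graph_rep_swp:
  assumes "proof_graph (P, \<Gamma>)" "p \<in> poss P" "\<not> is_leaf (sub P p)" "is_linking u"
    "mset (leaves u) = mset (leaves (sub P p))" "npar u = npar (sub P p)" "swp u = swp (sub P p)"
  shows "proof_graph (rep P p u, \<Gamma>)"
proof (rule proof_graph_rep[OF assms(1-6)])
  have "full (rep P p u) = full P"
    using swp_rep_cong[OF assms(7), of P p] rep_sub[OF assms(2)] by (simp add: full_def)
  then show "bconn (rep P p u) \<Gamma>"
    using assms(1) same_leaves(1)[OF leaves_rep_eq[OF assms(2,5)]] unfolding proof_graph_iff bconn_def by simp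
qed

lemma swp_TensI: "(X, M) \<in> swp A \<Longrightarrow> (Y, N) \<in> swp B \<Longrightarrow> (X \<union> Y, M + N) \<in> swp (Tens A B)"
  by auto

lemma swp_ParI1: "(X, M) \<in> swp A \<Longrightarrow> (Y, N) \<in> swp B \<Longrightarrow> (X, add_mset Y (M + N)) \<in> swp (Par A B)"
  by auto

lemma swp_ParI2: "(X, M) \<in> swp A \<Longrightarrow> (Y, N) \<in> swp B \<Longrightarrow> (Y, add_mset X (M + N)) \<in> swp (Par A B)"
  by auto

lemma swp_TensE:
  assumes "(Z, L) \<in> swp (Tens A B)"
  obtains X M Y N where "(X, M) \<in> swp A" "(Y, N) \<in> swp B" "Z = X \<union> Y" "L = M + N"
  using assms by auto

lemma swp_ParE:
  assumes "(Z, L) \<in> swp (Par A B)"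
  obtains X M Y N where "(X, M) \<in> swp A" "(Y, N) \<in> swp B" "Z = X" "L = add_mset Y (M + N)"
  | X M Y N where "(X, M) \<in> swp A" "(Y, N) \<in> swp B" "Z = Y" "L = add_mset X (M + N)"
  using assms by auto

lemma fullI: "(X, N) \<in> swp t \<Longrightarrow> add_mset X N \<in> full t"
  by (auto simp: full_iff)

text \<open>In either bracketing any one of the three root blocks may survive as root block, and the
  other two are cut off.\<close>

lemma swp_Par_assoc: "swp (Par A (Par B C)) = swp (Par (Par A B) C)"
proof -
  have le: "swp (Par A (Par B C)) \<subseteq> swp (Par (Par A B) C)" for A B C :: "'a tm"
  proof (rule subrelI)
    fix Z L assume "(Z, L) \<in> swp (Par A (Par B C))"
    then show "(Z, L) \<in> swp (Par (Par A B) C)"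
    proof (cases rule: swp_ParE)
      case 1: (1 X M W O')
      from 1(2) show ?thesis
      proof (cases rule: swp_ParE)
        case (1 Y N V K)
        from swp_ParI1[OF swp_ParI1[OF \<open>(X, M) \<in> swp A\<close> 1(1)] 1(2)] show ?thesis
          using \<open>Z = X\<close> \<open>L = _\<close> 1(3,4) by (simp add: ac_simps add_mset_commute del: swp.simps)
      next
        case (2 Y N V K)
        from swp_ParI1[OF swp_ParI1[OF \<open>(X, M) \<in> swp A\<close> 2(1)] 2(2)] show ?thesis
          using \<open>Z = X\<close> \<open>L = _\<close> 2(3,4) by (simp add: ac_simps add_mset_commute del: swp.simps)
      qed
    next
      case 2: (2 X M W O')
      from 2(2) show ?thesis
      proof (cases rule: swp_ParE)
        case (1 Y N V K)
        from swp_ParI1[OF swp_ParI2[OF \<open>(X, M) \<in> swp A\<close> 1(1)] 1(2)] show ?thesis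
          using \<open>Z = W\<close> \<open>L = _\<close> 1(3,4) by (simp add: ac_simps add_mset_commute del: swp.simps)
      next
        case (2 Y N V K)
        from swp_ParI2[OF swp_ParI1[OF \<open>(X, M) \<in> swp A\<close> 2(1)] 2(2)] show ?thesis
          using \<open>Z = W\<close> \<open>L = _\<close> 2(3,4) by (simp add: ac_simps add_mset_commute del: swp.simps)
      qed
    qed
  qed
  \<comment> \<open>The reverse inclusion is \<open>le\<close> applied to the three trees in reverse
    order.\<close>
  have "swp (Par (Par A B) C) = swp (Par C (Par A B))" by (rule swp_Par_comm)
  also have "\<dots> = swp (Par C (Par B A))"
    using swp_rep_cong[OF swp_Par_comm[of A B], of "Par C A" "[True]"] by (simp del: swp.simps)
  also have "\<dots> \<subseteq> swp (Par (Par C B) A)" by (rule le)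
  also have "\<dots> = swp (Par A (Par C B))" by (rule swp_Par_comm)
  also have "\<dots> = swp (Par A (Par B C))"
    using swp_rep_cong[OF swp_Par_comm[of C B], of "Par A C" "[True]"] by (simp del: swp.simps)
  finally show ?thesis using le by blast
qed

lemma pg_sub_linking:
  "proof_graph (P, \<Gamma>) \<Longrightarrow> p \<in> poss P \<Longrightarrow> \<not> is_leaf (sub P p) \<Longrightarrow> is_linking (sub P p)"
  by (simp add: proof_graph_iff is_linking_sub)

lemma proof_graph_par_comm:
  assumes "proof_graph (P, \<Gamma>)" "p \<in> poss P" "sub P p = Par A B"
  shows "proof_graph (rep P p (Par B A), \<Gamma>)"
  using pg_sub_linking[OF assms(1,2)] assms(3)
  by (intro proof_graph_rep_swp[OF assms(1,2)]) (simp_all add: swp_Par_comm[of B A] del: swp.simps)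

lemma proof_graph_tens_comm:
  assumes "proof_graph (P, \<Gamma>)" "p \<in> poss P" "sub P p = Tens A B"
  shows "proof_graph (rep P p (Tens B A), \<Gamma>)"
  using pg_sub_linking[OF assms(1,2)] assms(3)
  by (intro proof_graph_rep_swp[OF assms(1,2)])
    (simp_all add: swp_Tens_comm[of B A] is_linking_Tens_comm del: swp.simps)

lemma proof_graph_par_assoc:
  assumes "proof_graph (P, \<Gamma>)" "p \<in> poss P" "sub P p = Par (Par A B) C"
  shows "proof_graph (rep P p (Par A (Par B C)), \<Gamma>)"
  using pg_sub_linking[OF assms(1,2)] assms(3)
  by (intro proof_graph_rep_swp[OF assms(1,2)]) (simp_all add: swp_Par_assoc del: swp.simps)

lemma proof_graph_cut_sym:
  assumes "proof_graph (P, add_mset (Cut A B) \<Gamma>)" "item_ok (Cut B A)"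
  shows "proof_graph (P, add_mset (Cut B A) \<Gamma>)"
proof -
  have "full (itree (Cut A B)) = full (itree (Cut B A))"
    unfolding full_def itree.simps using swp_Tens_comm[of A B] by (rule arg_cong)
  then have "swm (add_mset (Cut B A) \<Gamma>) = swm (add_mset (Cut A B) \<Gamma>)"
    unfolding fun_eq_iff swm_add_iff by simp
  then show ?thesis using assms unfolding proof_graph_iff bconn_def par_count_def by (simp add: ac_simps)
qed

section \<open>Tightness of the block count\<close>

lemma full_blocks:
  assumes "M \<in> full t" "B \<in># M"
  shows "B \<noteq> {} \<and> finite B \<and> B \<subseteq> names t"
proof -
  obtain X N where X: "(X, N) \<in> swp t" "M = add_mset X N" using assms(1) by (auto simp: full_iff)
  then have "B = X \<or> B \<in># N" using assms(2) by auto
  then show ?thesis using swp_blocks[OF X(1)] swp_finite[OF X(1)] by auto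
qed

lemma swm_blocks: "swm \<Gamma> N \<Longrightarrow> B \<in># N \<Longrightarrow> B \<noteq> {} \<and> finite B \<and> B \<subseteq> snd ` set_mset (seq_leaves \<Gamma>)"
proof (induction rule: swm.induct)
  case (swm_add M c \<Gamma> N)
  show ?case
  proof (cases "B \<in># M")
    case True
    then show ?thesis using full_blocks[OF swm_add(1)] by (auto simp: names_def)
  next
    case False
    then show ?thesis using swm_add by auto
  qed
qed simp

lemma full_count: "M \<in> full t \<Longrightarrow> size M = npar t + 1 \<and> (\<Sum>B\<in>#M. card B) \<le> length (leaves t)"
  using swp_size[of _ _ t] swp_card[of _ _ t] by (auto simp: full_iff)

lemma swm_count: "swm \<Gamma> N \<Longrightarrow> size N = (\<Sum>c\<in>#\<Gamma>. npar (itree c)) + size \<Gamma> \<and>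
    (\<Sum>B\<in>#N. card B) \<le> (\<Sum>c\<in>#\<Gamma>. length (leaves (itree c)))"
proof (induction rule: swm.induct)
  case (swm_add M c \<Gamma> N)
  then show ?case using full_count[OF swm_add(1)] by simp
qed simp

text \<open>Supplies the hypotheses of \<open>split_block_not_conn\<close> for every switching of a
  proof graph: \<open>par_count\<close> is exactly the tight case of
  \<open>hconn_bound\<close>.\<close>

lemma proof_graph_tight:
  assumes "proof_graph (P, \<Gamma>)" "M \<in> full P" "swm \<Gamma> N"
  shows "hconn (names P) (M + N)" "\<forall>B\<in>#M + N. finite B \<and> B \<noteq> {}"
    "(\<Sum>B\<in>#M + N. card B) + 1 \<le> card (names P) + size (M + N)"
proof -
  have pg: "dnames P" "mset (leaves P) = seq_leaves \<Gamma>" "par_count P \<Gamma>" "bconn P \<Gamma>"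
    using assms(1) by (simp_all add: proof_graph_iff)
  show "hconn (names P) (M + N)" using pg assms unfolding bconn_def by blast
  show "\<forall>B\<in>#M + N. finite B \<and> B \<noteq> {}" using full_blocks[OF assms(2)] swm_blocks[OF assms(3)] by auto
  show "(\<Sum>B\<in>#M + N. card B) + 1 \<le> card (names P) + size (M + N)"
    using full_count[OF assms(2)] swm_count[OF assms(3)] pg(3) card_names[OF pg(1)] length_leaves_seq[OF pg(2)]
    unfolding par_count_def by simp
qed

section \<open>Cut reductions\<close>

lemma hrel_avoid_block:
  assumes "(a, v) \<in> (hrel (add_mset B M))\<^sup>*" "\<And>w. w \<in> B \<Longrightarrow> (a, w) \<notin> (hrel (add_mset B M))\<^sup>*"
  shows "(a, v) \<in> (hrel M)\<^sup>*"
  using assms(1)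
proof (induction rule: rtrancl_induct)
  case (step y z)
  then obtain C where C: "C \<in># add_mset B M" "y \<in> C" "z \<in> C" unfolding hrel_def by blast
  then have "C \<in># M" using assms(2) step(1) by auto
  then have "(y, z) \<in> hrel M" using C unfolding hrel_def by blast
  with step.IH show ?case by (rule rtrancl_into_rtrancl)
qed simp

text \<open>Both switchings of the par are needed. Keeping \<open>B\<close> shows, by tightness,
  that the block \<open>Xb\<close> of \<open>B\<close> is not joined to the dual side
  \<open>?U\<close> by the other blocks. Keeping \<open>A\<close> shows that \<open>Xb\<close> is
  joined to \<open>Xa\<close> or to \<open>?U\<close>, hence to \<open>Xa\<close>. So the remaining
  blocks join \<open>Xa\<close> with \<open>Xb\<close>, and the two new cuts reach all four
  pieces.\<close>

lemma proof_graph_red_par: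
  assumes pg: "proof_graph (P, add_mset (Cut (Par A B) (Tens B' A')) \<Gamma>)"
  shows "proof_graph (P, add_mset (Cut A A') (add_mset (Cut B B') \<Gamma>))"
proof -
  let ?c = "Cut (Par A B) (Tens B' A')"
  have base: "is_linking P" "\<forall>c\<in>#add_mset ?c \<Gamma>. item_ok c" "dnames P"
    "mset (leaves P) = seq_leaves (add_mset ?c \<Gamma>)" "par_count P (add_mset ?c \<Gamma>)"
    using pg by (simp_all add: proof_graph_iff)
  have "dnames (itree ?c)" using wf_names_item(1)[OF base(3,4), of ?c] by simp
  then have disj: "names B \<inter> (names B' \<union> names A') = {}" unfolding itree.simps dnames_simps by auto
  have "bconn P (add_mset (Cut A A') (add_mset (Cut B B') \<Gamma>))"
    unfolding bconn_def
  proof (intro ballI allI impI)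
    fix M N assume M: "M \<in> full P" and "swm (add_mset (Cut A A') (add_mset (Cut B B') \<Gamma>)) N"
    then obtain N1 N2 N0 where N: "N1 \<in> full (Tens A A')" "N2 \<in> full (Tens B B')" "swm \<Gamma> N0" "N = N1 + (N2 + N0)"
      by (auto simp: swm_add_iff)
    from N(1) obtain Xa ma Xa' ma' where a: "(Xa, ma) \<in> swp A" "(Xa', ma') \<in> swp A'" "N1 = add_mset (Xa \<union> Xa') (ma + ma')"
      unfolding full_iff by (metis swp_TensE)
    from N(2) obtain Xb mb Xb' mb' where b: "(Xb, mb) \<in> swp B" "(Xb', mb') \<in> swp B'" "N2 = add_mset (Xb \<union> Xb') (mb + mb')"
      unfolding full_iff by (metis swp_TensE)
    \<comment> \<open>The blocks shared by the two old switchings and the new one.\<close>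
    define R where "R = ma + ma' + mb + mb' + N0 + M"
    let ?U = "Xb' \<union> Xa'"
    have e1: "M + (add_mset (Xa \<union> ?U) (add_mset Xb (ma + mb) + (mb' + ma')) + N0) = add_mset (Xa \<union> ?U) (add_mset Xb R)"
      and e2: "M + (add_mset (Xb \<union> ?U) (add_mset Xa (ma + mb) + (mb' + ma')) + N0) = add_mset (Xb \<union> ?U) (add_mset Xa R)"
      by (simp_all add: R_def ac_simps)
    have sw: "swm (add_mset ?c \<Gamma>) (add_mset (Xa \<union> ?U) (add_mset Xb (ma + mb) + (mb' + ma')) + N0)"
      "swm (add_mset ?c \<Gamma>) (add_mset (Xb \<union> ?U) (add_mset Xa (ma + mb) + (mb' + ma')) + N0)"
      using fullI[OF swp_TensI[OF swp_ParI1[OF a(1) b(1)] swp_TensI[OF b(2) a(2)]]]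
        fullI[OF swp_TensI[OF swp_ParI2[OF a(1) b(1)] swp_TensI[OF b(2) a(2)]]] N(3)
      unfolding swm_add_iff itree.simps by blast+
    note T1 = proof_graph_tight[OF pg M sw(1), unfolded e1]
    note T2 = proof_graph_tight[OF pg M sw(2), unfolded e2]
    have ne: "Xa \<noteq> {}" "Xb \<noteq> {}" "Xb' \<noteq> {}" and sub: "Xb \<subseteq> names B" "Xb' \<subseteq> names B'" "Xa' \<subseteq> names A'" "Xa \<subseteq> names A"
      using swp_blocks[OF a(1)] swp_blocks[OF b(1)] swp_blocks[OF b(2)] swp_blocks[OF a(2)] by simp_all
    obtain xa xb xb' where x: "xa \<in> Xa" "xb \<in> Xb" "xb' \<in> Xb'" using ne by auto
    have inP: "names (itree ?c) \<subseteq> names P" using wf_names_item(2)[OF base(3,4), of ?c] by simp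
    \<comment> \<open>Splits the block of the switching that keeps \<open>B\<close>.\<close>
    have sep: "(xb, u) \<notin> (hrel (add_mset Xb (add_mset ?U (add_mset Xa R))))\<^sup>*" if "u \<in> ?U" for u
      using T2 x that sub disj by (intro split_block_not_conn[of "names P"]) auto
    have "(xb, xa) \<in> (hrel (add_mset Xa (add_mset ?U (add_mset Xb R))))\<^sup>* \<or>
      (xb, xb') \<in> (hrel (add_mset Xa (add_mset ?U (add_mset Xb R))))\<^sup>*"
      using x sub inP by (intro split_block_conn[OF T1(1)]) auto
    then have "(xb, xa) \<in> (hrel (add_mset ?U (add_mset Xa (add_mset Xb R))))\<^sup>*"
      using sep[of xb'] x by (simp add: add_mset_commute)
    \<comment> \<open>The set \<open>?U\<close> is not a block of the new graph; by
      \<open>sep\<close> the chain never meets it, so it can be omitted.\<close>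
    then have "(xb, xa) \<in> (hrel (add_mset Xa (add_mset Xb R)))\<^sup>*"
      by (rule hrel_avoid_block) (use sep in \<open>simp add: add_mset_commute\<close>)
    then have ba': "(xb, xa) \<in> (hrel (add_mset Xa (add_mset Xb R)))\<^sup>*" .
    have MN: "M + N = add_mset (Xa \<union> Xa') (add_mset (Xb \<union> Xb') R)"
      by (simp add: N a b R_def ac_simps)
    have ba: "(xb, xa) \<in> (hrel (M + N))\<^sup>*" using ba' by (rule hrel_mono) (auto simp: MN)
    have toa: "(u, xa) \<in> (hrel (M + N))\<^sup>*" if u: "u \<in> Xa \<union> ?U" for u
    proof -
      consider "u \<in> Xa \<union> Xa'" | "u \<in> Xb'" using u by blast
      then show ?thesis
      proof cases
        case 1
        then show ?thesis using x by (intro hrel_stepI[of "Xa \<union> Xa'"]) (auto simp: MN)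
      next
        case 2
        then have "(u, xb) \<in> (hrel (M + N))\<^sup>*" using x by (intro hrel_stepI[of "Xb \<union> Xb'"]) (auto simp: MN)
        then show ?thesis using ba by (rule rtrancl_trans)
      qed
    qed
    show "hconn (names P) (M + N)"
    proof (rule hconn_hom[OF T1(1)])
      fix C u v assume C: "C \<in># add_mset (Xa \<union> ?U) (add_mset Xb R)" "u \<in> C" "v \<in> C"
      then consider "C = Xa \<union> ?U" | "C = Xb" | "C \<in># R" by auto
      then show "(u, v) \<in> (hrel (M + N))\<^sup>*"
      proof cases
        case 1
        then show ?thesis using toa[of u] hrel_sym[OF toa[of v]] C by (simp add: rtrancl_trans)
      next
        case 2
        then show ?thesis using C by (intro hrel_stepI[of "Xb \<union> Xb'"]) (auto simp: MN)
      next
        case 3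
        then show ?thesis using C by (intro hrel_stepI[of C]) (auto simp: MN)
      qed
    qed auto
  qed
  then show ?thesis using base unfolding proof_graph_iff par_count_def by (auto simp: ac_simps)
qed

text \<open>Common core of the axiom and unit reductions. Two leaves, one par and one item
  disappear, so the count stays balanced. The last hypothesis lifts a switching of \<open>u\<close>
  to the redex: up to \<open>i\<close> and \<open>j\<close>, every block of the redex is a block of
  \<open>u\<close> or part of its root block. Mapping \<open>i\<close> and \<open>j\<close> into
  that root block carries connectedness over.\<close>

lemma proof_graph_contract:
  assumes pg: "proof_graph (P, add_mset (Cut (Leaf x i) (Leaf y j)) \<Gamma>)"
    and p: "p \<in> poss P" "\<not> is_leaf (sub P p)" and u: "is_linking u"
    and lv: "mset (leaves (sub P p)) = mset (leaves u) + {#(x, i), (y, j)#}"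
    and np: "npar (sub P p) = Suc (npar u)"
    and sw: "\<And>X cs. (X, cs) \<in> swp u \<Longrightarrow> \<exists>X' cs'. (X', cs') \<in> swp (sub P p) \<and> X' \<subseteq> X \<union> {i, j} \<and>
      (\<forall>B\<in>#cs'. B \<in># cs \<or> B \<subseteq> X \<union> {i, j})"
  shows "proof_graph (rep P p u, \<Gamma>)"
proof -
  let ?c = "Cut (Leaf x i) (Leaf y j)"
  let ?P = "rep P p u"
  have base: "is_linking P" "\<forall>c\<in>#add_mset ?c \<Gamma>. item_ok c" "dnames P"
    "mset (leaves P) = seq_leaves (add_mset ?c \<Gamma>)" "par_count P (add_mset ?c \<Gamma>)" "bconn P (add_mset ?c \<Gamma>)"
    using pg unfolding proof_graph_iff by blast+
  have lP: "mset (leaves P) = mset (leaves ?P) + {#(x, i), (y, j)#}"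
    using leaves_rep[OF p(1), of u] unfolding lv by (simp add: add_mset_commute)
  from seq_leaves_split[OF base(3) lP] have d: "dnames ?P" and nP: "names P = names ?P \<union> {i, j}" and ij: "i \<notin> names ?P" "j \<notin> names ?P"
    by (auto simp: names_def)
  have lG: "mset (leaves ?P) = seq_leaves \<Gamma>" using lP base(4) by (simp add: add_mset_commute)
  have nG: "snd ` set_mset (seq_leaves \<Gamma>) = names ?P" unfolding lG[symmetric] by (simp add: names_def)
  have len: "length (leaves P) = length (leaves ?P) + 2" using arg_cong[OF lP, of size] by simp
  have "npar P = Suc (npar ?P)" using npar_rep[OF p(1), of u] np by simp
  then have pc: "par_count ?P \<Gamma>" using base(5) len unfolding par_count_def by simp
  obtain C where C: "full (rep P p v) = {add_mset (X \<union> K) (M + D) | X M K D. (X, M) \<in> swp v \<and> (K, D) \<in> C}" for v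
    using full_context[OF p(1)] by blast
  have "bconn ?P \<Gamma>" unfolding bconn_def
  proof (intro ballI allI impI)
    fix M N assume M: "M \<in> full ?P" and N: "swm \<Gamma> N"
    from M obtain X cs K D where X: "(X, cs) \<in> swp u" "(K, D) \<in> C" and Meq: "M = add_mset (X \<union> K) (cs + D)"
      unfolding C by blast
    obtain X' cs' where X': "(X', cs') \<in> swp (sub P p)" "X' \<subseteq> X \<union> {i, j}" "\<forall>B\<in>#cs'. B \<in># cs \<or> B \<subseteq> X \<union> {i, j}"
      using sw[OF X(1)] by blast
    obtain z where z: "z \<in> X" using swp_blocks[OF X(1)] by auto
    \<comment> \<open>The cut leaves are folded onto a leaf of the root block of \<open>u\<close>,
      so the block of the cut collapses to a point.\<close>
    define f where "f v = (if v \<in> {i, j} then z else v)" for v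
    let ?T = "add_mset (X' \<union> K) (cs' + D) + (add_mset {i, j} {#} + N)"
    have "add_mset (X' \<union> K) (cs' + D) \<in> full (rep P p (sub P p))" unfolding C using X' X by blast
    then have "add_mset (X' \<union> K) (cs' + D) \<in> full P" using rep_sub[OF p(1)] by simp
    moreover have "swm (add_mset ?c \<Gamma>) (add_mset {i, j} {#} + N)"
      unfolding swm_add_iff by (intro exI[of _ "add_mset {i, j} {#}"] exI[of _ N]) (auto simp: N full_iff)
    ultimately have T: "hconn (names P) ?T" using base(6) unfolding bconn_def by blast
    have root: "(f v, f w) \<in> (hrel (M + N))\<^sup>*" if "v \<in> X \<union> K \<union> {i, j}" "w \<in> X \<union> K \<union> {i, j}" for v w
      using that z by (intro hrel_stepI[of "X \<union> K"]) (auto simp: Meq f_def)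
    have small: "f v = v" if "v \<in> names ?P" for v using that ij by (auto simp: f_def)
    have other: "(f v, f w) \<in> (hrel (M + N))\<^sup>*" if B: "B \<in># M + N" "v \<in> B" "w \<in> B" for B v w
    proof -
      have "B \<subseteq> names ?P" using B(1) full_blocks[OF M] swm_blocks[OF N] nG by auto
      then have "f v = v" "f w = w" using B small by auto
      then show ?thesis using hrel_stepI[OF B] by simp
    qed
    show "hconn (names ?P) (M + N)"
    proof (rule hconn_hom[OF T _ small])
      show "names ?P \<subseteq> names P" using nP by blast
      fix B v w assume B: "B \<in># ?T" "v \<in> B" "w \<in> B"
      then have "B \<subseteq> X \<union> K \<union> {i, j} \<or> B \<in># M + N" using X'(2,3) by (auto simp: Meq)
      then show "(f v, f w) \<in> (hrel (M + N))\<^sup>*"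
      proof
        assume "B \<subseteq> X \<union> K \<union> {i, j}"
        then show ?thesis using B by (intro root) auto
      next
        assume "B \<in># M + N"
        then show ?thesis using B by (intro other)
      qed
    qed
  qed
  moreover have "is_linking ?P" using is_linking_rep[OF base(1) p u] .
  ultimately show ?thesis using base(2) d lG pc unfolding proof_graph_iff by simp
qed

lemma proof_graph_red_ax:
  assumes "proof_graph (P, add_mset (Cut (Leaf x i) (Leaf (dlit x) j)) \<Gamma>)" "p \<in> poss P" "is_atomic x"
    "sub P p = Par (Tens (Leaf (dlit x) h) (Leaf x i)) (Tens (Leaf (dlit x) j) (Leaf x k))"
  shows "proof_graph (rep P p (Tens (Leaf (dlit x) h) (Leaf x k)), \<Gamma>)"
proof (rule proof_graph_contract[OF assms(1,2)])
  show "is_linking (Tens (Leaf (dlit x) h) (Leaf x k))"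
    using assms(3) by (cases x) (auto intro: is_linking.intros)
  fix X cs assume "(X, cs) \<in> swp (Tens (Leaf (dlit x) h) (Leaf x k))"
  then show "\<exists>X' cs'. (X', cs') \<in> swp (sub P p) \<and> X' \<subseteq> X \<union> {i, j} \<and>
      (\<forall>B\<in>#cs'. B \<in># cs \<or> B \<subseteq> X \<union> {i, j})"
    \<comment> \<open>The left axiom link is the root block, and the par cuts off the right
      one.\<close>
    by (intro exI[of _ "{h, i}"] exI[of _ "{#{j, k}#}"]) (auto simp: assms(4))
qed (auto simp: assms(4))

lemma proof_graph_red_unit:
  assumes "proof_graph (P, add_mset (Cut (Leaf Bot i) (Leaf One j)) \<Gamma>)" "p \<in> poss P"
    "sub P p = Par (Tens Q (Leaf Bot i)) (Leaf One j)"
  shows "proof_graph (rep P p Q, \<Gamma>)"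
proof (rule proof_graph_contract[OF assms(1,2)])
  show "is_linking Q" using pg_sub_linking[OF assms(1,2)] assms(3) by simp
  fix X cs assume X: "(X, cs) \<in> swp Q"
  have "(X \<union> {i}, add_mset {j} (cs + {#} + {#})) \<in> swp (Par (Tens Q (Leaf Bot i)) (Leaf One j))"
    by (intro swp_ParI1 swp_TensI X) auto
  then show "\<exists>X' cs'. (X', cs') \<in> swp (sub P p) \<and> X' \<subseteq> X \<union> {i, j} \<and>
      (\<forall>B\<in>#cs'. B \<in># cs \<or> B \<subseteq> X \<union> {i, j})"
    unfolding assms(3) by (intro exI conjI) (assumption, auto)
qed (auto simp: assms(3))

subsection \<open>Detached bottoms\<close>

lemma rep_leaf:
  assumes "r \<in> poss t" "sub t r = Leaf l i"
  shows "poss (rep t r (Leaf l k)) = poss t"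
    and "eidx (rep t r (Leaf l k)) \<sigma> = eidx t \<sigma>"
    and "q \<in> poss t \<Longrightarrow> q \<noteq> r \<Longrightarrow> nd c (rep t r (Leaf l k)) q = nd c t q"
proof -
  show "poss (rep t r (Leaf l k)) = poss t"
    using assms by (induction t r rule: sub.induct) (auto split: if_splits)
  show "eidx (rep t r (Leaf l k)) \<sigma> = eidx t \<sigma>"
    using assms
  proof (induction t arbitrary: r \<sigma>)
    case (Leaf l' i') then show ?case by (cases r) (auto simp: eidx_simps)
  next
    case (Tens A B) then show ?case by (cases r) (auto simp: eidx_simps split: if_splits)
  next
    case (Par A B) then show ?case by (cases r) (auto simp: eidx_simps split: if_splits)
  qed
  show "q \<in> poss t \<Longrightarrow> q \<noteq> r \<Longrightarrow> nd c (rep t r (Leaf l k)) q = nd c t q"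
    using assms
  proof (induction t arbitrary: r q c)
    case (Leaf l' i') then show ?case by (cases r) auto
  next
    case (Tens A B) then show ?case by (cases r; cases q) (auto split: if_splits)
  next
    case (Par A B) then show ?case by (cases r; cases q) (auto split: if_splits)
  qed
qed

lemma image_remove: "(\<And>z. z \<in> I \<Longrightarrow> z \<noteq> a \<Longrightarrow> g z \<noteq> e) \<Longrightarrow> g a = e \<Longrightarrow> g ` (I - {a}) = g ` I - {e}"
  by auto

text \<open>The sequent is not touched, so a leaf \<open>i\<close> of it stays behind without its
  edge to the linking. For fresh \<open>k\<close> the new edge is pendant.\<close>

lemma swedges_rename_leaf:
  assumes "dnames P" "r @ [b] \<in> poss P" "r \<in> ipos P" "sub P r = Tens A B" "sub P (r @ [b]) = Leaf l i"
  shows "swedges (rep P (r @ [b]) (Leaf l k)) xs s = insert {VLink r, VLeaf k} (swedges P xs s - {{VLink r, VLeaf i}})"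
proof -
  let ?P = "rep P (r @ [b]) (Leaf l k)" and ?e = "{VLink r, VLeaf i}"
  let ?g = "\<lambda>t (p, b). {nd VLink t p, nd VLink t (p @ [b])}"
  let ?I = "eidx P (\<lambda>q. s (VLink q))"
  let ?J = "\<Union>k<length xs. tedges (itree (xs ! k)) (nd (VSeq k) (itree (xs ! k))) s"
  have r: "nd VLink P r = VLink r" "nd VLink P (r @ [b]) = VLeaf i" "nd VLink ?P (r @ [b]) = VLeaf k"
    using assms sub_rep[OF assms(2)] by (auto simp: nd_def)
  have rI: "(r, b) \<in> ?I" using assms(3,4) by (auto simp: eidx_def ipos_def)
  have same: "?g ?P (p, b') = ?g P (p, b')" if "(p, b') \<in> ?I" "(p, b') \<noteq> (r, b)" for p b'
  proof -
    have "p \<in> ipos P" "p \<in> poss P" "p @ [b'] \<in> poss P" using eidx_poss[OF that(1)] by auto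
    moreover have "p \<noteq> r @ [b]" using \<open>p \<in> ipos P\<close> assms(5) by (auto simp: ipos_def)
    moreover have "p @ [b'] \<noteq> r @ [b]" using that(2) by auto
    ultimately show ?thesis using rep_leaf(3)[OF assms(2,5)] by simp
  qed
  have diff: "?g P (p, b') \<noteq> ?e" if "(p, b') \<in> ?I" "(p, b') \<noteq> (r, b)" for p b'
    using tedges_inj[OF assms(1), of VLink p r b' b] that eidx_poss[OF that(1)] assms(3) r
    by (auto simp: inj_def)
  have "r \<in> poss P" using assms(3) by (simp add: ipos_def)
  then have e: "?g P (r, b) = ?e" "?g ?P (r, b) = {VLink r, VLeaf k}"
    using r rep_leaf(3)[OF assms(2,5), of r] by auto
  have J: "?e \<notin> ?J" by (auto dest!: tedges_parent)
  have "swedges ?P xs s = ?g ?P ` ?I \<union> ?J"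
    unfolding swedges_def nd_link_nd nd_seq_nd tedges_image[of ?P] rep_leaf(2)[OF assms(2,5)] ..
  also have "?g ?P ` ?I = insert (?g ?P (r, b)) (?g ?P ` (?I - {(r, b)}))" using rI by blast
  also have "?g ?P ` (?I - {(r, b)}) = ?g P ` (?I - {(r, b)})"
    using same by (intro image_cong) auto
  also have "?g P ` (?I - {(r, b)}) = ?g P ` ?I - {?e}"
  proof (rule image_remove)
    show "?g P z \<noteq> ?e" if "z \<in> ?I" "z \<noteq> (r, b)" for z
      using diff[of "fst z" "snd z"] that by simp
  qed (rule e(1))
  finally have "swedges ?P xs s = insert {VLink r, VLeaf k} (?g P ` ?I - {?e}) \<union> ?J" using e by simp
  also have "\<dots> = insert {VLink r, VLeaf k} ((?g P ` ?I \<union> ?J) - {?e})" using J by blast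
  also have "?g P ` ?I \<union> ?J = swedges P xs s"
    unfolding swedges_def nd_link_nd nd_seq_nd tedges_image[of P] ..
  finally show ?thesis .
qed

text \<open>Renaming the occurrence of the bottom in the linking has the effect of deleting its edge. In this form the
  side condition is visibly independent of the order of the sequent and of the sides of the par.\<close>

definition detached :: "'a tm \<Rightarrow> 'a item multiset \<Rightarrow> bool list \<Rightarrow> 'a tm \<Rightarrow> 'a tm \<Rightarrow> nat \<Rightarrow> bool" where
  "detached P \<Gamma> p S Q i \<longleftrightarrow> (\<forall>k. k \<notin> names P \<longrightarrow>
     (\<forall>M\<in>full (rep P p (Par S (Tens Q (Leaf Bot k)))). \<forall>N. swm \<Gamma> N \<longrightarrow>
       (\<forall>v\<in>names S. (i, v) \<notin> (hrel (M + N))\<^sup>*)))"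

text \<open>Fold the pendant vertex \<open>b\<close> onto its neighbour \<open>a\<close>.\<close>

lemma path_drop_pendant:
  assumes "(u, v) \<in> (adj (insert {a, b} E))\<^sup>*" "\<forall>e\<in>E. b \<notin> e" "u \<noteq> b" "v \<noteq> b"
  shows "(u, v) \<in> (adj E)\<^sup>*"
proof -
  define f where "f x = (if x = b then a else x)" for x
  have "(f u, f v) \<in> (adj E)\<^sup>*"
    using assms(1)
  proof (induction rule: rtrancl_induct)
    case (step y z)
    have "f y = f z \<or> (f y, f z) \<in> adj E"
    proof (cases "{y, z} \<in> E")
      case True
      then show ?thesis using assms(2) by (auto simp: f_def adj_def)
    next
      case False
      then have "{y, z} = {a, b}" using step(2) by (auto simp: adj_def)
      then show ?thesis by (auto simp: f_def doubleton_eq_iff)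
    qed
    then show ?case using step.IH by (metis rtrancl.rtrancl_into_rtrancl)
  qed simp
  then show ?thesis using assms(3,4) by (simp add: f_def)
qed

text \<open>The flag \<open>a\<close> tells on which side of the par the bottom hangs. The renamed
  linking differs from the graph with the deleted edge by a pendant edge only, and a node of the
  other side can be exchanged for the leaf \<open>dleaf\<close> below it, which lies on the same
  side.\<close>

lemma side_detached_iff:
  assumes d: "dnames P" "mset (leaves P) = seq_leaves (mset xs)" and p: "p \<in> poss P"
    and par: "sub P p = Par A B" and sub: "sub P (p @ [a]) = Tens Q (Leaf Bot i)" and k: "k \<notin> names P"
  shows "(\<forall>s. \<forall>q\<in>poss (sub P (p @ [\<not> a])). (VLeaf i, nd_link P (p @ [\<not> a] @ q))
        \<notin> (adj (swedges P xs s - {{nd_link P (p @ [a]), VLeaf i}}))\<^sup>*) \<longleftrightarrow>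
    (\<forall>M\<in>full (rep P (p @ [a, True]) (Leaf Bot k)). \<forall>N. swm (mset xs) N \<longrightarrow>
       (\<forall>v\<in>names (sub P (p @ [\<not> a])). (i, v) \<notin> (hrel (M + N))\<^sup>*))" (is "?L \<longleftrightarrow> _")
proof -
  let ?r = "p @ [a]"
  let ?P = "rep P (p @ [a, True]) (Leaf Bot k)"
  have r: "?r \<in> poss P" "p @ [\<not> a] \<in> poss P" "sub P ?r = Tens Q (Leaf Bot i)"
    using p par sub by (cases a; simp add: poss_append_iff sub_append)+
  have r2: "?r @ [True] \<in> poss P" "sub P (?r @ [True]) = Leaf Bot i"
    using r p sub by (simp_all only: poss_append_iff[of ?r] sub_append[of ?r]) simp_all
  have Peq: "?P = rep P (?r @ [True]) (Leaf Bot k)" by simp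
  have rI: "?r \<in> ipos P" using r by (simp add: ipos_def)
  let ?e = "{VLink ?r, VLeaf i}"
  let ?E = "\<lambda>s. swedges P xs s - {?e}"
  have sw: "swedges ?P xs s = insert {VLink ?r, VLeaf k} (?E s)" for s
    unfolding Peq by (rule swedges_rename_leaf[OF d(1) r2(1) rI r(3) r2(2)])
  have ik: "i \<noteq> k" using k sub_leaf_names[OF r2] by (force simp: names_def)
  have fresh: "\<forall>e\<in>?E s. VLeaf k \<notin> e" for s
  proof
    fix e assume "e \<in> ?E s"
    then obtain u w where uw: "e = {u, w}" "u \<in> verts P xs" "w \<in> verts P xs"
      using swedges_verts[OF d(1), of xs e s] wf_names_item(1)[OF d] by auto
    have it: "names (itree (xs ! m)) \<subseteq> names P" if "m < length xs" for m
      using wf_names_item(2)[OF d, of "xs ! m"] that by simp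
    have "VLeaf k \<notin> verts P xs"
    proof
      assume "VLeaf k \<in> verts P xs"
      from gl_names[OF this it] have "gl P xs (\<lambda>_. False) (VLeaf k) \<in> names P" by blast
      then show False using k by simp
    qed
    then show "VLeaf k \<notin> e" using uw by auto
  qed
  have nd: "nd_link P ?r = VLink ?r" using r(3) by (simp add: nd_link_def)
  let ?S = "sub P (p @ [\<not> a])"
  have rS: "sub (rep u [a, True] w) [\<not> a] = sub u [\<not> a]" if "u = Par A B" for u w :: "'a tm"
    using that by (cases a) auto
  have SP: "sub ?P (p @ [\<not> a]) = ?S"
    using rep_append[OF p, of "[a, True]"] rS[OF par] p by (simp add: sub_append poss_rep sub_rep)
  have Sq: "p @ (\<not> a) # q \<in> poss P \<and> sub P (p @ (\<not> a) # q) = sub ?S q \<and> p @ (\<not> a) # q \<noteq> ?r @ [True]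
      \<and> sub ?P (p @ (\<not> a) # q) = sub ?S q" if q: "q \<in> poss ?S" for q
  proof -
    have "(p @ [\<not> a]) @ q \<in> poss P" using q r(2) unfolding poss_append_iff[of "p @ [\<not> a]"] by blast
    moreover have "sub P ((p @ [\<not> a]) @ q) = sub ?S q" using r(2) by (rule sub_append)
    moreover have "p @ [\<not> a] \<in> poss ?P" using rep_leaf(1)[OF r2] r(2) by simp
    then have "sub ?P ((p @ [\<not> a]) @ q) = sub ?S q" using sub_append[of "p @ [\<not> a]" ?P q] SP by simp
    ultimately show ?thesis by simp
  qed
  show ?thesis
  proof
    assume bd: ?L
    show "\<forall>M\<in>full ?P. \<forall>N. swm (mset xs) N \<longrightarrow> (\<forall>v\<in>names ?S. (i, v) \<notin> (hrel (M + N))\<^sup>*)"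
    proof (intro ballI allI impI notI)
      fix M N v assume h: "M \<in> full ?P" "swm (mset xs) N" "v \<in> names ?S" "(i, v) \<in> (hrel (M + N))\<^sup>*"
      then obtain s where s: "M + N = tblk ?P xs s" using tblk_range[of "M + N" ?P xs] by blast
      obtain l where "(l, v) \<in> set (leaves ?S)" using h(3) by (auto simp: names_def)
      then obtain q where q: "q \<in> poss ?S" "sub ?S q = Leaf l v" using leaf_position by blast
      then have ndv: "nd_link P (p @ [\<not> a] @ q) = VLeaf v" using Sq[OF q(1)] by (simp add: nd_link_def)
      have "v \<in> names P" using sub_leaf_names[of "p @ (\<not> a) # q" P l v] Sq[OF q(1)] q(2) by (force simp: names_def)
      then have "v \<noteq> k" using k by auto
      have "(VLeaf i, VLeaf v) \<in> (adj (insert {VLink ?r, VLeaf k} (?E s)))\<^sup>*"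
        using path_of_blocks h(4) unfolding s sw[symmetric] by blast
      then have "(VLeaf i, VLeaf v) \<in> (adj (?E s))\<^sup>*"
        using ik \<open>v \<noteq> k\<close> by (intro path_drop_pendant[OF _ fresh]) auto
      then show False using bd q(1) ndv unfolding nd by metis
    qed
  next
    assume h: "\<forall>M\<in>full ?P. \<forall>N. swm (mset xs) N \<longrightarrow> (\<forall>v\<in>names ?S. (i, v) \<notin> (hrel (M + N))\<^sup>*)"
    show ?L unfolding nd
    proof (intro allI ballI notI)
      fix s q assume q: "q \<in> poss (sub P (p @ [\<not> a]))"
        and path: "(VLeaf i, nd_link P (p @ [\<not> a] @ q)) \<in> (adj (?E s))\<^sup>*"
      have "nd_link P (p @ [\<not> a] @ q) = nd VLink ?P (p @ (\<not> a) # q)"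
        unfolding Peq nd_link_nd using Sq[OF q] rep_leaf(3)[OF r2] by simp
      moreover have "(VLeaf i, nd_link P (p @ [\<not> a] @ q)) \<in> (adj (swedges ?P xs s))\<^sup>*"
        unfolding sw by (rule adj_mono[OF _ path]) auto
      ultimately have "(i, dleaf (sub ?P (p @ (\<not> a) # q)) (\<lambda>q'. s (VLink ((p @ (\<not> a) # q) @ q')))) \<in> (hrel (tblk ?P xs s))\<^sup>*"
        using path_gl[of "VLeaf i" _ ?P xs s] by fastforce
      moreover have "dleaf (sub ?P (p @ (\<not> a) # q)) (\<lambda>q'. s (VLink ((p @ (\<not> a) # q) @ q'))) \<in> names ?S"
        using dleaf_names[of "sub ?S q"] names_sub[OF q] Sq[OF q] by fastforce
      moreover obtain M N where "M \<in> full ?P" "swm (mset xs) N" "tblk ?P xs s = M + N"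
        using tblk_range[of "tblk ?P xs s" ?P xs] by blast
      ultimately show False using h by metis
    qed
  qed
qed

text \<open>For \<open>a = True\<close> the left side is \<open>bot_detached\<close>. The mirrored
  form allows the condition to be checked before the par is commuted.\<close>

lemma detached_iff:
  assumes "proof_graph (P, \<Gamma>)" "p \<in> poss P" "mset xs = \<Gamma>"
    and "sub P p = (if a then Par S (Tens Q (Leaf Bot i)) else Par (Tens Q (Leaf Bot i)) S)"
  shows "(\<forall>s. \<forall>q\<in>poss S. (VLeaf i, nd_link P (p @ [\<not> a] @ q))
        \<notin> (adj (swedges P xs s - {{nd_link P (p @ [a]), VLeaf i}}))\<^sup>*) \<longleftrightarrow> detached P \<Gamma> p S Q i"
proof -
  have d: "dnames P" "mset (leaves P) = seq_leaves (mset xs)" using assms(1,3) by (simp_all add: proof_graph_iff)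
  obtain A B where par: "sub P p = Par A B" using assms(4) by (cases a) auto
  have S: "sub P (p @ [\<not> a]) = S" "sub P (p @ [a]) = Tens Q (Leaf Bot i)"
    using assms(4) sub_append[OF assms(2)] by (cases a; simp)+
  have full: "full (rep P (p @ [a, True]) (Leaf Bot k)) = full (rep P p (Par S (Tens Q (Leaf Bot k))))" for k
  proof (cases a)
    case True
    then show ?thesis using rep_append[OF assms(2), of "[a, True]"] assms(4) by simp
  next
    case False
    then have "rep P (p @ [a, True]) (Leaf Bot k) = rep P p (Par (Tens Q (Leaf Bot k)) S)"
      using rep_append[OF assms(2), of "[a, True]"] assms(4) by simp
    then show ?thesis using swp_rep_cong[OF swp_Par_comm[of "Tens Q (Leaf Bot k)" S], of P p] by (simp add: full_def)
  qed
  obtain k where k: "k \<notin> names P" using ex_new_if_finite[OF infinite_UNIV_nat finite_names] by blast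
  show ?thesis
  proof
    assume L: "\<forall>s. \<forall>q\<in>poss S. (VLeaf i, nd_link P (p @ [\<not> a] @ q))
        \<notin> (adj (swedges P xs s - {{nd_link P (p @ [a]), VLeaf i}}))\<^sup>*"
    show "detached P \<Gamma> p S Q i"
      unfolding detached_def
    proof (intro allI impI)
      fix k assume "k \<notin> names P"
      from side_detached_iff[OF d assms(2) par S(2) this, unfolded S(1) full assms(3)] L
      show "\<forall>M\<in>full (rep P p (Par S (Tens Q (Leaf Bot k)))). \<forall>N. swm \<Gamma> N \<longrightarrow>
        (\<forall>v\<in>names S. (i, v) \<notin> (hrel (M + N))\<^sup>*)" by argo
    qed
  next
    assume "detached P \<Gamma> p S Q i"
    then have "\<forall>M\<in>full (rep P p (Par S (Tens Q (Leaf Bot k)))). \<forall>N. swm \<Gamma> N \<longrightarrow>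
        (\<forall>v\<in>names S. (i, v) \<notin> (hrel (M + N))\<^sup>*)" using k unfolding detached_def by simp
    with side_detached_iff[OF d assms(2) par S(2) k, unfolded S(1) full assms(3)]
    show "\<forall>s. \<forall>q\<in>poss S. (VLeaf i, nd_link P (p @ [\<not> a] @ q))
        \<notin> (adj (swedges P xs s - {{nd_link P (p @ [a]), VLeaf i}}))\<^sup>*" by argo
  qed
qed

text \<open>If the par keeps \<open>Q\<close>, the blocks before and after agree. If it keeps
  \<open>S\<close>, the bottom passes from the root block of \<open>Q\<close> to that of
  \<open>S\<close>. Taking it away splits the old block in two; detachment says that
  \<open>S\<close> hangs together with the part of \<open>Q\<close>, not with \<open>i\<close>, so
  joining \<open>i\<close> to \<open>S\<close> reconnects everything.\<close>

lemma proof_graph_bot_par: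
  assumes pg: "proof_graph (P, \<Gamma>)" and p: "p \<in> poss P" and sub: "sub P p = Par S (Tens Q (Leaf Bot i))"
    and det: "detached P \<Gamma> p S Q i"
  shows "proof_graph (rep P p (Tens (Par S Q) (Leaf Bot i)), \<Gamma>)"
proof (rule proof_graph_rep[OF pg p])
  let ?P = "rep P p (Tens (Par S Q) (Leaf Bot i))"
  show "\<not> is_leaf (sub P p)" "is_linking (Tens (Par S Q) (Leaf Bot i))"
    "mset (leaves (Tens (Par S Q) (Leaf Bot i))) = mset (leaves (sub P p))"
    "npar (Tens (Par S Q) (Leaf Bot i)) = npar (sub P p)"
    using pg_sub_linking[OF pg p] sub by simp_all
  have nm: "names ?P = names P"
    using sub by (intro same_leaves leaves_rep_eq[OF p]) simp
  obtain k where k: "k \<notin> names P" using ex_new_if_finite[OF infinite_UNIV_nat finite_names] by blast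
  obtain C where C: "full (rep P p v) = {add_mset (X \<union> K) (M + D) | X M K D. (X, M) \<in> swp v \<and> (K, D) \<in> C}" for v
    using full_context[OF p] by blast
  show "bconn ?P \<Gamma>" unfolding bconn_def nm
  proof (intro ballI allI impI)
    fix M N assume M: "M \<in> full ?P" and N: "swm \<Gamma> N"
    from M obtain X cs K D where X: "(X, cs) \<in> swp (Tens (Par S Q) (Leaf Bot i))" "(K, D) \<in> C"
      and Meq: "M = add_mset (X \<union> K) (cs + D)"
      unfolding C by blast
    from X(1) obtain Y where Y: "(Y, cs) \<in> swp (Par S Q)" "X = Y \<union> {i}" by (auto elim!: swp_TensE simp del: swp.simps(2,3))
    have old: "hconn (names P) (add_mset (X0 \<union> K) (cs0 + D) + N)"
      if "(X0, cs0) \<in> swp (Par S (Tens Q (Leaf Bot i)))" for X0 cs0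
    proof -
      have "add_mset (X0 \<union> K) (cs0 + D) \<in> full (rep P p (sub P p))"
        unfolding C sub using that X(2) by blast
      then have "add_mset (X0 \<union> K) (cs0 + D) \<in> full P" using rep_sub[OF p] by simp
      then show ?thesis using pg N unfolding proof_graph_iff bconn_def by blast
    qed
    have bot: "({i}, {#}) \<in> swp (Leaf Bot i)" "({k}, {#}) \<in> swp (Leaf Bot k)" for i k by simp_all
    from Y(1) show "hconn (names P) (M + N)"
    proof (cases rule: swp_ParE)
      case 1: (1 XS cS XQ cQ)
      define R where "R = cS + cQ + D + N"
      obtain vs vq where v: "vs \<in> XS" "vq \<in> XQ" using swp_blocks[OF 1(1)] swp_blocks[OF 1(2)] by auto
      have inP: "names S \<subseteq> names P" "names Q \<subseteq> names P" "i \<in> names P" using names_sub[OF p] sub by auto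
      have vP: "vs \<in> names S" "vs \<in> names P" "vq \<in> names P"
        using v inP swp_blocks[OF 1(1)] swp_blocks[OF 1(2)] by auto
      have "hconn (names P) (add_mset (XS \<union> K) (add_mset (XQ \<union> {i}) (cS + (cQ + {#})) + D) + N)"
        by (intro old swp_ParI1 swp_TensI 1 bot)
      moreover have "add_mset (XS \<union> K) (add_mset (XQ \<union> {i}) (cS + (cQ + {#})) + D) + N = add_mset (XQ \<union> {i}) (add_mset (XS \<union> K) R)"
        by (simp add: R_def ac_simps add_mset_commute)
      ultimately have h1: "hconn (names P) (add_mset (XQ \<union> {i}) (add_mset (XS \<union> K) R))" by metis
      \<comment> \<open>The old graph with the edge of the bottom deleted: \<open>k\<close> takes
        the place of \<open>i\<close> in the block of \<open>Q\<close>.\<close>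
      let ?T = "add_mset (XS \<union> K) (add_mset (XQ \<union> {k}) (cS + (cQ + {#})) + D) + N"
      have "(XS, add_mset (XQ \<union> {k}) (cS + (cQ + {#}))) \<in> swp (Par S (Tens Q (Leaf Bot k)))"
        by (intro swp_ParI1 swp_TensI 1 bot)
      then have "add_mset (XS \<union> K) (add_mset (XQ \<union> {k}) (cS + (cQ + {#})) + D) \<in> full (rep P p (Par S (Tens Q (Leaf Bot k))))"
        unfolding C using X(2) by blast
      then have "(i, vs) \<notin> (hrel ?T)\<^sup>*"
        using det N k vP(1) unfolding detached_def by blast
      \<comment> \<open>The same situation in the form produced by splitting, with \<open>i\<close>
        as a block of its own.\<close>
      moreover let ?Z = "add_mset XQ (add_mset {i} (add_mset (XS \<union> K) R))"
      have "(i, vs) \<in> (hrel ?T)\<^sup>*"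
        if "(i, vs) \<in> (hrel ?Z)\<^sup>*"
      proof (rule hrel_hom[OF that, of "\<lambda>x. x"])
        fix B u w assume B: "B \<in># ?Z" "u \<in> B" "w \<in> B"
        show "(u, w) \<in> (hrel ?T)\<^sup>*"
        proof (cases "B = {i}")
          case False
          then have "\<exists>C\<in>#?T. B \<subseteq> C"
            using B(1) by (auto simp: R_def)
          then obtain C where C: "C \<in># ?T" "B \<subseteq> C" ..
          show ?thesis by (rule hrel_stepI[OF C(1)]) (use B C in auto)
        qed (use B in simp)
      qed
      ultimately have "(i, vs) \<notin> (hrel ?Z)\<^sup>*" by argo
      then have sep: "(vs, i) \<notin> (hrel ?Z)\<^sup>*" using hrel_sym[of vs i ?Z] by argo
      have spl: "(w, vq) \<in> (hrel ?Z)\<^sup>* \<or> (w, i) \<in> (hrel ?Z)\<^sup>*" if "w \<in> names P" for w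
        using v vP that by (intro split_block_conn[OF h1]) auto
      have MN: "M + N = add_mset (XS \<union> {i} \<union> K) (add_mset XQ R)"
        using 1 Y Meq by (simp add: R_def ac_simps add_mset_commute)
      have up: "(a, b) \<in> (hrel (M + N))\<^sup>*" if "(a, b) \<in> (hrel ?Z)\<^sup>*" for a b
        by (rule hrel_mono[OF that]) (auto simp: MN)
      have "(vs, vq) \<in> (hrel ?Z)\<^sup>*" using spl[OF vP(2)] sep by argo
      then have sq: "(vs, vq) \<in> (hrel (M + N))\<^sup>*" by (rule up)
      have "(i, vs) \<in> (hrel (M + N))\<^sup>*" using v by (intro hrel_stepI[of "XS \<union> {i} \<union> K"]) (auto simp: MN)
      then have iq: "(i, vq) \<in> (hrel (M + N))\<^sup>*" using sq by (rule rtrancl_trans)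
      show ?thesis
      proof (rule hconnI_star)
        fix w assume "w \<in> names P"
        from spl[OF this] show "(w, vq) \<in> (hrel (M + N))\<^sup>*"
        proof
          assume "(w, i) \<in> (hrel ?Z)\<^sup>*"
          from rtrancl_trans[OF up[OF this] iq] show ?thesis .
        qed (rule up)
      qed
    next
      case 2: (2 XS cS XQ cQ)
      have "hconn (names P) (add_mset ((XQ \<union> {i}) \<union> K) (add_mset XS (cS + (cQ + {#})) + D) + N)"
        by (intro old swp_ParI2 swp_TensI 2 bot)
      then show ?thesis using 2 Y Meq by simp
    qed
  qed
qed

text \<open>A cut between two leaves separated by a tensor of the linking would close a cycle.\<close>

lemma no_cut_across_tens:
  assumes pg: "proof_graph (P, add_mset (Cut (Leaf x i) (Leaf y j)) \<Gamma>)" and p: "p \<in> poss P" "sub P p = Tens A B"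
    and ij: "i \<in> names A \<and> j \<in> names B \<or> j \<in> names A \<and> i \<in> names B"
  shows False
proof -
  let ?c = "Cut (Leaf x i) (Leaf y j)"
  have "\<exists>X cs. (X, cs) \<in> swp (Tens A B) \<and> i \<in> X \<and> j \<in> X"
    using ij swp_root_choice[of _ A] swp_root_choice[of _ B] by (meson UnI1 UnI2 swp_TensI)
  then obtain X cs where X: "(X, cs) \<in> swp (Tens A B)" "i \<in> X" "j \<in> X" by blast
  obtain C where C: "full (rep P p v) = {add_mset (X \<union> K) (M + D) | X M K D. (X, M) \<in> swp v \<and> (K, D) \<in> C}" for v
    using full_context[OF p(1)] by blast
  have "full P \<noteq> {}" using blk_in_swp[of P] by (auto simp: full_def)
  then have "full (rep P p (sub P p)) \<noteq> {}" using rep_sub[OF p(1)] by simp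
  then obtain K D where KD: "(K, D) \<in> C" unfolding C by blast
  let ?M = "add_mset (X \<union> K) (cs + D)"
  have "?M \<in> full (rep P p (sub P p))" unfolding C p(2) using X KD by blast
  then have M: "?M \<in> full P" using rep_sub[OF p(1)] by simp
  obtain ys where "mset ys = \<Gamma>" by (meson ex_mset)
  then obtain N where N: "swm \<Gamma> N" using swm_list[of ys] by blast
  have sw: "swm (add_mset ?c \<Gamma>) (add_mset ({i} \<union> {j}) {#} + N)"
    unfolding swm_add_iff by (intro exI[of _ "add_mset ({i} \<union> {j}) {#}"] exI[of _ N]) (auto simp: N full_iff)
  have e: "?M + (add_mset ({i} \<union> {j}) {#} + N) = add_mset ({i} \<union> {j}) (?M + N)" by simp
  note T = proof_graph_tight[OF pg M sw, unfolded e]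
  have d: "dnames P" "mset (leaves P) = seq_leaves (add_mset ?c \<Gamma>)" using pg unfolding proof_graph_iff by blast+
  have "dnames (itree ?c)" using wf_names_item(1)[OF d, of ?c] by simp
  then have "i \<noteq> j" by simp
  then have "(i, j) \<notin> (hrel (add_mset {i} (add_mset {j} (?M + N))))\<^sup>*"
    by (intro split_block_not_conn[OF _ T]) auto
  moreover have "(i, j) \<in> (hrel (add_mset {i} (add_mset {j} (?M + N))))\<^sup>*"
    using X by (intro hrel_stepI[of "X \<union> K"]) auto
  ultimately show False by contradiction
qed

subsection \<open>Empires\<close>

text \<open>Up to its first use of the new edge, a path stays in \<open>H\<close>.\<close>

lemma adj_insert_path:
  assumes "(x, y) \<in> (adj (insert {v, w} H))\<^sup>*"
  shows "(x, y) \<in> (adj H)\<^sup>* \<or> (x, v) \<in> (adj H)\<^sup>* \<or> (x, w) \<in> (adj H)\<^sup>*"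
  using assms
proof (induction rule: rtrancl_induct)
  case (step y z)
  show ?case
  proof (cases "{y, z} \<in> H")
    case True
    then have "(y, z) \<in> adj H" by (simp add: adj_def)
    then show ?thesis using step.IH rtrancl_into_rtrancl[of x y "adj H" z] by blast
  next
    case False
    then have "{y, z} = {v, w}" using step(2) by (simp add: adj_def)
    then have "y = v \<or> y = w" by (auto simp: doubleton_eq_iff)
    then show ?thesis using step.IH by blast
  qed
qed simp

lemma adj_remove_path:
  assumes "(T, x) \<in> (adj E)\<^sup>*"
  shows "(T, x) \<in> (adj (E - {{T, b}}))\<^sup>* \<or> (b, x) \<in> (adj (E - {{T, b}}))\<^sup>*"
  using assms
proof (induction rule: rtrancl_induct)
  case (step y z)
  show ?case
  proof (cases "{y, z} = {T, b}")
    case True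
    then have "z = T \<or> z = b" by (auto simp: doubleton_eq_iff)
    then show ?thesis by blast
  next
    case False
    then have "(y, z) \<in> adj (E - {{T, b}})" using step(2) by (simp add: adj_def)
    then show ?thesis using step.IH rtrancl_into_rtrancl[of _ y "adj (E - {{T, b}})" z] by blast
  qed
qed simp

text \<open>Every par \<open>v\<close> keeps exactly one of the edges to its premises \<open>c v False\<close> and \<open>c v True\<close>; the edges in
  \<open>F\<close> are always present.\<close>

locale switched_graph =
  fixes V :: "'v set" and F :: "'v set set" and Pr :: "'v set" and c :: "'v \<Rightarrow> bool \<Rightarrow> 'v"
  assumes connected: "uconnected V (F \<union> {{v, c v (s v)} | v. v \<in> Pr})"
    and acyclic: "uacyclic (F \<union> {{v, c v (s v)} | v. v \<in> Pr})"
    and premise: "v \<in> Pr \<Longrightarrow> c v d \<in> V"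
begin

definition G :: "('v \<Rightarrow> bool) \<Rightarrow> 'v set set" where
  "G s = F \<union> {{v, c v (s v)} | v. v \<in> Pr}"

text \<open>The edge to be deleted. It is always present and does not touch a par, so no edge to a
  premise of a par coincides with it.\<close>

definition good_edge :: "'v \<Rightarrow> 'v \<Rightarrow> bool" where
  "good_edge T b \<longleftrightarrow> {T, b} \<in> F \<and> T \<noteq> b \<and> T \<notin> Pr \<and> b \<notin> Pr \<and> T \<in> V"

definition empire :: "'v \<Rightarrow> 'v \<Rightarrow> 'v set" where
  "empire T b = {v. \<forall>s. (T, v) \<in> (adj (G s - {{T, b}}))\<^sup>*}"

lemma bridge: "good_edge T b \<Longrightarrow> (T, b) \<notin> (adj (G s - {{T, b}}))\<^sup>*"
  using uacyclic_bridge[OF acyclic, of T b s] unfolding G_def good_edge_def by blast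

lemma empire_refl: "T \<in> empire T b"
  by (simp add: empire_def)

lemma empire_edge:
  assumes "{u, w} \<in> F" "{u, w} \<noteq> {T, b}" "u \<in> empire T b"
  shows "w \<in> empire T b"
  unfolding empire_def
proof (intro CollectI allI)
  fix s
  have "(u, w) \<in> adj (G s - {{T, b}})" using assms(1,2) by (simp add: adj_def G_def)
  moreover have "(T, u) \<in> (adj (G s - {{T, b}}))\<^sup>*" using assms(3) by (simp add: empire_def)
  ultimately show "(T, w) \<in> (adj (G s - {{T, b}}))\<^sup>*" by (rule rtrancl_into_rtrancl[rotated])
qed

lemma par_edge:
  assumes "good_edge T b" "v \<in> Pr"
  shows "(v, c v (s v)) \<in> (adj (G s - {{T, b}}))\<^sup>*"
proof (rule adjI)
  have "{v, c v (s v)} \<noteq> {T, b}" using assms by (auto simp: good_edge_def doubleton_eq_iff)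
  moreover have "{v, c v (s v)} \<in> G s" unfolding G_def using assms(2) by blast
  ultimately show "{v, c v (s v)} \<in> G s - {{T, b}}" by simp
qed

lemma empire_par:
  assumes "good_edge T b" "v \<in> Pr" "c v False \<in> empire T b" "c v True \<in> empire T b"
  shows "v \<in> empire T b"
  unfolding empire_def
proof (intro CollectI allI)
  fix s
  have "c v (s v) \<in> empire T b" using assms(3,4) by (cases "s v") auto
  then have "(T, c v (s v)) \<in> (adj (G s - {{T, b}}))\<^sup>*" by (simp add: empire_def)
  from rtrancl_trans[OF this adj_sym[OF par_edge[OF assms(1,2)]]]
  show "(T, v) \<in> (adj (G s - {{T, b}}))\<^sup>*" .
qed

text \<open>A par is connected to \<open>T\<close> in all switchings only from above. If the premise
  \<open>d\<close> were cut off from \<open>T\<close> in some switching, it would be joined to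
  \<open>b\<close>; then \<open>T\<close> and \<open>b\<close> would be connected around
  \<open>v\<close>, possibly after switching \<open>v\<close> to \<open>d\<close>, although
  \<open>{T, b}\<close> is a bridge.\<close>

lemma empire_premise:
  assumes e: "good_edge T b" and v: "v \<in> Pr" "v \<in> empire T b"
  shows "c v d \<in> empire T b"
  unfolding empire_def
proof (intro CollectI allI, rule ccontr)
  fix s assume n: "(T, c v d) \<notin> (adj (G s - {{T, b}}))\<^sup>*"
  have Tv: "(T, v) \<in> (adj (G s' - {{T, b}}))\<^sup>*" for s' using v(2) by (simp add: empire_def)
  have sv: "s v \<noteq> d"
  proof
    assume "s v = d"
    then show False using rtrancl_trans[OF Tv par_edge[OF e v(1)], of s] n by simp
  qed
  define s' where "s' = s(v := d)"
  define H where "H = (F \<union> {{u, c u (s u)} | u. u \<in> Pr \<and> u \<noteq> v}) - {{T, b}}"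
  have ne: "{v, c v x} \<noteq> {T, b}" for x using e v(1) by (auto simp: good_edge_def doubleton_eq_iff)
  have Gs: "G s - {{T, b}} = insert {v, c v (s v)} H"
    unfolding G_def H_def using v(1) ne[of "s v"] by blast
  have Gs': "G s' - {{T, b}} = insert {v, c v d} H"
  proof -
    have "{{u, c u (s' u)} | u. u \<in> Pr} = insert {v, c v d} {{u, c u (s u)} | u. u \<in> Pr \<and> u \<noteq> v}"
      using v(1) by (auto simp: s'_def)
    then have "G s' = insert {v, c v d} (F \<union> {{u, c u (s u)} | u. u \<in> Pr \<and> u \<noteq> v})" by (simp add: G_def)
    then show ?thesis unfolding H_def using ne[of d] by (simp add: insert_Diff_if)
  qed
  have up: "(x, y) \<in> (adj (G s - {{T, b}}))\<^sup>*" if "(x, y) \<in> (adj H)\<^sup>*" for x y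
    using that unfolding Gs by (rule adj_mono[rotated]) blast
  have up': "(x, y) \<in> (adj (G s' - {{T, b}}))\<^sup>*" if "(x, y) \<in> (adj H)\<^sup>*" for x y
    using that unfolding Gs' by (rule adj_mono[rotated]) blast
  \<comment> \<open>With \<open>v\<close> switched to \<open>d\<close>, a path from \<open>T\<close>
    to \<open>v\<close> cannot come through that premise, so some path uses neither premise edge of
    \<open>v\<close>.\<close>
  have TvH: "(T, v) \<in> (adj H)\<^sup>*"
    using adj_insert_path[OF Tv[of s', unfolded Gs']] up[of T "c v d"] n by argo
  have "(T, c v d) \<in> (adj (G s))\<^sup>*"
    using connected[of s] premise[OF v(1), of d] e unfolding uconnected_def G_def good_edge_def by simp
  then have "(b, c v d) \<in> (adj (G s - {{T, b}}))\<^sup>*" using adj_remove_path[of T "c v d" "G s" b] n by argo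
  from adj_insert_path[OF this[unfolded Gs]] consider
    "(b, c v d) \<in> (adj H)\<^sup>*" | "(b, v) \<in> (adj H)\<^sup>*" | "(b, c v (s v)) \<in> (adj H)\<^sup>*" by blast
  then show False
  proof cases
    case 1
    have "(v, c v d) \<in> (adj (G s' - {{T, b}}))\<^sup>*" using par_edge[OF e v(1), of s'] by (simp add: s'_def)
    from rtrancl_trans[OF rtrancl_trans[OF Tv this] adj_sym[OF up'[OF 1]]] show False
      using bridge[OF e, of s'] by argo
  next
    case 2
    from rtrancl_trans[OF up[OF TvH] adj_sym[OF up[OF 2]]] show False using bridge[OF e, of s] by argo
  next
    case 3
    from rtrancl_trans[OF rtrancl_trans[OF Tv par_edge[OF e v(1)]] adj_sym[OF up[OF 3]]] show False
      using bridge[OF e, of s] by argo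
  qed
qed

text \<open>If neither of two overlapping empires contains the root of the other, then a switching that leaves the
  first empire inside the second one, and the second one elsewhere, separates \<open>T2\<close> from the overlap.\<close>

lemma empire_nesting:
  assumes e: "good_edge T1 b1" "good_edge T2 b2" and x: "x \<in> empire T1 b1" "x \<in> empire T2 b2"
  shows "T2 \<in> empire T1 b1 \<or> T1 \<in> empire T2 b2"
proof (rule ccontr)
  let ?E1 = "empire T1 b1" and ?E2 = "empire T2 b2"
  assume "\<not> (T2 \<in> ?E1 \<or> T1 \<in> ?E2)"
  then have n: "T2 \<notin> ?E1" "T1 \<notin> ?E2" by auto
  define \<tau> where "\<tau> v = (SOME d. c v d \<notin> (if v \<in> ?E2 then ?E1 else ?E2))" for v
  have tau1: "c v (\<tau> v) \<notin> ?E1" if "v \<in> Pr" "v \<in> ?E2" "v \<notin> ?E1" for v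
  proof -
    have "\<exists>d. c v d \<notin> ?E1" using empire_par[OF e(1) that(1)] that(3) by blast
    from someI_ex[OF this] show ?thesis using that(2) by (simp add: \<tau>_def)
  qed
  have tau2: "c v (\<tau> v) \<notin> ?E2" if "v \<in> Pr" "v \<notin> ?E2" for v
  proof -
    have "\<exists>d. c v d \<notin> ?E2" using empire_par[OF e(2) that(1)] that(2) by blast
    from someI_ex[OF this] show ?thesis using that(2) by (simp add: \<tau>_def)
  qed
  have "(T2, x) \<in> (adj (G \<tau> - {{T2, b2}}))\<^sup>*" using x(2) by (simp add: empire_def)
  then have "x \<in> ?E2 \<and> x \<notin> ?E1"
  proof (induction rule: rtrancl_induct)
    case base
    show ?case using n(1) empire_refl by blast
  next
    case (step y z)
    then have yz: "{y, z} \<in> G \<tau>" "{y, z} \<noteq> {T2, b2}" by (auto simp: adj_def)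
    show ?case
    proof (cases "{y, z} \<in> F")
      case True
      have z2: "z \<in> ?E2" using empire_edge[OF True yz(2)] step.IH by blast
      have "{y, z} \<noteq> {T1, b1}" using n(2) z2 step.IH by (auto simp: doubleton_eq_iff)
      then have "z \<notin> ?E1" using empire_edge[of z y T1 b1] True step.IH by (auto simp: insert_commute)
      then show ?thesis using z2 by blast
    next
      case False
      then obtain v where v: "v \<in> Pr" "{y, z} = {v, c v (\<tau> v)}" using yz(1) unfolding G_def by blast
      then consider "y = v" "z = c v (\<tau> v)" | "z = v" "y = c v (\<tau> v)" by (auto simp: doubleton_eq_iff)
      then show ?thesis
      proof cases
        case 1
        then show ?thesis using empire_premise[OF e(2) v(1)] tau1[OF v(1)] step.IH by blast
      next
        case 2
        then show ?thesis using tau2[OF v(1)] empire_premise[OF e(1) v(1)] step.IH by blast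
      qed
    qed
  qed
  then show False using x(1) by blast
qed

text \<open>The link to the side condition for bottoms: the deleted edge is a bridge, and the empire
  lies on the side of \<open>T\<close>.\<close>

lemma empire_separated:
  assumes "good_edge T b" "v \<in> empire T b"
  shows "(b, v) \<notin> (adj (G s - {{T, b}}))\<^sup>*"
proof
  assume "(b, v) \<in> (adj (G s - {{T, b}}))\<^sup>*"
  then have "(v, b) \<in> (adj (G s - {{T, b}}))\<^sup>*" by (rule adj_sym)
  moreover have "(T, v) \<in> (adj (G s - {{T, b}}))\<^sup>*" using assms(2) by (simp add: empire_def)
  ultimately have "(T, b) \<in> (adj (G s - {{T, b}}))\<^sup>*" by (rule rtrancl_trans[rotated])
  then show False using bridge[OF assms(1), of s] by argo
qed

end

section \<open>Empires in proof graphs\<close>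

fun chd :: "'a tm \<Rightarrow> 'a item list \<Rightarrow> vtx \<Rightarrow> bool \<Rightarrow> vtx" where
  "chd P xs (VLeaf i) d = VLeaf i"
| "chd P xs (VLink p) d = nd VLink P (p @ [d])"
| "chd P xs (VSeq k p) d = nd (VSeq k) (itree (xs ! k)) (p @ [d])"

text \<open>With \<open>par_verts\<close> and \<open>chd\<close>, the data of
  \<open>switched_graph\<close> for a proof graph; the edges of cuts are among these.\<close>

definition tens_edges :: "'a tm \<Rightarrow> 'a item list \<Rightarrow> vtx set set" where
  "tens_edges P xs = {{VLink p, nd VLink P (p @ [d])} | p d. p \<in> poss P \<and> (\<exists>A B. sub P p = Tens A B)} \<union>
     {{VSeq k p, nd (VSeq k) (itree (xs ! k)) (p @ [d])} | k p d.
       k < length xs \<and> p \<in> poss (itree (xs ! k)) \<and> (\<exists>A B. sub (itree (xs ! k)) p = Tens A B)}"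

definition par_verts :: "'a tm \<Rightarrow> 'a item list \<Rightarrow> vtx set" where
  "par_verts P xs = {VLink p | p. p \<in> poss P \<and> (\<exists>A B. sub P p = Par A B)} \<union>
     {VSeq k p | k p. k < length xs \<and> p \<in> poss (itree (xs ! k)) \<and> (\<exists>A B. sub (itree (xs ! k)) p = Par A B)}"

lemma tens_edges_linkI: "p \<in> poss P \<Longrightarrow> sub P p = Tens A B \<Longrightarrow> {VLink p, nd VLink P (p @ [d])} \<in> tens_edges P xs"
  unfolding tens_edges_def by blast

lemma tens_edges_seqI:
  "k < length xs \<Longrightarrow> p \<in> poss (itree (xs ! k)) \<Longrightarrow> sub (itree (xs ! k)) p = Tens A B \<Longrightarrow>
    {VSeq k p, nd (VSeq k) (itree (xs ! k)) (p @ [d])} \<in> tens_edges P xs"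
  unfolding tens_edges_def by blast

lemma par_verts_linkI: "p \<in> poss P \<Longrightarrow> sub P p = Par A B \<Longrightarrow> VLink p \<in> par_verts P xs"
  unfolding par_verts_def by blast

lemma tedges_decomp:
  "tedges t (nd c t) s = {{c p, nd c t (p @ [d])} | p d. p \<in> poss t \<and> (\<exists>A B. sub t p = Tens A B)} \<union>
     {{c p, nd c t (p @ [s (c p)])} | p. p \<in> poss t \<and> (\<exists>A B. sub t p = Par A B)}" (is "_ = ?T \<union> ?P")
proof (intro equalityI subsetI)
  fix e assume "e \<in> tedges t (nd c t) s"
  then obtain p b where p: "e = {nd c t p, nd c t (p @ [b])}" "p \<in> poss t" "\<not> is_leaf (sub t p)"
    "case sub t p of Leaf l i \<Rightarrow> False | Tens A B \<Rightarrow> True | Par A B \<Rightarrow> s (c p) = b" by (rule tedgesE)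
  then have e: "e = {c p, nd c t (p @ [b])}" by (simp add: nd_ipos ipos_def)
  show "e \<in> ?T \<union> ?P" using p(2,4) e by (cases "sub t p") auto
next
  fix e assume "e \<in> ?T \<union> ?P"
  then obtain p d where e: "e = {c p, nd c t (p @ [d])}" and p: "p \<in> poss t" "\<not> is_leaf (sub t p)" "(p, d) \<in> eidx t (\<lambda>q. s (c q))"
    unfolding eidx_def by auto
  then have "e = {nd c t p, nd c t (p @ [d])}" by (simp add: nd_ipos ipos_def)
  then show "e \<in> tedges t (nd c t) s" unfolding tedges_image using p(3) by (auto intro!: rev_image_eqI)
qed

lemma swedges_decomp:
  "swedges P xs s = tens_edges P xs \<union> {{v, chd P xs v (s v)} | v. v \<in> par_verts P xs}"
proof -
  have "{{v, chd P xs v (s v)} | v. v \<in> par_verts P xs} =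
    {{VLink p, nd VLink P (p @ [s (VLink p)])} | p. p \<in> poss P \<and> (\<exists>A B. sub P p = Par A B)} \<union>
    (\<Union>k<length xs. {{VSeq k p, nd (VSeq k) (itree (xs ! k)) (p @ [s (VSeq k p)])} | p.
       p \<in> poss (itree (xs ! k)) \<and> (\<exists>A B. sub (itree (xs ! k)) p = Par A B)})"
    unfolding par_verts_def by (auto 0 4)
  moreover have "tens_edges P xs = {{VLink p, nd VLink P (p @ [d])} | p d. p \<in> poss P \<and> (\<exists>A B. sub P p = Tens A B)} \<union>
    (\<Union>k<length xs. {{VSeq k p, nd (VSeq k) (itree (xs ! k)) (p @ [d])} | p d.
       p \<in> poss (itree (xs ! k)) \<and> (\<exists>A B. sub (itree (xs ! k)) p = Tens A B)})"
    unfolding tens_edges_def by blast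
  ultimately show ?thesis
    unfolding swedges_def nd_link_nd nd_seq_nd tedges_decomp by (simp only: UN_Un_distrib Un_assoc Un_left_commute)
qed

text \<open>Empires live on the concrete graph, whose vertices refer to an order \<open>xs\<close>
  of the items.\<close>

locale pgraph =
  fixes P :: "'a tm" and xs :: "'a item list"
  assumes pg: "proof_graph (P, mset xs)"
begin

lemma wf: "dnames P" "mset (leaves P) = seq_leaves (mset xs)"
  using pg by (simp_all add: proof_graph_iff)

sublocale switched_graph "verts P xs" "tens_edges P xs" "par_verts P xs" "chd P xs"
proof
  have "switch_ok P xs" using pg unfolding proof_graph_def by simp
  then show "uconnected (verts P xs) (tens_edges P xs \<union> {{v, chd P xs v (s v)} | v. v \<in> par_verts P xs})"
    "uacyclic (tens_edges P xs \<union> {{v, chd P xs v (s v)} | v. v \<in> par_verts P xs})" for s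
    unfolding switch_ok_def swedges_decomp by blast+
  fix v d assume "v \<in> par_verts P xs"
  then consider p A B where "v = VLink p" "p \<in> poss P" "sub P p = Par A B"
    | k p A B where "v = VSeq k p" "k < length xs" "p \<in> poss (itree (xs ! k))" "sub (itree (xs ! k)) p = Par A B"
    unfolding par_verts_def by blast
  then show "chd P xs v d \<in> verts P xs"
  proof cases
    case 1
    then have "p @ [d] \<in> poss P" by (intro poss_snoc) auto
    then show ?thesis using 1 unfolding verts_def nd_link_nd by simp
  next
    case 2
    then have "p @ [d] \<in> poss (itree (xs ! k))" by (intro poss_snoc) auto
    then show ?thesis using 2 unfolding verts_def nd_seq_nd by auto
  qed
qed

lemma G_swedges: "G s = swedges P xs s"
  unfolding G_def swedges_decomp ..

lemma link_inj: "p \<in> poss P \<Longrightarrow> q \<in> poss P \<Longrightarrow> nd VLink P p = nd VLink P q \<Longrightarrow> p = q"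
  using inj_onD[OF nd_inj[OF wf(1), of VLink]] by (simp add: inj_def)

lemma bot_good:
  assumes r: "r \<in> poss P" "sub P r = Tens Q (Leaf Bot m)"
  shows "good_edge (VLink r) (VLeaf m)"
proof -
  have r2: "r @ [True] \<in> poss P" "sub P (r @ [True]) = Leaf Bot m" using r by (auto simp: poss_append_iff sub_append)
  then have "nd VLink P (r @ [True]) = VLeaf m" by (simp add: nd_def)
  then have "{VLink r, VLeaf m} \<in> tens_edges P xs" using tens_edges_linkI[OF r, of True xs] by simp
  moreover have "VLink r \<in> verts P xs" unfolding verts_def nd_link_nd using r by (force simp: nd_def)
  moreover have "VLink r \<notin> par_verts P xs" "VLeaf m \<notin> par_verts P xs" unfolding par_verts_def using r(2) by auto
  ultimately show ?thesis unfolding good_edge_def by simp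
qed

text \<open>Within the linking, tensors hand membership in an empire down by their fixed edges and
  pars by \<open>empire_premise\<close>. The node \<open>r\<close> has to be avoided, as one of its
  edges is deleted.\<close>

lemma empire_down:
  assumes e: "good_edge (VLink r) (VLeaf m)" and r0: "r0 \<in> poss P" "nd VLink P r0 \<in> empire (VLink r) (VLeaf m)"
    and ne: "\<And>q. r0 @ q \<noteq> r" and q: "q \<in> poss (sub P r0)"
  shows "nd VLink P (r0 @ q) \<in> empire (VLink r) (VLeaf m)"
  using q
proof (induction q rule: rev_induct)
  case Nil
  then show ?case using r0 by simp
next
  case (snoc d q)
  have q: "q \<in> poss (sub P r0)" "[d] \<in> poss (sub (sub P r0) q)"
    using snoc.prems unfolding poss_append_iff by auto
  have p: "r0 @ q \<in> poss P" "[d] \<in> poss (sub P (r0 @ q))" using q r0 by (auto simp: poss_append_iff sub_append)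
  have IH: "nd VLink P (r0 @ q) \<in> empire (VLink r) (VLeaf m)" using snoc.IH q by blast
  have ne1: "nd VLink P ((r0 @ q) @ [d]) \<noteq> VLink r" using ne[of "q @ [d]"] by (auto simp: nd_def split: tm.splits)
  show ?case
  proof (cases "sub P (r0 @ q)")
    case (Leaf l i)
    then show ?thesis using p(2) by simp
  next
    case (Tens A B)
    then have "{VLink (r0 @ q), nd VLink P ((r0 @ q) @ [d])} \<in> tens_edges P xs" using p by (intro tens_edges_linkI)
    moreover have "{VLink (r0 @ q), nd VLink P ((r0 @ q) @ [d])} \<noteq> {VLink r, VLeaf m}"
      using ne[of q] ne1 by (auto simp: doubleton_eq_iff)
    moreover have "VLink (r0 @ q) \<in> empire (VLink r) (VLeaf m)" using IH Tens by (simp add: nd_def)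
    ultimately show ?thesis using empire_edge by simp
  next
    case (Par A B)
    then have "VLink (r0 @ q) \<in> par_verts P xs" using p by (intro par_verts_linkI)
    moreover have "VLink (r0 @ q) \<in> empire (VLink r) (VLeaf m)" using IH Par by (simp add: nd_def)
    ultimately show ?thesis using empire_premise[OF e, of "VLink (r0 @ q)" d] by simp
  qed
qed

lemma empire_body:
  assumes r: "r \<in> poss P" "sub P r = Tens Q (Leaf Bot m)" and i: "i \<in> names Q"
  shows "VLeaf i \<in> empire (VLink r) (VLeaf m)"
proof -
  obtain l where "(l, i) \<in> set (leaves Q)" using i by (auto simp: names_def)
  then obtain q where q: "q \<in> poss Q" "sub Q q = Leaf l i" using leaf_position by blast
  have r2: "r @ [False] \<in> poss P" "sub P (r @ [False]) = Q" "r @ [True] \<in> poss P" "sub P (r @ [True]) = Leaf Bot m"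
    using r by (auto simp: poss_append_iff sub_append)
  have "{VLink r, nd VLink P (r @ [False])} \<in> tens_edges P xs" using r by (intro tens_edges_linkI)
  moreover have "nd VLink P (r @ [False]) \<noteq> VLeaf m"
    using link_inj[OF r2(1,3)] r2(4) by (auto simp: nd_def)
  then have "{VLink r, nd VLink P (r @ [False])} \<noteq> {VLink r, VLeaf m}" by (auto simp: doubleton_eq_iff)
  ultimately have "nd VLink P (r @ [False]) \<in> empire (VLink r) (VLeaf m)"
    using empire_edge empire_refl by blast
  then have "nd VLink P ((r @ [False]) @ q) \<in> empire (VLink r) (VLeaf m)"
    using q r2 by (intro empire_down[OF bot_good[OF r] r2(1)]) auto
  moreover have "sub P ((r @ [False]) @ q) = Leaf l i" using sub_append[OF r2(1), of q] r2(2) q(2) by simp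
  then have "nd VLink P ((r @ [False]) @ q) = VLeaf i" by (simp add: nd_def)
  ultimately show ?thesis by simp
qed

text \<open>A cut node behaves as a tensor, so its leaves enter an empire together; the deleted edge
  has an inner node of the linking as one end and cannot be an edge of the cut.\<close>

lemma empire_cut:
  assumes c: "Cut (Leaf x i) (Leaf y j) \<in> set xs" and i: "VLeaf i \<in> empire (VLink r) b \<or> VLeaf j \<in> empire (VLink r) b"
  shows "VLeaf i \<in> empire (VLink r) b \<and> VLeaf j \<in> empire (VLink r) b"
proof -
  obtain k where k: "k < length xs" "xs ! k = Cut (Leaf x i) (Leaf y j)" using c by (auto simp: in_set_conv_nth)
  have "{VSeq k [], nd (VSeq k) (itree (xs ! k)) ([] @ [d])} \<in> tens_edges P xs" for d
    using k by (intro tens_edges_seqI) auto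
  from this[of False] this[of True] have e: "{VSeq k [], VLeaf i} \<in> tens_edges P xs" "{VSeq k [], VLeaf j} \<in> tens_edges P xs"
    using k by simp_all
  have ne: "{VSeq k [], VLeaf u} \<noteq> {VLink r, b}" for u by (auto simp: doubleton_eq_iff)
  have "VSeq k [] \<in> empire (VLink r) b"
    using i empire_edge[of "VLeaf i" "VSeq k []" "VLink r" b] empire_edge[of "VLeaf j" "VSeq k []" "VLink r" b] e ne
    by (auto simp: insert_commute)
  then show ?thesis using empire_edge[OF e(1) ne] empire_edge[OF e(2) ne] by blast
qed

lemma side_separated:
  assumes p: "p \<in> poss P" "sub P p = Par A B" and sub: "sub P (p @ [a]) = Tens Q (Leaf Bot m)"
    and root: "nd VLink P (p @ [\<not> a]) \<in> empire (VLink (p @ [a])) (VLeaf m)"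
    and q: "q \<in> poss (sub P (p @ [\<not> a]))"
  shows "(VLeaf m, nd_link P (p @ [\<not> a] @ q)) \<notin> (adj (swedges P xs s - {{nd_link P (p @ [a]), VLeaf m}}))\<^sup>*"
proof -
  have r: "p @ [a] \<in> poss P" "p @ [\<not> a] \<in> poss P" using poss_snoc[OF p(1)] p(2) by simp_all
  have nd: "nd_link P (p @ [a]) = VLink (p @ [a])" using sub by (simp add: nd_link_def)
  note e = bot_good[OF r(1) sub]
  have "nd VLink P ((p @ [\<not> a]) @ q) \<in> empire (VLink (p @ [a])) (VLeaf m)"
    using q by (intro empire_down[OF e r(2) root]) auto
  from empire_separated[OF e this, of s] show ?thesis unfolding nd G_swedges by (simp add: nd_link_nd)
qed

end

text \<open>The place from which a leaf can be reduced against its partner: \<open>One\<close> has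
  to be a whole side of the par, any other literal a premise of the tensor that forms this
  side.\<close>

definition anchored :: "'a lit \<Rightarrow> nat \<Rightarrow> 'a tm \<Rightarrow> bool" where
  "anchored x i t \<longleftrightarrow> (if x = One then t = Leaf x i else (\<exists>A B. t = Tens A B \<and> (A = Leaf x i \<or> B = Leaf x i)))"

definition joined :: "'a item multiset \<Rightarrow> nat \<Rightarrow> nat \<Rightarrow> bool" where
  "joined \<Gamma> i j \<longleftrightarrow> (\<exists>x y. Cut (Leaf x i) (Leaf y j) \<in># \<Gamma> \<or> Cut (Leaf y j) (Leaf x i) \<in># \<Gamma>)"

lemma joined_sym: "joined \<Gamma> i j \<longleftrightarrow> joined \<Gamma> j i"
  unfolding joined_def by blast

text \<open>The empire of the left tensor contains \<open>i\<close>, hence its cut partner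
  \<open>j\<close>, hence the root of \<open>S\<close>, which is \<open>j\<close> or the tensor
  directly attached to it.\<close>

lemma detached_anchored:
  assumes "proof_graph (P, \<Gamma>)" "p \<in> poss P" "joined \<Gamma> i j"
    and sub: "sub P p = Par (Tens Q (Leaf Bot m)) S" and i: "i \<in> names Q" and S: "anchored y j S"
  shows "detached P \<Gamma> p S Q m"
proof -
  obtain xs where xs: "mset xs = \<Gamma>" by (meson ex_mset)
  interpret pgraph P xs by unfold_locales (use assms xs in simp)
  let ?r = "p @ [False]"
  have s: "sub P (p @ [False]) = Tens Q (Leaf Bot m)" "sub P (p @ [True]) = S" "?r \<in> poss P" "p @ [True] \<in> poss P"
    using sub assms(2) by (auto simp: sub_append poss_append_iff)
  let ?E = "empire (VLink ?r) (VLeaf m)"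
  have "VLeaf j \<in> ?E"
    using assms(3) empire_cut empire_body[OF s(3,1) i] unfolding joined_def xs[symmetric] set_mset_mset by blast
  moreover have "nd VLink P (p @ [True]) \<in> ?E" if y: "y \<noteq> One"
  proof -
    obtain A B where AB: "S = Tens A B" "A = Leaf y j \<or> B = Leaf y j" using S y by (auto simp: anchored_def)
    then obtain d where "sub P ((p @ [True]) @ [d]) = Leaf y j"
    proof -
      have "sub P ((p @ [True]) @ [d]) = (if d then B else A)" for d
        using sub_append[OF s(4), of "[d]"] s(2) AB(1) by simp
      then show thesis using AB(2) that[of False] that[of True] by auto
    qed
    then have "nd VLink P ((p @ [True]) @ [d]) = VLeaf j" by (simp add: nd_def)
    moreover have "{VLink (p @ [True]), nd VLink P ((p @ [True]) @ [d])} \<in> tens_edges P xs"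
      using s AB by (intro tens_edges_linkI) auto
    ultimately have "{VLeaf j, VLink (p @ [True])} \<in> tens_edges P xs" by (simp add: insert_commute)
    moreover have "{VLeaf j, VLink (p @ [True])} \<noteq> {VLink ?r, VLeaf m}" by (auto simp: doubleton_eq_iff)
    ultimately have "VLink (p @ [True]) \<in> ?E" using \<open>VLeaf j \<in> ?E\<close> by (rule empire_edge)
    then show ?thesis using s AB by (simp add: nd_def)
  qed
  moreover have "nd VLink P (p @ [True]) = VLeaf j" if "y = One" using S s that by (simp add: anchored_def nd_def)
  ultimately have root: "nd VLink P (p @ [\<not> False]) \<in> ?E" by (cases "y = One") auto
  have "\<forall>s. \<forall>q\<in>poss S. (VLeaf m, nd_link P (p @ [\<not> False] @ q)) \<notin> (adj (swedges P xs s - {{nd_link P (p @ [False]), VLeaf m}}))\<^sup>*"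
    using side_separated[OF assms(2) sub s(1) root] s(2) by simp
  then show ?thesis using detached_iff[OF assms(1,2) xs, of False S Q m] sub by simp
qed

text \<open>The leaf \<open>j\<close> lies in both empires: in the first through the cut, in the
  second as a leaf of \<open>R\<close>. By nesting, one empire contains the root of the other
  side.\<close>

lemma detached_either:
  assumes "proof_graph (P, \<Gamma>)" "p \<in> poss P" "joined \<Gamma> i j"
    and sub: "sub P p = Par (Tens Q (Leaf Bot m)) (Tens R (Leaf Bot n))" and i: "i \<in> names Q" and j: "j \<in> names R"
  shows "detached P \<Gamma> p (Tens R (Leaf Bot n)) Q m \<or> detached P \<Gamma> p (Tens Q (Leaf Bot m)) R n"
proof -
  obtain xs where xs: "mset xs = \<Gamma>" by (meson ex_mset)
  interpret pgraph P xs by unfold_locales (use assms xs in simp)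
  have s: "sub P (p @ [False]) = Tens Q (Leaf Bot m)" "sub P (p @ [True]) = Tens R (Leaf Bot n)"
    "p @ [False] \<in> poss P" "p @ [True] \<in> poss P"
    using sub assms(2) by (auto simp: sub_append poss_append_iff)
  let ?E = "empire (VLink (p @ [False])) (VLeaf m)" and ?F = "empire (VLink (p @ [True])) (VLeaf n)"
  have "VLeaf j \<in> ?E"
    using assms(3) empire_cut empire_body[OF s(3,1) i] unfolding joined_def xs[symmetric] set_mset_mset by blast
  moreover have "VLeaf j \<in> ?F" using empire_body[OF s(4,2) j] .
  ultimately have "VLink (p @ [True]) \<in> ?E \<or> VLink (p @ [False]) \<in> ?F"
    using empire_nesting[OF bot_good[OF s(3,1)] bot_good[OF s(4,2)]] by blast
  then show ?thesis
  proof
    assume "VLink (p @ [True]) \<in> ?E"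
    then have root: "nd VLink P (p @ [\<not> False]) \<in> ?E" using s by (simp add: nd_def)
    have "\<forall>s. \<forall>q\<in>poss (Tens R (Leaf Bot n)). (VLeaf m, nd_link P (p @ [\<not> False] @ q)) \<notin> (adj (swedges P xs s - {{nd_link P (p @ [False]), VLeaf m}}))\<^sup>*"
      using side_separated[OF assms(2) sub s(1) root] s(2) by simp
    then show ?thesis using detached_iff[OF assms(1,2) xs, of False "Tens R (Leaf Bot n)" Q m] sub by simp
  next
    assume "VLink (p @ [False]) \<in> ?F"
    then have root: "nd VLink P (p @ [\<not> True]) \<in> ?F" using s by (simp add: nd_def)
    have "\<forall>s. \<forall>q\<in>poss (Tens Q (Leaf Bot m)). (VLeaf n, nd_link P (p @ [\<not> True] @ q)) \<notin> (adj (swedges P xs s - {{nd_link P (p @ [True]), VLeaf n}}))\<^sup>*"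
      using side_separated[OF assms(2) sub s(2) root] s(1) by simp
    then show ?thesis using detached_iff[OF assms(1,2) xs, of True "Tens Q (Leaf Bot m)" R n] sub by simp
  qed
qed

subsection \<open>Bringing cut leaves together\<close>

lemma pg_sim_trans: "pg_sim G H \<Longrightarrow> pg_sim H K \<Longrightarrow> pg_sim G K"
  unfolding pg_sim_def by simp

lemma pg_sim_refl: "pg_sim G G"
  unfolding pg_sim_def by simp

lemma pg_sim_step: "sim_step G H \<or> sim_step H G \<Longrightarrow> proof_graph G \<Longrightarrow> proof_graph H \<Longrightarrow> pg_sim G H"
  unfolding pg_sim_def by (rule r_into_rtranclp) simp

lemma pg_sim_proof_graph: "pg_sim G H \<Longrightarrow> proof_graph G \<Longrightarrow> proof_graph H"
  unfolding pg_sim_def by (induction rule: rtranclp_induct) auto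

lemma sim_par_comm:
  assumes "p \<in> poss P" "proof_graph (rep P p (Par A B), \<Gamma>)"
  shows "pg_sim (rep P p (Par A B), \<Gamma>) (rep P p (Par B A), \<Gamma>)"
  using sim_step.par_comm[OF poss_rep[OF assms(1)] sub_rep[OF assms(1)]] assms
    proof_graph_par_comm[OF assms(2) poss_rep[OF assms(1)] sub_rep[OF assms(1)]]
  by (intro pg_sim_step) (simp_all add: rep_rep)

lemma sim_tens_comm:
  assumes "p \<in> poss P" "proof_graph (rep P p (Tens A B), \<Gamma>)"
  shows "pg_sim (rep P p (Tens A B), \<Gamma>) (rep P p (Tens B A), \<Gamma>)"
  using sim_step.tens_comm[OF poss_rep[OF assms(1)] sub_rep[OF assms(1)]] assms
    proof_graph_tens_comm[OF assms(2) poss_rep[OF assms(1)] sub_rep[OF assms(1)]]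
  by (intro pg_sim_step) (simp_all add: rep_rep)

lemma sim_par_assoc:
  assumes "p \<in> poss P" "proof_graph (rep P p (Par (Par A B) C), \<Gamma>)"
  shows "pg_sim (rep P p (Par (Par A B) C), \<Gamma>) (rep P p (Par A (Par B C)), \<Gamma>)"
  using sim_step.par_assoc[OF poss_rep[OF assms(1)] sub_rep[OF assms(1)], of A B C] assms
    proof_graph_par_assoc[OF assms(2) poss_rep[OF assms(1)] sub_rep[OF assms(1)]]
  by (intro pg_sim_step) (simp_all add: rep_rep)

lemma sim_bot_par:
  assumes "p \<in> poss P" "proof_graph (rep P p (Par S (Tens Q (Leaf Bot m))), \<Gamma>)"
    "detached (rep P p (Par S (Tens Q (Leaf Bot m)))) \<Gamma> p S Q m"
  shows "pg_sim (rep P p (Par S (Tens Q (Leaf Bot m))), \<Gamma>) (rep P p (Tens (Par S Q) (Leaf Bot m)), \<Gamma>)"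
proof -
  let ?P = "rep P p (Par S (Tens Q (Leaf Bot m)))"
  note p = poss_rep[OF assms(1), of "Par S (Tens Q (Leaf Bot m))"]
    and s = sub_rep[OF assms(1), of "Par S (Tens Q (Leaf Bot m))"]
  have "\<forall>xs. mset xs = \<Gamma> \<longrightarrow> bot_detached ?P xs p m"
    using detached_iff[OF assms(2) p, of _ True S Q m] s assms(3) unfolding bot_detached_def
    by (simp add: sub_append[OF p])
  from sim_step.bot_par[OF p s this] proof_graph_bot_par[OF assms(2) p s assms(3)] assms(2)
  show ?thesis by (intro pg_sim_step) (simp_all add: rep_rep[OF assms(1)])
qed

lemma detached_rep:
  assumes "p \<in> poss P" "mset (leaves u) = mset (leaves v)"
  shows "detached (rep P p u) \<Gamma> p S Q m \<longleftrightarrow> detached (rep P p v) \<Gamma> p S Q m"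
proof -
  have "mset (leaves (rep P p u)) + mset (leaves (sub P p)) = mset (leaves (rep P p v)) + mset (leaves (sub P p))"
    using leaves_rep[OF assms(1), of u] leaves_rep[OF assms(1), of v] assms(2) by simp
  then have "names (rep P p u) = names (rep P p v)" by (intro same_leaves) simp
  then show ?thesis unfolding detached_def rep_rep[OF assms(1)] by simp
qed

lemma rep_into: "p \<in> poss P \<Longrightarrow> rep (rep P p u) (p @ q) v = rep P p (rep u q v)"
  using rep_append[OF poss_rep, of p P u q v] by (simp add: sub_rep rep_rep)

lemma poss_into: "p \<in> poss P \<Longrightarrow> q \<in> poss u \<Longrightarrow> p @ q \<in> poss (rep P p u)"
  by (simp add: poss_append_iff poss_rep sub_rep)

text \<open>The surroundings change with each move, so tree and position are existential. What
  counts is that the left side loses leaves but keeps \<open>z\<close>, while the right side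
  stays.\<close>

definition shrinks :: "'a item multiset \<Rightarrow> 'a tm \<Rightarrow> bool list \<Rightarrow> 'a tm \<Rightarrow> 'a tm \<Rightarrow> 'a lit \<times> nat \<Rightarrow> bool" where
  "shrinks \<Gamma> P p L S z \<longleftrightarrow> (\<exists>P' p' L'. p' \<in> poss P' \<and>
     pg_sim (rep P p (Par L S), \<Gamma>) (rep P' p' (Par L' S), \<Gamma>) \<and>
     length (leaves L') < length (leaves L) \<and> z \<in> set (leaves L'))"

lemma shrinksI:
  "p' \<in> poss P' \<Longrightarrow> pg_sim (rep P p (Par L S), \<Gamma>) (rep P' p' (Par L' S), \<Gamma>) \<Longrightarrow>
    length (leaves L') < length (leaves L) \<Longrightarrow> z \<in> set (leaves L') \<Longrightarrow> shrinks \<Gamma> P p L S z"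
  unfolding shrinks_def by blast

text \<open>Associativity pushes the part without \<open>z\<close> out of the left side; if
  \<open>z\<close> sits in the first premise of the inner par, that par is commuted first.\<close>

lemma shrinks_par:
  assumes p: "p \<in> poss P" and pg: "proof_graph (rep P p (Par (Par A B) S), \<Gamma>)" and z: "z \<in> set (leaves (Par A B))"
  shows "shrinks \<Gamma> P p (Par A B) S z"
proof -
  have right: "\<exists>P' p'. p' \<in> poss P' \<and> pg_sim (rep P p (Par (Par A B) S), \<Gamma>) (rep P' p' (Par B S), \<Gamma>)"
    if "proof_graph (rep P p (Par (Par A B) S), \<Gamma>)" for A B
  proof (intro exI conjI)
    show "p @ [True] \<in> poss (rep P p (Par A S))" using p by (intro poss_into) auto
    show "pg_sim (rep P p (Par (Par A B) S), \<Gamma>) (rep (rep P p (Par A S)) (p @ [True]) (Par B S), \<Gamma>)"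
      using sim_par_assoc[OF p that] p by (simp add: rep_into)
  qed
  show ?thesis
  proof (cases "z \<in> set (leaves B)")
    case True
    moreover obtain P' p' where "p' \<in> poss P'" "pg_sim (rep P p (Par (Par A B) S), \<Gamma>) (rep P' p' (Par B S), \<Gamma>)"
      using right[OF pg] by blast
    ultimately show ?thesis by (intro shrinksI) auto
  next
    case False
    then have zA: "z \<in> set (leaves A)" using z by simp
    have eq: "rep P p (Par (Par A' B') S) = rep (rep P p (Par A S)) (p @ [False]) (Par A' B')" for A' B'
      using p by (simp add: rep_into)
    have "p @ [False] \<in> poss (rep P p (Par A S))" using p by (intro poss_into) auto
    from sim_par_comm[OF this pg[unfolded eq]]
    have 1: "pg_sim (rep P p (Par (Par A B) S), \<Gamma>) (rep P p (Par (Par B A) S), \<Gamma>)" unfolding eq .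
    from right[OF pg_sim_proof_graph[OF 1 pg]] obtain P' p' where
      "p' \<in> poss P'" "pg_sim (rep P p (Par (Par B A) S), \<Gamma>) (rep P' p' (Par A S), \<Gamma>)" by blast
    then show ?thesis using pg_sim_trans[OF 1] zA by (intro shrinksI) auto
  qed
qed

text \<open>The bottom is lifted above the par. As the equivalence expects it on the right, the par
  is commuted before and after.\<close>

lemma shrinks_bot:
  assumes p: "p \<in> poss P" and pg: "proof_graph (rep P p (Par (Tens Q (Leaf Bot m)) S), \<Gamma>)"
    and det: "detached (rep P p (Par (Tens Q (Leaf Bot m)) S)) \<Gamma> p S Q m" and z: "z \<in> set (leaves Q)"
  shows "shrinks \<Gamma> P p (Tens Q (Leaf Bot m)) S z"
proof -
  have 1: "pg_sim (rep P p (Par (Tens Q (Leaf Bot m)) S), \<Gamma>) (rep P p (Par S (Tens Q (Leaf Bot m))), \<Gamma>)"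
    by (rule sim_par_comm[OF p pg])
  have "detached (rep P p (Par S (Tens Q (Leaf Bot m)))) \<Gamma> p S Q m"
    using det detached_rep[OF p, of "Par (Tens Q (Leaf Bot m)) S" "Par S (Tens Q (Leaf Bot m))"] by (simp add: ac_simps)
  from sim_bot_par[OF p pg_sim_proof_graph[OF 1 pg] this]
  have 2: "pg_sim (rep P p (Par S (Tens Q (Leaf Bot m))), \<Gamma>) (rep P p (Tens (Par S Q) (Leaf Bot m)), \<Gamma>)" .
  define B where "B = rep P p (Tens Q (Leaf Bot m))"
  have p': "p @ [False] \<in> poss B" unfolding B_def using p by (intro poss_into) auto
  have eq: "rep P p (Tens u (Leaf Bot m)) = rep B (p @ [False]) u" for u unfolding B_def using p by (simp add: rep_into)
  note 12 = pg_sim_trans[OF 1 2]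
  from sim_par_comm[OF p' pg_sim_proof_graph[OF 12 pg, unfolded eq]]
  have "pg_sim (rep P p (Tens (Par S Q) (Leaf Bot m)), \<Gamma>) (rep B (p @ [False]) (Par Q S), \<Gamma>)" unfolding eq .
  from shrinksI[OF p' pg_sim_trans[OF 12 this] _ z] show ?thesis by simp
qed

text \<open>An axiom link anchors both of its leaves, and every other tensor of a linking has a
  bottom as a premise.\<close>

lemma linking_shape:
  assumes "is_linking t" "(x, i) \<in> set (leaves t)"
  obtains "anchored x i t" | A B where "t = Par A B"
  | Q m where "t = Tens (Leaf Bot m) Q \<or> t = Tens Q (Leaf Bot m)" "(x, i) \<in> set (leaves Q)"
  using assms(1)
proof cases
  case (lk_botl L k)
  then show ?thesis using assms(2) that(1) that(3)[of k L] by (auto simp: anchored_def)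
next
  case (lk_botr L k)
  then show ?thesis using assms(2) that(1) that(3)[of k L] by (auto simp: anchored_def)
qed (use assms(2) that(1,2) in \<open>auto simp: anchored_def\<close>)

definition settled :: "'a lit \<Rightarrow> nat \<Rightarrow> 'a tm \<Rightarrow> bool" where
  "settled x i t \<longleftrightarrow> anchored x i t \<or> (\<exists>A B. t = Par A B) \<or> (\<exists>Q m. t = Tens Q (Leaf Bot m) \<and> (x, i) \<in> set (leaves Q))"

lemma settle:
  assumes "p \<in> poss P" "proof_graph (rep P p t, \<Gamma>)" "is_linking t" "(x, i) \<in> set (leaves t)"
  obtains t' where "pg_sim (rep P p t, \<Gamma>) (rep P p t', \<Gamma>)" "mset (leaves t') = mset (leaves t)" "settled x i t'"
  using assms(3,4)
proof (cases rule: linking_shape)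
  case 1
  then show ?thesis using that[of t] pg_sim_refl[of "(rep P p t, \<Gamma>)"] by (simp add: settled_def)
next
  case (2 A B)
  then show ?thesis using that[of t] pg_sim_refl[of "(rep P p t, \<Gamma>)"] by (simp add: settled_def)
next
  case (3 Q m)
  from 3(1) show ?thesis
  proof
    assume t: "t = Tens (Leaf Bot m) Q"
    have "pg_sim (rep P p t, \<Gamma>) (rep P p (Tens Q (Leaf Bot m)), \<Gamma>)"
      using sim_tens_comm[OF assms(1)] assms(2) unfolding t by blast
    then show ?thesis using that 3 t by (simp add: settled_def)
  next
    assume t: "t = Tens Q (Leaf Bot m)"
    then show ?thesis using that[of t] pg_sim_refl[of "(rep P p t, \<Gamma>)"] 3 by (simp add: settled_def)
  qed
qed

lemma linking_part:
  assumes "proof_graph (rep P p u, \<Gamma>)" "p \<in> poss P" "\<not> is_leaf u"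
  shows "is_linking u"
  using pg_sub_linking[OF assms(1) poss_rep[OF assms(2)]] assms(3) by (simp add: sub_rep[OF assms(2)])

lemma leaf_names: "(x, i) \<in> set (leaves t) \<Longrightarrow> i \<in> names t"
  by (force simp: names_def)

text \<open>Unless a par is at hand, a side that is not anchored ends in a bottom. If the other side
  is anchored, that bottom is free to move; if both sides end in one, nesting frees one of them
  without saying which.\<close>

lemma shrinks_either:
  assumes p: "p \<in> poss P" and pg: "proof_graph (rep P p (Par L S), \<Gamma>)" and j: "joined \<Gamma> i j"
    and L: "settled x i L" "(x, i) \<in> set (leaves L)" and S: "settled y j S" "(y, j) \<in> set (leaves S)"
    and na: "\<not> (anchored x i L \<and> anchored y j S)"
  shows "shrinks \<Gamma> P p L S (x, i) \<or> shrinks \<Gamma> P p S L (y, j)"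
proof -
  note comm = sim_par_comm[OF p pg]
  note pg' = pg_sim_proof_graph[OF comm pg]
  note pr = poss_rep[OF p] and sr = sub_rep[OF p]
  consider A B where "L = Par A B" | A B where "S = Par A B"
    | Q m where "L = Tens Q (Leaf Bot m)" "(x, i) \<in> set (leaves Q)" "anchored y j S"
    | R n where "S = Tens R (Leaf Bot n)" "(y, j) \<in> set (leaves R)" "anchored x i L"
    | Q m R n where "L = Tens Q (Leaf Bot m)" "(x, i) \<in> set (leaves Q)" "S = Tens R (Leaf Bot n)" "(y, j) \<in> set (leaves R)"
    using L(1) S(1) na unfolding settled_def by blast
  then show ?thesis
  proof cases
    case 1
    then show ?thesis using shrinks_par[OF p] pg L(2) by blast
  next
    case 2
    then show ?thesis using shrinks_par[OF p] pg' S(2) by blast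
  next
    case 3
    have "detached (rep P p (Par L S)) \<Gamma> p S Q m"
      using detached_anchored[OF pg pr j] sr 3 leaf_names by metis
    then show ?thesis using shrinks_bot[OF p] pg 3 by blast
  next
    case 4
    have "detached (rep P p (Par S L)) \<Gamma> p L R n"
      using detached_anchored[OF pg' pr] joined_sym[of \<Gamma> i j] j sr 4 leaf_names by metis
    then show ?thesis using shrinks_bot[OF p] pg' 4 by blast
  next
    case 5
    have "detached (rep P p (Par L S)) \<Gamma> p S Q m \<or> detached (rep P p (Par L S)) \<Gamma> p L R n"
      using detached_either[OF pg pr j] sr 5 leaf_names by metis
    moreover have "detached (rep P p (Par L S)) \<Gamma> p L R n \<longleftrightarrow> detached (rep P p (Par S L)) \<Gamma> p L R n"
      using p by (rule detached_rep) simp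
    ultimately show ?thesis using shrinks_bot[OF p] pg pg' 5 by blast
  qed
qed

text \<open>The induction counts the leaves of both sides, since it cannot be prescribed which side
  shrinks.\<close>

lemma bring_together:
  assumes "p \<in> poss P" "proof_graph (rep P p (Par L S), \<Gamma>)" "joined \<Gamma> i j"
    "(x, i) \<in> set (leaves L)" "(y, j) \<in> set (leaves S)"
  shows "\<exists>P' p' L' S'. p' \<in> poss P' \<and> pg_sim (rep P p (Par L S), \<Gamma>) (rep P' p' (Par L' S'), \<Gamma>) \<and>
    anchored x i L' \<and> anchored y j S'"
  using assms
proof (induction "length (leaves L) + length (leaves S)" arbitrary: P p L S rule: less_induct)
  case less
  note p = less.prems(1) and pg = less.prems(2) and j = less.prems(3)
  have lk: "is_linking L" "is_linking S" using linking_part[OF pg p] by simp_all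
  define B where "B = rep P p (Par L S)"
  have pF: "p @ [False] \<in> poss B" unfolding B_def using p by (intro poss_into) auto
  have eF: "rep P p (Par t S) = rep B (p @ [False]) t" for t unfolding B_def using p by (simp add: rep_into)
  from settle[OF pF pg[unfolded eF] lk(1) less.prems(4)] obtain L0 where
    L0: "pg_sim (rep P p (Par L S), \<Gamma>) (rep P p (Par L0 S), \<Gamma>)" "mset (leaves L0) = mset (leaves L)" "settled x i L0"
    unfolding eF[symmetric] by blast
  note pg0 = pg_sim_proof_graph[OF L0(1) pg]
  define C where "C = rep P p (Par L0 S)"
  have pT: "p @ [True] \<in> poss C" unfolding C_def using p by (intro poss_into) auto
  have eT: "rep P p (Par L0 t) = rep C (p @ [True]) t" for t unfolding C_def using p by (simp add: rep_into)
  from settle[OF pT pg0[unfolded eT] lk(2) less.prems(5)] obtain S0 where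
    S0: "pg_sim (rep P p (Par L0 S), \<Gamma>) (rep P p (Par L0 S0), \<Gamma>)" "mset (leaves S0) = mset (leaves S)" "settled y j S0"
    unfolding eT[symmetric] by blast
  note sim = pg_sim_trans[OF L0(1) S0(1)]
  note pg1 = pg_sim_proof_graph[OF sim pg]
  have lv: "(x, i) \<in> set (leaves L0)" "(y, j) \<in> set (leaves S0)"
    using less.prems(4,5) mset_eq_setD[OF L0(2)] mset_eq_setD[OF S0(2)] by auto
  have len: "length (leaves L0) = length (leaves L)" "length (leaves S0) = length (leaves S)"
    using L0(2) S0(2) by (auto dest: mset_eq_length)
  show ?case
  proof (cases "anchored x i L0 \<and> anchored y j S0")
    case True
    then show ?thesis using sim p by blast
  next
    case False
    from shrinks_either[OF p pg1 j L0(3) lv(1) S0(3) lv(2) False] show ?thesis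
    proof
      assume "shrinks \<Gamma> P p L0 S0 (x, i)"
      then obtain P1 p1 L1 where 1: "p1 \<in> poss P1" "pg_sim (rep P p (Par L0 S0), \<Gamma>) (rep P1 p1 (Par L1 S0), \<Gamma>)"
        "length (leaves L1) < length (leaves L0)" "(x, i) \<in> set (leaves L1)" unfolding shrinks_def by blast
      note sim1 = pg_sim_trans[OF sim 1(2)]
      have "length (leaves L1) + length (leaves S0) < length (leaves L) + length (leaves S)" using 1(3) len by simp
      from less.hyps[OF this 1(1) pg_sim_proof_graph[OF sim1 pg] j 1(4) lv(2)] obtain P' p' L' S' where
        "p' \<in> poss P'" "pg_sim (rep P1 p1 (Par L1 S0), \<Gamma>) (rep P' p' (Par L' S'), \<Gamma>)" "anchored x i L'" "anchored y j S'"
        by blast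
      then show ?thesis using pg_sim_trans[OF sim1] by blast
    next
      assume "shrinks \<Gamma> P p S0 L0 (y, j)"
      then obtain P1 p1 S1 where 1: "p1 \<in> poss P1" "pg_sim (rep P p (Par S0 L0), \<Gamma>) (rep P1 p1 (Par S1 L0), \<Gamma>)"
        "length (leaves S1) < length (leaves S0)" "(y, j) \<in> set (leaves S1)" unfolding shrinks_def by blast
      note sim1 = pg_sim_trans[OF pg_sim_trans[OF sim sim_par_comm[OF p pg1]] 1(2)]
      \<comment> \<open>The sides were exchanged in order to shrink the right one; here they are
        exchanged back.\<close>
      note sim2 = pg_sim_trans[OF sim1 sim_par_comm[OF 1(1) pg_sim_proof_graph[OF sim1 pg]]]
      have "length (leaves L0) + length (leaves S1) < length (leaves L) + length (leaves S)" using 1(3) len by simp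
      from less.hyps[OF this 1(1) pg_sim_proof_graph[OF sim2 pg] j lv(1) 1(4)] obtain P' p' L' S' where
        "p' \<in> poss P'" "pg_sim (rep P1 p1 (Par L0 S1), \<Gamma>) (rep P' p' (Par L' S'), \<Gamma>)" "anchored x i L'" "anchored y j S'"
        by blast
      then show ?thesis using pg_sim_trans[OF sim2] by blast
    qed
  qed
qed

subsection \<open>Cut elimination\<close>

lemma leaves_separated:
  assumes "u \<in> set (leaves t)" "v \<in> set (leaves t)" "u \<noteq> v"
  obtains p A B where "p \<in> poss t" "sub t p = Tens A B \<or> sub t p = Par A B"
    "u \<in> set (leaves A) \<and> v \<in> set (leaves B) \<or> v \<in> set (leaves A) \<and> u \<in> set (leaves B)"
proof -
  define sep where "sep t \<longleftrightarrow> (\<exists>A B. (t = Tens A B \<or> t = Par A B) \<and>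
    (u \<in> set (leaves A) \<and> v \<in> set (leaves B) \<or> v \<in> set (leaves A) \<and> u \<in> set (leaves B)))" for t
  have "\<exists>p\<in>poss t. sep (sub t p)"
    using assms
  proof (induction t)
    case (Tens A B)
    show ?case
    proof (cases "sep (Tens A B)")
      case True
      then show ?thesis by (intro bexI[of _ "[]"]) auto
    next
      case False
      then show ?thesis using Tens by (auto simp: sep_def bex_Un)
    qed
  next
    case (Par A B)
    show ?case
    proof (cases "sep (Par A B)")
      case True
      then show ?thesis by (intro bexI[of _ "[]"]) auto
    next
      case False
      then show ?thesis using Par by (auto simp: sep_def bex_Un)
    qed
  qed simp
  then show thesis using that unfolding sep_def by blast
qed

lemma siblings:
  assumes pg: "proof_graph (P, add_mset (Cut (Leaf x i) (Leaf y j)) \<Gamma>)" and xy: "x \<noteq> y"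
  obtains P' p' L S where "p' \<in> poss P'"
    "pg_sim (P, add_mset (Cut (Leaf x i) (Leaf y j)) \<Gamma>) (rep P' p' (Par L S), add_mset (Cut (Leaf x i) (Leaf y j)) \<Gamma>)"
    "anchored x i L" "anchored y j S"
proof -
  let ?\<Delta> = "add_mset (Cut (Leaf x i) (Leaf y j)) \<Gamma>"
  have "mset (leaves P) = {#(x, i), (y, j)#} + seq_leaves \<Gamma>" using pg unfolding proof_graph_iff by simp
  then have "(x, i) \<in># mset (leaves P)" "(y, j) \<in># mset (leaves P)" by simp_all
  then have "(x, i) \<in> set (leaves P)" "(y, j) \<in> set (leaves P)" by simp_all
  from leaves_separated[OF this] xy obtain p A B where p: "p \<in> poss P" "sub P p = Tens A B \<or> sub P p = Par A B"
    and lr: "(x, i) \<in> set (leaves A) \<and> (y, j) \<in> set (leaves B) \<or> (y, j) \<in> set (leaves A) \<and> (x, i) \<in> set (leaves B)"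
    by blast
  have "i \<in> names A \<and> j \<in> names B \<or> j \<in> names A \<and> i \<in> names B" using lr leaf_names by blast
  then have par: "sub P p = Par A B" using no_cut_across_tens[OF pg p(1)] p(2) by blast
  then have eq: "P = rep P p (Par A B)" using rep_sub[OF p(1)] by simp
  have pg': "proof_graph (rep P p (Par A B), ?\<Delta>)" using pg eq by simp
  have j: "joined ?\<Delta> i j" unfolding joined_def by auto
  from lr show thesis
  proof
    assume "(x, i) \<in> set (leaves A) \<and> (y, j) \<in> set (leaves B)"
    then show thesis using bring_together[OF p(1) pg' j] that eq by metis
  next
    assume h: "(y, j) \<in> set (leaves A) \<and> (x, i) \<in> set (leaves B)"
    have c: "pg_sim (P, ?\<Delta>) (rep P p (Par B A), ?\<Delta>)" using sim_par_comm[OF p(1) pg'] eq by simp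
    then obtain P' p' L S where "p' \<in> poss P'" "pg_sim (rep P p (Par B A), ?\<Delta>) (rep P' p' (Par L S), ?\<Delta>)"
      "anchored x i L" "anchored y j S"
      using bring_together[OF p(1) pg_sim_proof_graph[OF c pg] j] h by blast
    then show thesis using pg_sim_trans[OF c] that by blast
  qed
qed

text \<open>In a linking, a tensor with an atom as a premise can only be an axiom link.\<close>

lemma anchored_atom:
  assumes "is_linking t" "is_atomic x" "anchored x i t"
  obtains h where "t = Tens (Leaf (dlit x) h) (Leaf x i) \<or> t = Tens (Leaf x i) (Leaf (dlit x) h)"
  using assms(1) by cases (use assms(2,3) that in \<open>auto simp: anchored_def split: if_splits\<close>)

lemma sim_left_tens_comm:
  assumes "p \<in> poss P" "proof_graph (rep P p (Par (Tens A B) S), \<Gamma>)"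
  shows "pg_sim (rep P p (Par (Tens A B) S), \<Gamma>) (rep P p (Par (Tens B A) S), \<Gamma>)"
proof -
  define C where "C = rep P p (Par A S)"
  have "p @ [False] \<in> poss C" unfolding C_def using assms(1) by (intro poss_into) auto
  moreover have "rep P p (Par t S) = rep C (p @ [False]) t" for t unfolding C_def using assms(1) by (simp add: rep_into)
  ultimately show ?thesis using sim_tens_comm[of "p @ [False]" C A B \<Gamma>] assms(2) by simp
qed

lemma sim_right_tens_comm:
  assumes "p \<in> poss P" "proof_graph (rep P p (Par S (Tens A B)), \<Gamma>)"
  shows "pg_sim (rep P p (Par S (Tens A B)), \<Gamma>) (rep P p (Par S (Tens B A)), \<Gamma>)"
proof -
  define C where "C = rep P p (Par S A)"
  have "p @ [True] \<in> poss C" unfolding C_def using assms(1) by (intro poss_into) auto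
  moreover have "rep P p (Par S t) = rep C (p @ [True]) t" for t unfolding C_def using assms(1) by (simp add: rep_into)
  ultimately show ?thesis using sim_tens_comm[of "p @ [True]" C A B \<Gamma>] assms(2) by simp
qed

text \<open>Correctness of the result is demanded separately: \<open>gred\<close> rewrites raw
  graphs, while a step of nets must end in a net.\<close>

definition reducible :: "'a pgraph \<Rightarrow> bool" where
  "reducible G \<longleftrightarrow> (\<exists>G' H. pg_sim G G' \<and> gred G' H \<and> proof_graph H)"

lemma reducible_sim: "pg_sim G G' \<Longrightarrow> reducible G' \<Longrightarrow> reducible G"
  unfolding reducible_def using pg_sim_trans by blast

lemma reducible_atom:
  assumes pg: "proof_graph (P, add_mset (Cut (Leaf x i) (Leaf (dlit x) j)) \<Gamma>)" and x: "is_atomic x"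
  shows "reducible (P, add_mset (Cut (Leaf x i) (Leaf (dlit x) j)) \<Gamma>)"
proof -
  let ?\<Delta> = "add_mset (Cut (Leaf x i) (Leaf (dlit x) j)) \<Gamma>"
  have "x \<noteq> dlit x" by (cases x) auto
  from siblings[OF pg this] obtain P1 p L S where p: "p \<in> poss P1" and s1: "pg_sim (P, ?\<Delta>) (rep P1 p (Par L S), ?\<Delta>)"
    and an: "anchored x i L" "anchored (dlit x) j S" by metis
  note pg1 = pg_sim_proof_graph[OF s1 pg]
  have lk: "is_linking L" "is_linking S" using linking_part[OF pg1 p] by simp_all
  have x': "is_atomic (dlit x)" "dlit (dlit x) = x" using x by (cases x; simp)+
  obtain h where h: "L = Tens (Leaf (dlit x) h) (Leaf x i) \<or> L = Tens (Leaf x i) (Leaf (dlit x) h)"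
    using anchored_atom[OF lk(1) x an(1)] by blast
  obtain k where k: "S = Tens (Leaf x k) (Leaf (dlit x) j) \<or> S = Tens (Leaf (dlit x) j) (Leaf x k)"
    using anchored_atom[OF lk(2) x'(1) an(2)] unfolding x'(2) by blast
  let ?L = "Tens (Leaf (dlit x) h) (Leaf x i)" and ?S = "Tens (Leaf (dlit x) j) (Leaf x k)"
  have s2: "pg_sim (rep P1 p (Par L S), ?\<Delta>) (rep P1 p (Par ?L S), ?\<Delta>)"
    using h sim_left_tens_comm[OF p, of "Leaf x i" "Leaf (dlit x) h" S ?\<Delta>] pg1 pg_sim_refl by metis
  note s12 = pg_sim_trans[OF s1 s2]
  have s3: "pg_sim (rep P1 p (Par ?L S), ?\<Delta>) (rep P1 p (Par ?L ?S), ?\<Delta>)"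
    using k sim_right_tens_comm[OF p, of ?L "Leaf x k" "Leaf (dlit x) j" ?\<Delta>] pg_sim_proof_graph[OF s12 pg] pg_sim_refl by metis
  note s = pg_sim_trans[OF s12 s3]
  let ?P = "rep P1 p (Par ?L ?S)" and ?u = "Tens (Leaf (dlit x) h) (Leaf x k)"
  note pp = poss_rep[OF p, of "Par ?L ?S"] and sp = sub_rep[OF p, of "Par ?L ?S"]
  have "gred (?P, \<Gamma> + {#Cut (Leaf x i) (Leaf (dlit x) j)#}) (rep ?P p ?u, \<Gamma>)"
    by (rule gred.red_ax[OF pp x sp])
  then have "gred (?P, ?\<Delta>) (rep ?P p ?u, \<Gamma>)" by simp
  moreover have "proof_graph (rep ?P p ?u, \<Gamma>)"
    by (rule proof_graph_red_ax[OF pg_sim_proof_graph[OF s pg] pp x sp])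
  ultimately show ?thesis using s unfolding reducible_def by blast
qed

lemma reducible_unit:
  assumes pg: "proof_graph (P, add_mset (Cut (Leaf Bot i) (Leaf One j)) \<Gamma>)"
  shows "reducible (P, add_mset (Cut (Leaf Bot i) (Leaf One j)) \<Gamma>)"
proof -
  let ?\<Delta> = "add_mset (Cut (Leaf Bot i) (Leaf One j)) \<Gamma>"
  have "Bot \<noteq> (One :: 'a lit)" by simp
  from siblings[OF pg this] obtain P1 p L S where p: "p \<in> poss P1" and s1: "pg_sim (P, ?\<Delta>) (rep P1 p (Par L S), ?\<Delta>)"
    and an: "anchored Bot i L" "anchored One j S" by metis
  note pg1 = pg_sim_proof_graph[OF s1 pg]
  have S: "S = Leaf One j" using an(2) by (simp add: anchored_def)
  obtain Q where Q: "L = Tens Q (Leaf Bot i) \<or> L = Tens (Leaf Bot i) Q" using an(1) by (auto simp: anchored_def)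
  let ?L = "Tens Q (Leaf Bot i)"
  have s2: "pg_sim (rep P1 p (Par L S), ?\<Delta>) (rep P1 p (Par ?L S), ?\<Delta>)"
    using Q sim_left_tens_comm[OF p, of "Leaf Bot i" Q S ?\<Delta>] pg1 pg_sim_refl by metis
  note s = pg_sim_trans[OF s1 s2, unfolded S]
  let ?P = "rep P1 p (Par ?L (Leaf One j))"
  note pp = poss_rep[OF p, of "Par ?L (Leaf One j)"] and sp = sub_rep[OF p, of "Par ?L (Leaf One j)"]
  have "gred (?P, \<Gamma> + {#Cut (Leaf Bot i) (Leaf One j)#}) (rep ?P p Q, \<Gamma>)"
    by (rule gred.red_unit[OF pp sp])
  then have "gred (?P, ?\<Delta>) (rep ?P p Q, \<Gamma>)" by simp
  moreover have "proof_graph (rep ?P p Q, \<Gamma>)"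
    by (rule proof_graph_red_unit[OF pg_sim_proof_graph[OF s pg] pp sp])
  ultimately show ?thesis using s unfolding reducible_def by blast
qed

lemma reducible_par:
  assumes "proof_graph (P, add_mset (Cut (Par A B) (Tens B' A')) \<Gamma>)"
  shows "reducible (P, add_mset (Cut (Par A B) (Tens B' A')) \<Gamma>)"
  using gred.red_par[of P \<Gamma> A B B' A'] proof_graph_red_par[OF assms] pg_sim_refl[of "(P, add_mset (Cut (Par A B) (Tens B' A')) \<Gamma>)"]
  unfolding reducible_def by (auto simp: add_mset_commute)

lemma dual_dual [simp]: "dual (dual t) = t"
proof (induction t)
  case (Leaf l i)
  then show ?case by (cases l) auto
qed auto

lemma erase_dual: "erase (dual t) = dual (erase t)"
  by (induction t) auto

text \<open>The definition of \<open>item_ok\<close> treats the sides of a cut differently; symmetry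
  rests on duality being an involution that commutes with erasing names.\<close>

lemma item_ok_sym: "item_ok (Cut A B) \<Longrightarrow> item_ok (Cut B A)"
  by (simp add: erase_dual)

lemma sim_cut_sym:
  assumes "proof_graph (P, add_mset (Cut A B) \<Gamma>)"
  shows "pg_sim (P, add_mset (Cut A B) \<Gamma>) (P, add_mset (Cut B A) \<Gamma>)"
proof -
  have "item_ok (Cut A B)" using assms unfolding proof_graph_iff by (metis union_single_eq_member)
  then show ?thesis using sim_step.cut_sym[of P \<Gamma> A B] proof_graph_cut_sym[OF assms item_ok_sym] assms
    by (intro pg_sim_step) auto
qed

lemma cut_reducible:
  assumes pg: "proof_graph (P, \<Delta>)" and c: "c \<in># \<Delta>" "is_cut c"
  shows "reducible (P, \<Delta>)"
proof -
  obtain A B where AB: "c = Cut A B" using c(2) by (cases c) auto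
  obtain \<Gamma> where D: "\<Delta> = add_mset (Cut A B) \<Gamma>" using c(1) AB by (meson mset_add)
  have ok: "erase B = erase (dual A)" using pg c(1) AB unfolding proof_graph_iff by fastforce
  note pg = pg[unfolded D]
  note sym = sim_cut_sym[OF pg]
  note pg' = pg_sim_proof_graph[OF sym pg]
  show ?thesis
  proof (cases A)
    case (Par A1 A2)
    then obtain B1 B2 where "B = Tens B2 B1" using ok by (cases B) auto
    then show ?thesis using reducible_par pg Par D by metis
  next
    case (Tens A1 A2)
    then obtain B1 B2 where "B = Par B1 B2" using ok by (cases B) auto
    then show ?thesis using reducible_par pg' Tens D reducible_sim[OF sym] by metis
  next
    case (Leaf x i)
    then obtain j where B: "B = Leaf (dlit x) j" using ok by (cases B) auto
    consider "is_atomic x" | "x = Bot" | "x = One" by (cases x) auto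
    then show ?thesis
    proof cases
      case 1
      then show ?thesis using reducible_atom pg B Leaf D by metis
    next
      case 2
      then have "B = Leaf One j" using B by simp
      then show ?thesis using reducible_unit pg 2 Leaf D by metis
    next
      case 3
      then have "B = Leaf Bot j" using B by simp
      then show ?thesis using reducible_unit pg' 3 Leaf D reducible_sim[OF sym] by metis
    qed
  qed
qed

text \<open>A tree with n leaves has n - 1 binary nodes, and \<open>itree\<close> supplies the cut
  node. The subtraction never truncates, since every tree has a leaf.\<close>

definition weight :: "'a pgraph \<Rightarrow> nat" where
  "weight G = (\<Sum>c\<in>#snd G. length (leaves (itree c)) - 1)"

lemma weight_sim_step: "sim_step G H \<Longrightarrow> weight G = weight H"
  by (induction rule: sim_step.induct) (auto simp: weight_def)

lemma weight_sim: "pg_sim G H \<Longrightarrow> weight G = weight H"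
  unfolding pg_sim_def by (induction rule: rtranclp_induct) (auto simp: weight_sim_step)

text \<open>The par rule keeps all leaves of the sequent but splits one item into two, which costs
  one node. The other rules remove an item with two leaves.\<close>

lemma weight_gred: "gred G H \<Longrightarrow> weight H < weight G"
proof (induction rule: gred.induct)
  case (red_par P \<Gamma> A B B' A')
  obtain a b where "length (leaves A) = Suc a" "length (leaves B) = Suc b"
    using length_leaves_pos(1) gr0_implies_Suc by metis
  then show ?case by (simp add: weight_def)
qed (auto simp: weight_def)

text \<open>Allows arbitrary representatives of consecutive nets to be compared.\<close>

lemma net_weight:
  assumes "is_net N" "G \<in> N" "H \<in> N" shows "weight G = weight H"
proof -
  obtain K where "N = {H. pg_sim K H}" using assms(1) unfolding is_net_def by blast
  then show ?thesis using assms(2,3) weight_sim[of K G] weight_sim[of K H] by simp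
qed

theorem theorem1p26:
  shows "(\<nexists>f :: nat \<Rightarrow> 'a pgraph set. \<forall>n. net_red (f n) (f (Suc n))) \<and>
         (\<forall>N :: 'a pgraph set. is_net N \<longrightarrow> ((\<nexists>M. net_red N M) \<longleftrightarrow> cut_free_net N))"
proof (intro conjI allI impI notI)
  assume "\<exists>f :: nat \<Rightarrow> 'a pgraph set. \<forall>n. net_red (f n) (f (Suc n))"
  then obtain f :: "nat \<Rightarrow> 'a pgraph set" where f: "net_red (f n) (f (Suc n))" for n by blast
  have ex: "\<exists>g. g \<in> f n" for n using f[of n] unfolding net_red_def by blast
  \<comment> \<open>Any representative will do, since the weight depends on the net alone.\<close>
  define g where "g n = (SOME G. G \<in> f n)" for n
  have g: "g n \<in> f n" for n unfolding g_def using ex someI_ex by metis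
  have "weight (g (Suc n)) < weight (g n)" for n
  proof -
    obtain G H where GH: "G \<in> f n" "H \<in> f (Suc n)" "gred G H" "is_net (f n)" "is_net (f (Suc n))"
      using f[of n] unfolding net_red_def by blast
    then show ?thesis using weight_gred[OF GH(3)] net_weight g by metis
  qed
  then show False using wf_no_infinite_down_chainE[OF wf_measure[of weight], of g] by auto
next
  fix N :: "'a pgraph set" assume N: "is_net N"
  then obtain G0 where G0: "proof_graph G0" "N = {H. pg_sim G0 H}" unfolding is_net_def by blast
  show "(\<nexists>M. net_red N M) \<longleftrightarrow> cut_free_net N"
  proof
    assume nf: "\<nexists>M. net_red N M"
    show "cut_free_net N" unfolding cut_free_net_def
    proof (intro ballI notI)
      fix G c assume G: "G \<in> N" and c: "c \<in># snd G" "is_cut c"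
      obtain P \<Delta> where PD: "G = (P, \<Delta>)" by fastforce
      have "pg_sim G0 G" using G G0 by simp
      then have "reducible G" using cut_reducible[of P \<Delta> c] pg_sim_proof_graph[of G0 G] G0(1) c PD by simp
      then obtain G' H where r: "pg_sim G G'" "gred G' H" "proof_graph H" unfolding reducible_def by blast
      have "G' \<in> N" using pg_sim_trans[OF \<open>pg_sim G0 G\<close> r(1)] G0(2) by simp
      moreover have "H \<in> {K. pg_sim H K}" using pg_sim_refl by simp
      moreover have "is_net {K. pg_sim H K}" unfolding is_net_def using r(3) by blast
      ultimately have "net_red N {K. pg_sim H K}" unfolding net_red_def using N r(2) by blast
      then show False using nf by blast
    qed
  next
    assume cf: "cut_free_net N"
    show "\<nexists>M. net_red N M"
    proof
      assume "\<exists>M. net_red N M"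
      then obtain G H where "G \<in> N" "gred G H" unfolding net_red_def by blast
      \<comment> \<open>Every rule consumes a cut.\<close>
      from this(2) have "\<exists>c\<in>#snd G. is_cut c" by (induction rule: gred.induct) auto
      then show False using cf \<open>G \<in> N\<close> unfolding cut_free_net_def by blast
    qed
  qed
qed

end
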